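(* Suppose $u$ and $v$ are distributional solutions to the Navier–Stokes equations on $\mathbb R^d\times(0,T)$ for $d=2$ or $d=3$. Suppose also that $w=u-v\in L^\infty(0,T;L^2)\cap L^2(0,T;H^1)$ satisfies the energy inequality $$\partial_t\|w\|_{L^2}^2+2\|\nabla w\|_{L^2}^2\le-2\int(w\cdot\nabla u)\cdot w\,dx .$$ There exist universal constants $c_5>0$ and $C>0$ so that, if, at a given time, there exists $J\in\mathbb Z$ so that $$\frac{\|\Delta_{\le J}w\|_{L^2}^2}{\|\Delta_{>J}w\|_{L^2}^2}\le\frac{c_5\,2^{2J}}{\min\{\|u\|_{L^\infty},\sqrt{\|\nabla u\|_{L^\infty}}\}^2}-1$$ and $$2^{2J}\ge\frac{\min\{\|u\|_{L^\infty},\sqrt{\|\nabla u\|_{L^\infty}}\}^2}{c_5},$$ then, at that time, $$\partial_t\|w\|_{L^2}^2+\frac{C\min\{\|u\|_{L^\infty},\sqrt{\|\nabla u\|_{L^\infty}}\}^2}{2c_5}\|w\|_{L^2}^2<0,\qquad( * )$$ meaning the flows are not de-correlating at the given time. Similarly, $( * )$ also holds if there exists $h>0$ so that $$\frac{\|J_hw\|_{L^2}^2}{\|w-J_hw\|_{L^2}^2}\le\frac{c_5\,h^{-2}}{\min\{\|u\|_{L^\infty},\sqrt{\|\nabla u\|_{L^\infty}}\}^2}-1$$ and $$h^{-2}\ge\frac{\min\{\|u\|_{L^\infty},\sqrt{\|\nabla u\|_{L^\infty}}\}^2}{c_5}.$$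
   Context: The Navier–Stokes equations are $\partial_tu-\Delta u+u\cdot\nabla u+\nabla p=0$, $\nabla\cdot u=0$ (viscosity $1$). Littlewood–Paley: fix a non-negative radial $\chi\in C_0^\infty(B_1)$, $\chi=1$ on $B_{1/2}$; $\phi(\xi)=\chi(\xi/2)-\chi(\xi)$, $\phi_j(\xi)=\phi(2^{-j}\xi)$, $\dot\Delta_jf=\mathcal F^{-1}\phi_j*f$ for $j\in\mathbb Z$; $\Delta_{\le J}f=\sum_{j\le J}\dot\Delta_jf$ and $\Delta_{>J}f=f-\Delta_{\le J}f$. Interpolant: for $h>0$ fix a lattice of cubes $\{Q_i\}$ in $\mathbb R^d$ with side length $h$ (volume $h^d$), disjoint interiors, closures covering $\mathbb R^d$, one cube centered at the origin; $J_hf(x)=\sum_j\chi_{Q_j}(x)\frac1{|Q_j|}\int_{Q_j}f(y)\,dy$. All norms of $u$ and $w$ in the conditions and in $( * )$ are spatial norms over $\mathbb R^d$ evaluated at the given time. The conditions implicitly require the displayed quotients to be well defined (in particular nonzero denominators). *)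

theory Defs
  imports "HOL-Analysis.Analysis" "HOL-Probability.Essential_Supremum"
begin

definition pderiv_dir :: "'a::euclidean_space \<Rightarrow> ('a \<Rightarrow> real) \<Rightarrow> 'a \<Rightarrow> real" where
  "pderiv_dir b f x = frechet_derivative f (at x) b"

definition iter_pderiv :: "'a::euclidean_space list \<Rightarrow> ('a \<Rightarrow> real) \<Rightarrow> 'a \<Rightarrow> real" where
  "iter_pderiv bs f = foldr pderiv_dir bs f"

definition smooth :: "('a::euclidean_space \<Rightarrow> real) \<Rightarrow> bool" where
  "smooth f \<longleftrightarrow> (\<forall>bs. set bs \<subseteq> Basis \<longrightarrow> (\<forall>x. iter_pderiv bs f differentiable (at x)))"

definition supp :: "('a::euclidean_space \<Rightarrow> real) \<Rightarrow> 'a set" where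
  "supp f = closure {x. f x \<noteq> 0}"

definition test_fun :: "'a::euclidean_space set \<Rightarrow> ('a \<Rightarrow> real) \<Rightarrow> bool" where
  "test_fun \<Omega> f \<longleftrightarrow> smooth f \<and> compact (supp f) \<and> supp f \<subseteq> \<Omega>"

text \<open>Continuity of a distribution is expressed by the usual seminorm estimates on compact sets.\<close>

definition distribution :: "'a::euclidean_space set \<Rightarrow> (('a \<Rightarrow> real) \<Rightarrow> real) \<Rightarrow> bool" where
  "distribution \<Omega> p \<longleftrightarrow>
     (\<forall>f g a b. test_fun \<Omega> f \<longrightarrow> test_fun \<Omega> g \<longrightarrow>
        p (\<lambda>x. a * f x + b * g x) = a * p f + b * p g) \<and>
     (\<forall>K. compact K \<longrightarrow> K \<subseteq> \<Omega> \<longrightarrow>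
        (\<exists>N A. \<forall>f. test_fun \<Omega> f \<longrightarrow> supp f \<subseteq> K \<longrightarrow>
           \<bar>p f\<bar> \<le> A * (\<Sum>bs \<in> {bs. set bs \<subseteq> Basis \<and> length bs \<le> N}.
                          (SUP x. \<bar>iter_pderiv bs f x\<bar>))))"

definition loc_integrable ::
    "'a::euclidean_space set \<Rightarrow> ('a \<Rightarrow> 'b::euclidean_space) \<Rightarrow> bool" where
  "loc_integrable \<Omega> f \<longleftrightarrow> (\<forall>K. compact K \<longrightarrow> K \<subseteq> \<Omega> \<longrightarrow> set_integrable lebesgue K f)"

definition time_dir :: "real \<times> (real^'n)" where
  "time_dir = (1, 0)"

definition space_dir :: "'n::finite \<Rightarrow> real \<times> (real^'n)" where
  "space_dir i = (0, axis i 1)"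

definition space_time :: "real \<Rightarrow> (real \<times> (real^'n)) set" where
  "space_time T = {0<..<T} \<times> UNIV"

text \<open>The nonlinearity is read as the divergence of the tensor product of \<open>u\<close> with itself, so \<open>u\<close>
  is required to be locally square integrable in space-time.  The pressure is an arbitrary
  distribution.  All derivatives have been moved to the test function, and the overall sign of
  the momentum equation has been changed.\<close>

definition ns_solution :: "real \<Rightarrow> (real \<Rightarrow> real^'n \<Rightarrow> real^'n) \<Rightarrow> bool" where
  "ns_solution T u \<longleftrightarrow>
     loc_integrable (space_time T) (\<lambda>(t, x). u t x) \<and>
     loc_integrable (space_time T) (\<lambda>(t, x). (norm (u t x))\<^sup>2) \<and>
     (\<forall>f. test_fun (space_time T) f \<longrightarrow>
        (LINT (t, x)|lebesgue. (\<Sum>j\<in>UNIV. u t x $ j * pderiv_dir (space_dir j) f (t, x))) = 0) \<and>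
     (\<exists>p. distribution (space_time T) p \<and>
        (\<forall>f i. test_fun (space_time T) f \<longrightarrow>
           (LINT (t, x)|lebesgue.
               u t x $ i * pderiv_dir time_dir f (t, x)
             + u t x $ i * (\<Sum>j\<in>UNIV. pderiv_dir (space_dir j) (pderiv_dir (space_dir j) f) (t, x))
             + (\<Sum>j\<in>UNIV. u t x $ j * u t x $ i * pderiv_dir (space_dir j) f (t, x)))
           + p (pderiv_dir (space_dir i) f) = 0))"

definition in_L2 :: "(real^'n \<Rightarrow> 'b::euclidean_space) \<Rightarrow> bool" where
  "in_L2 f \<longleftrightarrow> f \<in> borel_measurable lebesgue \<and> integrable lebesgue (\<lambda>x. (norm (f x))\<^sup>2)"

definition L2_norm :: "(real^'n \<Rightarrow> 'b::euclidean_space) \<Rightarrow> real" where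
  "L2_norm f = sqrt (LINT x|lebesgue. (norm (f x))\<^sup>2)"

text \<open>The entry \<open>F x $ i $ j\<close> is the derivative of the component \<open>i\<close> of \<open>f\<close> in direction \<open>j\<close>, and the
  norm of a matrix is the Frobenius norm.\<close>

definition has_weak_grad :: "(real^'n \<Rightarrow> real^'n) \<Rightarrow> (real^'n \<Rightarrow> real^'n^'n) \<Rightarrow> bool" where
  "has_weak_grad f F \<longleftrightarrow>
     loc_integrable UNIV f \<and> loc_integrable UNIV F \<and>
     (\<forall>g i j. test_fun UNIV g \<longrightarrow>
        (LINT x|lebesgue. f x $ i * pderiv_dir (axis j 1) g x)
        = - (LINT x|lebesgue. F x $ i $ j * g x))"

text \<open>Weak gradients are unique up to null sets, so the choice below is immaterial.\<close>

definition weak_grad :: "(real^'n \<Rightarrow> real^'n) \<Rightarrow> real^'n \<Rightarrow> real^'n^'n" where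
  "weak_grad f = (SOME F. has_weak_grad f F)"

definition in_H1 :: "(real^'n \<Rightarrow> real^'n) \<Rightarrow> bool" where
  "in_H1 f \<longleftrightarrow> in_L2 f \<and> (\<exists>F. has_weak_grad f F \<and> in_L2 F)"

definition in_LinfL2_L2H1 :: "real \<Rightarrow> (real \<Rightarrow> real^'n \<Rightarrow> real^'n) \<Rightarrow> bool" where
  "in_LinfL2_L2H1 T w \<longleftrightarrow>
     (\<lambda>(t, x). w t x) \<in> borel_measurable (lebesgue_on (space_time T)) \<and>
     (\<exists>M. AE t in lebesgue_on {0<..<T}. in_L2 (w t) \<and> L2_norm (w t) \<le> M) \<and>
     (AE t in lebesgue_on {0<..<T}. in_H1 (w t)) \<and>
     set_integrable lebesgue {0<..<T} (\<lambda>t. (L2_norm (w t))\<^sup>2 + (L2_norm (weak_grad (w t)))\<^sup>2)"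

definition Linf_norm :: "(real^'n \<Rightarrow> 'b::euclidean_space) \<Rightarrow> ereal" where
  "Linf_norm f = esssup lebesgue (\<lambda>x. ereal (norm (f x)))"

definition Linf_norm_grad :: "(real^'n \<Rightarrow> real^'n) \<Rightarrow> ereal" where
  "Linf_norm_grad f = (if \<exists>F. has_weak_grad f F then Linf_norm (weak_grad f) else \<infinity>)"

text \<open>Only used for nonnegative arguments.\<close>

definition sqrt_ereal :: "ereal \<Rightarrow> ereal" where
  "sqrt_ereal x = (if x = \<infinity> then \<infinity> else ereal (sqrt (real_of_ereal x)))"

definition min_norm :: "(real^'n \<Rightarrow> real^'n) \<Rightarrow> ereal" where
  "min_norm f = min (Linf_norm f) (sqrt_ereal (Linf_norm_grad f))"

text \<open>A function in a Bochner space is only determined at almost every time; \<open>G\<close> is the set of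
  times at which it is evaluated, and the time derivative is taken along \<open>G\<close>.  It is the
  ordinary derivative if \<open>G = {0<..<T}\<close>.  The conditions on \<open>u\<close> and \<open>w\<close> at time \<open>t\<close> say that the
  terms of the inequality are well defined.\<close>

definition energy_ineq_at ::
    "real set \<Rightarrow> (real \<Rightarrow> real^'n \<Rightarrow> real^'n) \<Rightarrow> (real \<Rightarrow> real^'n \<Rightarrow> real^'n) \<Rightarrow> real \<Rightarrow> real \<Rightarrow> bool" where
  "energy_ineq_at G u w t D \<longleftrightarrow>
     in_H1 (w t) \<and> (\<exists>F. has_weak_grad (u t) F) \<and>
     integrable lebesgue (\<lambda>x. (weak_grad (u t) x *v w t x) \<bullet> w t x) \<and>
     ((\<lambda>s. (L2_norm (w s))\<^sup>2) has_real_derivative D) (at t within G) \<and>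
     D + 2 * (L2_norm (weak_grad (w t)))\<^sup>2
       \<le> - 2 * (LINT x|lebesgue. (weak_grad (u t) x *v w t x) \<bullet> w t x)"

text \<open>The times at which the inequality holds form a set of full measure in \<open>{0<..<T}\<close>.\<close>

definition energy_inequality ::
    "real \<Rightarrow> real set \<Rightarrow> (real \<Rightarrow> real^'n \<Rightarrow> real^'n) \<Rightarrow> (real \<Rightarrow> real^'n \<Rightarrow> real^'n)
      \<Rightarrow> (real \<Rightarrow> real) \<Rightarrow> bool" where
  "energy_inequality T G u w D \<longleftrightarrow>
     G \<subseteq> {0<..<T} \<and> (AE t in lebesgue_on {0<..<T}. t \<in> G) \<and>
     (\<forall>t\<in>G. energy_ineq_at G u w t (D t))"

definition lp_cutoff :: "(real^'n \<Rightarrow> real) \<Rightarrow> bool" where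
  "lp_cutoff chi \<longleftrightarrow>
     test_fun (ball 0 1) chi \<and> (\<forall>x. 0 \<le> chi x) \<and>
     (\<forall>x y. norm x = norm y \<longrightarrow> chi x = chi y) \<and> (\<forall>x\<in>ball 0 (1/2). chi x = 1)"

definition lp_symbol :: "(real^'n \<Rightarrow> real) \<Rightarrow> int \<Rightarrow> real^'n \<Rightarrow> real" where
  "lp_symbol chi j \<xi> =
     (let \<phi> = (\<lambda>\<eta>. chi ((1/2) *\<^sub>R \<eta>) - chi \<eta>) in \<phi> ((2 powi (- j)) *\<^sub>R \<xi>))"

definition inv_fourier :: "(real^'n \<Rightarrow> real) \<Rightarrow> real^'n \<Rightarrow> complex" where
  "inv_fourier g x =
     (LINT \<xi>|lebesgue. g \<xi> *\<^sub>R cis (x \<bullet> \<xi>)) / of_real ((2 * pi) ^ CARD('n))"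

text \<open>The symbols are even, so their inverse Fourier transforms are real.\<close>

definition lp_block ::
    "(real^'n \<Rightarrow> real) \<Rightarrow> int \<Rightarrow> (real^'n \<Rightarrow> real^'n) \<Rightarrow> real^'n \<Rightarrow> real^'n" where
  "lp_block chi j f x = (LINT y|lebesgue. Re (inv_fourier (lp_symbol chi j) (x - y)) *\<^sub>R f y)"

text \<open>For square integrable \<open>f\<close> the series converges absolutely at every point, by
  Bernstein's inequality.\<close>

definition lp_low ::
    "(real^'n \<Rightarrow> real) \<Rightarrow> int \<Rightarrow> (real^'n \<Rightarrow> real^'n) \<Rightarrow> real^'n \<Rightarrow> real^'n" where
  "lp_low chi J f x = (\<Sum>\<^sub>\<infinity>j\<in>{..J}. lp_block chi j f x)"

definition lp_high ::
    "(real^'n \<Rightarrow> real) \<Rightarrow> int \<Rightarrow> (real^'n \<Rightarrow> real^'n) \<Rightarrow> real^'n \<Rightarrow> real^'n" where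
  "lp_high chi J f x = f x - lp_low chi J f x"

text \<open>The cubes are half-open, so that every point lies in exactly one of them.\<close>

definition grid_cube :: "real \<Rightarrow> int^'n \<Rightarrow> (real^'n) set" where
  "grid_cube h k = {x. \<forall>i. h * (of_int (k $ i) - 1/2) \<le> x $ i \<and> x $ i < h * (of_int (k $ i) + 1/2)}"

definition cube_interp :: "real \<Rightarrow> (real^'n \<Rightarrow> real^'n) \<Rightarrow> real^'n \<Rightarrow> real^'n" where
  "cube_interp h f x =
     (\<Sum>\<^sub>\<infinity>k\<in>UNIV. indicator (grid_cube h k) x *\<^sub>R
        ((1 / measure lebesgue (grid_cube h k)) *\<^sub>R (LINT y:grid_cube h k|lebesgue. f y)))"

end

theory Submission
  imports Defs "HOL-Probability.Probability"
begin

text \<open>Write \<open>W = \<parallel>w\<parallel>\<^sup>2\<close> and \<open>E = \<parallel>\<nabla>w\<parallel>\<^sup>2\<close> at the given time, and \<open>m\<close> for the minimum of the two norms of \<open>u\<close>.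
  The transport term is at most \<open>m\<^sup>2 W\<close> if \<open>m\<close> comes from \<open>\<nabla>u\<close>, and an integration by parts bounds it by a
  multiple of \<open>m \<parallel>w\<parallel> \<parallel>\<nabla>w\<parallel>\<close> otherwise; either way the energy inequality gives \<open>\<partial>\<^sub>t W + E \<le> K m\<^sup>2 W\<close>.
  For the high-frequency part \<open>H\<close> of \<open>w\<close>, obtained by subtracting a projection at length scale \<open>l\<close>, one has
  \<open>\<parallel>H\<parallel>\<^sup>2 \<le> B l\<^sup>2 E\<close>: the values \<open>H x\<close> are averages of increments \<open>w x - w (x - z)\<close> over \<open>z\<close> of size about \<open>l\<close>,
  and \<open>\<parallel>w - w(\<cdot> - z)\<parallel>\<^sup>2 \<le> norm z\<^sup>2 E\<close>. The hypothesis on the quotient turns this into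
  \<open>m\<^sup>2 W \<le> A c\<^sub>5 E\<close>, so for small \<open>c\<^sub>5\<close> the dissipation \<open>E\<close> absorbs \<open>K m\<^sup>2 W\<close>.\<close>

subsection \<open>Smooth functions, test functions and convolutions\<close>

text \<open>Fourier analysis enters only through the cutoff: the blocks telescope to one convolution
  kernel, whose total mass is \<open>chi 0 = 1\<close> by Fourier inversion at the origin. Unit mass
  turns \<open>w\<close> minus its projection into an average of increments; decay of the kernel
  supplies the second moment. The grid average has a kernel with the same two properties, so both
  conditions share one argument.

  Gradients are weak, so calculus is done on mollifications and carried over by limits; the
  mollifiers are rescaled copies of the given cutoff. The definitions use the completed Lebesgue
  measure and a chosen gradient, while Tonelli and translation arguments run on Borel
  representatives, to which the data of one fixed time are transferred.

  If \<open>A\<close> collects the projection constants and \<open>K\<close> the energy constants,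
  then c5 = 1/(4 A K) and C = 1/A, which depend on the dimension and the cutoff alone.\<close>

abbreviation sq_norm :: "('a::euclidean_space \<Rightarrow> 'b::euclidean_space) \<Rightarrow> real" where
  "sq_norm f \<equiv> \<integral>x. (norm (f x))\<^sup>2 \<partial>lborel"

text \<open>The \<open>ennreal\<close> version carries the estimates: it makes sense without
  integrability, whereas \<open>sq_norm\<close> is 0 when the integral diverges. Finiteness is read
  off from a bound here before passing to the real version.\<close>

abbreviation sq_nnorm :: "('a::euclidean_space \<Rightarrow> 'b::euclidean_space) \<Rightarrow> ennreal" where
  "sq_nnorm f \<equiv> \<integral>\<^sup>+x. ennreal ((norm (f x))\<^sup>2) \<partial>lborel"

abbreviation sq_integrable :: "('a::euclidean_space \<Rightarrow> 'b::euclidean_space) \<Rightarrow> bool" where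
  "sq_integrable f \<equiv> integrable lborel (\<lambda>x. (norm (f x))\<^sup>2)"

lemma pderiv_dir_eq:
  assumes "(f has_derivative D) (at x)"
  shows "pderiv_dir b f x = D b"
  unfolding pderiv_dir_def using frechet_derivative_at[OF assms] by simp

lemma has_derivative_pderiv_dir:
  fixes f :: "'a::euclidean_space \<Rightarrow> real"
  assumes "f differentiable (at x)"
  shows "(f has_derivative (\<lambda>h. \<Sum>b\<in>Basis. (h \<bullet> b) * pderiv_dir b f x)) (at x)"
proof -
  have d: "(f has_derivative frechet_derivative f (at x)) (at x)"
    using assms frechet_derivative_works by blast
  have l: "linear (frechet_derivative f (at x))"
    using assms linear_frechet_derivative by blast
  have "frechet_derivative f (at x) h = (\<Sum>b\<in>Basis. (h \<bullet> b) * pderiv_dir b f x)" for h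
  proof -
    have "frechet_derivative f (at x) h = frechet_derivative f (at x) (\<Sum>b\<in>Basis. (h \<bullet> b) *\<^sub>R b)"
      by (simp add: euclidean_representation)
    also have "\<dots> = (\<Sum>b\<in>Basis. (h \<bullet> b) * pderiv_dir b f x)"
      by (simp add: linear_sum[OF l] linear_cmul[OF l] pderiv_dir_def)
    finally show ?thesis .
  qed
  then have "frechet_derivative f (at x) = (\<lambda>h. \<Sum>b\<in>Basis. (h \<bullet> b) * pderiv_dir b f x)"
    by auto
  with d show ?thesis by simp
qed

lemma pderiv_dir_add:
  fixes f g :: "'a::euclidean_space \<Rightarrow> real"
  assumes "f differentiable (at x)" "g differentiable (at x)"
  shows "pderiv_dir b (\<lambda>x. f x + g x) x = pderiv_dir b f x + pderiv_dir b g x"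
  using pderiv_dir_eq[OF has_derivative_add[OF assms[unfolded frechet_derivative_works]], of b]
  by (simp add: pderiv_dir_def)

lemma pderiv_dir_mult:
  fixes f g :: "'a::euclidean_space \<Rightarrow> real"
  assumes "f differentiable (at x)" "g differentiable (at x)"
  shows "pderiv_dir b (\<lambda>x. f x * g x) x = f x * pderiv_dir b g x + pderiv_dir b f x * g x"
  using pderiv_dir_eq[OF has_derivative_mult[OF assms[unfolded frechet_derivative_works]], of b]
  by (simp add: pderiv_dir_def)

lemma pderiv_dir_cmult:
  fixes f :: "'a::euclidean_space \<Rightarrow> real"
  assumes "f differentiable (at x)"
  shows "pderiv_dir b (\<lambda>x. c * f x) x = c * pderiv_dir b f x"
  using pderiv_dir_mult[of "\<lambda>x. c" x f b] assms by (simp add: pderiv_dir_def)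

text \<open>A class of differentiable functions that is closed under single partial derivatives
  contains all iterated ones. Smoothness can thus be shown by exhibiting such a class, without
  induction over lists of directions.\<close>

lemma smooth_coinduct:
  assumes "P f"
    and diff: "\<And>g x. P g \<Longrightarrow> g differentiable (at x)"
    and step: "\<And>g b. P g \<Longrightarrow> b \<in> Basis \<Longrightarrow> P (pderiv_dir b g)"
  shows "smooth f"
proof -
  have "P (iter_pderiv bs f)" if "set bs \<subseteq> Basis" for bs
    using that by (induction bs) (auto simp: iter_pderiv_def \<open>P f\<close> step)
  then show ?thesis unfolding smooth_def using diff by blast
qed

lemma smooth_differentiable: "smooth f \<Longrightarrow> f differentiable (at x)"
  unfolding smooth_def iter_pderiv_def
  by (metis empty_set empty_subsetI foldr.simps(1) id_apply)

lemma smooth_pderiv_dir: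
  assumes "smooth f" "b \<in> Basis"
  shows "smooth (pderiv_dir b f)"
  unfolding smooth_def
proof (intro allI impI)
  fix bs :: "'a list" and x assume "set bs \<subseteq> Basis"
  then have "iter_pderiv (bs @ [b]) f differentiable (at x)"
    using assms unfolding smooth_def by auto
  then show "iter_pderiv bs (pderiv_dir b f) differentiable (at x)"
    by (simp add: iter_pderiv_def)
qed

lemma smooth_has_derivative:
  "smooth f \<Longrightarrow> (f has_derivative (\<lambda>h. \<Sum>b\<in>Basis. (h \<bullet> b) * pderiv_dir b f x)) (at x)"
  by (rule has_derivative_pderiv_dir[OF smooth_differentiable])

lemma smooth_continuous_on: "smooth f \<Longrightarrow> continuous_on S f"
  by (meson continuous_at_imp_continuous_on differentiable_imp_continuous_within smooth_differentiable)

text \<open>The rules contain exactly what the product and chain rules produce, so that the set is closed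
  under partial derivatives and coinduction applies.\<close>

inductive smooth_alg :: "('a::euclidean_space \<Rightarrow> real) \<Rightarrow> bool" where
  base: "smooth f \<Longrightarrow> smooth_alg f"
| const: "smooth_alg (\<lambda>x. c)"
| add: "smooth_alg f \<Longrightarrow> smooth_alg g \<Longrightarrow> smooth_alg (\<lambda>x. f x + g x)"
| mult: "smooth_alg f \<Longrightarrow> smooth_alg g \<Longrightarrow> smooth_alg (\<lambda>x. f x * g x)"
| comp: "smooth g \<Longrightarrow> (\<And>c. c \<in> Basis \<Longrightarrow> smooth (\<lambda>x. v x \<bullet> c)) \<Longrightarrow> smooth_alg (\<lambda>x::'a. g (v x :: 'a))"

lemma smooth_alg_sum:
  "(\<And>i. i \<in> A \<Longrightarrow> smooth_alg (f i)) \<Longrightarrow> smooth_alg (\<lambda>x. \<Sum>i\<in>A. f i x)"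
  by (induction A rule: infinite_finite_induct) (auto intro: smooth_alg.intros)

text \<open>The inner map goes from the space to itself because \<open>smooth_alg\<close> lives at
  one type. This covers the two compositions that occur: affine substitutions, and
  \<open>trunc_product\<close> applied to a mollified vector field.\<close>

lemma has_derivative_comp_pderiv_dir:
  fixes v :: "'a::euclidean_space \<Rightarrow> 'a"
  assumes g: "smooth g" and v: "\<And>c. c \<in> Basis \<Longrightarrow> smooth (\<lambda>x. v x \<bullet> c)"
  shows "((\<lambda>x. g (v x)) has_derivative
    (\<lambda>h. \<Sum>c\<in>Basis. (\<Sum>b\<in>Basis. (h \<bullet> b) * pderiv_dir b (\<lambda>x. v x \<bullet> c) x) * pderiv_dir c g (v x))) (at x)"
proof -
  have vd: "(v has_derivative (\<lambda>h. \<Sum>c\<in>Basis. (\<Sum>b\<in>Basis. (h \<bullet> b) * pderiv_dir b (\<lambda>x. v x \<bullet> c) x) *\<^sub>R c)) (at x)"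
  proof (subst has_derivative_componentwise_within, intro ballI)
    fix c :: 'a assume c: "c \<in> Basis"
    show "((\<lambda>x. v x \<bullet> c) has_derivative (\<lambda>h. (\<Sum>c\<in>Basis. (\<Sum>b\<in>Basis. (h \<bullet> b) * pderiv_dir b (\<lambda>x. v x \<bullet> c) x) *\<^sub>R c) \<bullet> c)) (at x)"
      using smooth_has_derivative[OF v[OF c], of x] c
      by (simp add: inner_sum_left_Basis)
  qed
  show ?thesis
    using has_derivative_compose[OF vd smooth_has_derivative[OF g, of "v x"]]
    by (simp add: inner_sum_left_Basis o_def cong: sum.cong)
qed

lemma pderiv_dir_comp:
  fixes v :: "'a::euclidean_space \<Rightarrow> 'a"
  assumes g: "smooth g" and v: "\<And>c. c \<in> Basis \<Longrightarrow> smooth (\<lambda>x. v x \<bullet> c)" and b: "b \<in> Basis"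
  shows "pderiv_dir b (\<lambda>x. g (v x)) x = (\<Sum>c\<in>Basis. pderiv_dir b (\<lambda>x. v x \<bullet> c) x * pderiv_dir c g (v x))"
  using pderiv_dir_eq[OF has_derivative_comp_pderiv_dir[OF g v, of x], where b=b] b
  by (simp add: inner_Basis if_distrib[of "\<lambda>t. t * _"] cong: if_cong)

lemma smooth_alg_step:
  assumes "smooth_alg f"
  shows "f differentiable (at x) \<and> (\<forall>b\<in>Basis. smooth_alg (pderiv_dir b f))"
  using assms
proof (induction arbitrary: x)
  case (base f)
  then show ?case by (auto intro: smooth_alg.base smooth_pderiv_dir smooth_differentiable)
next
  case (const c)
  have "pderiv_dir b (\<lambda>x. c) = (\<lambda>x. 0)" for b :: 'a
    by (auto simp: pderiv_dir_def)
  then show ?case by (auto intro: smooth_alg.const)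
next
  case (add f g)
  then have "pderiv_dir b (\<lambda>x. f x + g x) = (\<lambda>x. pderiv_dir b f x + pderiv_dir b g x)" for b
    by (intro ext pderiv_dir_add) auto
  with add show ?case by (auto intro: smooth_alg.add)
next
  case (mult f g)
  then have "pderiv_dir b (\<lambda>x. f x * g x) = (\<lambda>x. f x * pderiv_dir b g x + pderiv_dir b f x * g x)" for b
    by (intro ext pderiv_dir_mult) auto
  with mult show ?case by (auto intro!: smooth_alg.add smooth_alg.mult)
next
  case (comp g v)
  have "pderiv_dir b (\<lambda>x. g (v x)) = (\<lambda>x. \<Sum>c\<in>Basis. pderiv_dir b (\<lambda>x. v x \<bullet> c) x * pderiv_dir c g (v x))"
    if "b \<in> Basis" for b
    by (rule ext, rule pderiv_dir_comp[OF comp that])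
  moreover have "smooth_alg (\<lambda>x. \<Sum>c\<in>Basis. pderiv_dir b (\<lambda>x. v x \<bullet> c) x * pderiv_dir c g (v x))"
    if "b \<in> Basis" for b
    using comp that
    by (intro smooth_alg_sum smooth_alg.mult smooth_alg.comp smooth_alg.base smooth_pderiv_dir) auto
  ultimately show ?case
    using has_derivative_comp_pderiv_dir[OF comp, of x] by (auto simp: differentiable_def)
qed

lemma smooth_alg_smooth: "smooth_alg f \<Longrightarrow> smooth f"
  by (rule smooth_coinduct[of smooth_alg]) (auto dest: smooth_alg_step)

lemma smooth_const: "smooth (\<lambda>x. c)"
  by (rule smooth_alg_smooth[OF smooth_alg.const])

lemma smooth_add: "smooth f \<Longrightarrow> smooth g \<Longrightarrow> smooth (\<lambda>x. f x + g x)"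
  by (rule smooth_alg_smooth[OF smooth_alg.add[OF smooth_alg.base smooth_alg.base]])

lemma smooth_mult: "smooth f \<Longrightarrow> smooth g \<Longrightarrow> smooth (\<lambda>x. f x * g x)"
  by (rule smooth_alg_smooth[OF smooth_alg.mult[OF smooth_alg.base smooth_alg.base]])

lemma smooth_comp:
  fixes v :: "'a::euclidean_space \<Rightarrow> 'a"
  shows "smooth g \<Longrightarrow> (\<And>c. c \<in> Basis \<Longrightarrow> smooth (\<lambda>x. v x \<bullet> c)) \<Longrightarrow> smooth (\<lambda>x. g (v x))"
  by (rule smooth_alg_smooth[OF smooth_alg.comp])

lemma smooth_inner: "smooth (\<lambda>x::'a::euclidean_space. x \<bullet> c)"
proof (rule smooth_coinduct[of "\<lambda>f. (\<exists>c. f = (\<lambda>x. x \<bullet> c)) \<or> (\<exists>k. f = (\<lambda>x. k))"])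
  fix g :: "'a \<Rightarrow> real" and b x
  assume "(\<exists>c. g = (\<lambda>x. x \<bullet> c)) \<or> (\<exists>k. g = (\<lambda>x. k))"
  moreover have "pderiv_dir b (\<lambda>x. x \<bullet> c) = (\<lambda>x. b \<bullet> c)" for c :: 'a
    by (rule ext, rule pderiv_dir_eq) (auto intro!: derivative_eq_intros)
  moreover have "pderiv_dir b (\<lambda>x. k) = (\<lambda>x. 0)" for k :: real
    by (auto simp: pderiv_dir_def)
  ultimately show "(\<exists>c. pderiv_dir b g = (\<lambda>x. x \<bullet> c)) \<or> (\<exists>k. pderiv_dir b g = (\<lambda>x. k))"
    by auto
qed auto

lemma smooth_affine_comp:
  fixes g :: "'a::euclidean_space \<Rightarrow> real"
  assumes "smooth g"
  shows "smooth (\<lambda>x. g (a + r *\<^sub>R x))"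
proof (rule smooth_comp[OF assms])
  fix c :: 'a assume "c \<in> Basis"
  have "smooth (\<lambda>x. a \<bullet> c + r * (x \<bullet> c))"
    by (intro smooth_add smooth_mult smooth_const smooth_inner)
  then show "smooth (\<lambda>x. (a + r *\<^sub>R x) \<bullet> c)" by (simp add: inner_simps)
qed

lemma pderiv_dir_affine:
  fixes g :: "'a::euclidean_space \<Rightarrow> real"
  assumes "smooth g"
  shows "pderiv_dir b (\<lambda>x. g (a + r *\<^sub>R x)) x = r * pderiv_dir b g (a + r *\<^sub>R x)"
proof -
  let ?D = "frechet_derivative g (at (a + r *\<^sub>R x))"
  have d: "(g has_derivative ?D) (at (a + r *\<^sub>R x))"
    using assms frechet_derivative_works smooth_differentiable by blast
  have l: "linear ?D" using d has_derivative_linear by blast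
  have "((\<lambda>x. g (a + r *\<^sub>R x)) has_derivative (\<lambda>h. ?D (r *\<^sub>R h))) (at x)"
    by (rule has_derivative_compose[of "\<lambda>x. a + r *\<^sub>R x", OF _ d]) (auto intro!: derivative_eq_intros)
  from pderiv_dir_eq[OF this, of b] show ?thesis
    by (simp add: linear_cmul[OF l] pderiv_dir_def)
qed

lemma test_fun_smooth: "test_fun S f \<Longrightarrow> smooth f"
  by (simp add: test_fun_def)

lemma test_fun_UNIV: "test_fun S f \<Longrightarrow> test_fun UNIV f"
  by (simp add: test_fun_def)

text \<open>Together with \<open>test_funI\<close> this trades compactness of the closed support for
  vanishing outside some ball, a property that passes to products, derivatives and affine
  substitutions by elementary norm estimates.\<close>

lemma test_fun_zero_outside:
  assumes "test_fun S f"
  obtains R where "R > 0" "\<And>x. norm x > R \<Longrightarrow> f x = 0"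
proof -
  have "bounded (supp f)" using assms by (auto simp: test_fun_def compact_imp_bounded)
  then obtain R where R: "R > 0" "\<And>x. x \<in> supp f \<Longrightarrow> norm x \<le> R"
    unfolding bounded_pos by auto
  moreover have "f x = 0" if "norm x > R" for x
  proof (rule ccontr)
    assume "f x \<noteq> 0"
    then have "x \<in> supp f" unfolding supp_def using closure_subset by fastforce
    with R that show False by fastforce
  qed
  ultimately show ?thesis using that by blast
qed

lemma test_funI:
  assumes "smooth f" "\<And>x. norm x > R \<Longrightarrow> f x = 0"
  shows "test_fun UNIV f"
proof -
  have "supp f \<subseteq> cball 0 R"
    unfolding supp_def by (rule closure_minimal) (use assms(2) in \<open>force simp: not_less[symmetric]\<close>)+
  then have "compact (supp f)"
    by (metis bounded_cball bounded_subset closed_closure compact_eq_bounded_closed supp_def)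
  with assms(1) show ?thesis by (simp add: test_fun_def)
qed

lemma pderiv_dir_zero_outside:
  fixes f :: "'a::euclidean_space \<Rightarrow> real"
  assumes R: "\<And>x. norm x > R \<Longrightarrow> f x = 0" and x: "norm x > R"
  shows "pderiv_dir b f x = 0"
proof -
  have op: "open {x::'a. norm x > R}" by (intro open_Collect_less continuous_intros)
  have "(f has_derivative (\<lambda>h. 0)) (at x)"
    by (rule has_derivative_transform_within_open[OF has_derivative_const[of 0] op]) (use x R in auto)
  then show ?thesis by (rule pderiv_dir_eq)
qed

lemma test_fun_pderiv_dir:
  assumes "test_fun UNIV f" "b \<in> Basis"
  shows "test_fun UNIV (pderiv_dir b f)"
proof -
  obtain R where "\<And>x. norm x > R \<Longrightarrow> f x = 0"
    using test_fun_zero_outside[OF assms(1)] by blast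
  then show ?thesis
    using assms by (intro test_funI[of _ R] smooth_pderiv_dir pderiv_dir_zero_outside) (auto dest: test_fun_smooth)
qed

lemma test_fun_bounded:
  assumes "test_fun UNIV f"
  obtains B where "B > 0" "\<And>x. \<bar>f x\<bar> \<le> B"
proof -
  obtain R where R: "R > 0" "\<And>x. norm x > R \<Longrightarrow> f x = 0"
    using test_fun_zero_outside[OF assms(1)] by blast
  have "bounded (f ` cball 0 R)"
    by (intro compact_imp_bounded compact_continuous_image smooth_continuous_on test_fun_smooth[OF assms] compact_cball)
  then obtain B where B: "B > 0" "\<And>x. x \<in> cball 0 R \<Longrightarrow> \<bar>f x\<bar> \<le> B"
    unfolding bounded_pos by auto
  then have "\<bar>f x\<bar> \<le> B" for x
    using R(2)[of x] B by (cases "norm x \<le> R") auto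
  with B(1) show ?thesis using that by blast
qed

text \<open>Merges bounds found separately for each direction or index pair into one positive
  constant. The weight \<open>g\<close> is 1 for plain bounds and the norm for the gradient of the
  truncated products.\<close>

lemma finite_uniform_bound:
  fixes f :: "'i \<Rightarrow> 'a \<Rightarrow> real"
  assumes "finite I" and g: "\<And>x. g x \<ge> 0" and "\<And>i. i \<in> I \<Longrightarrow> \<exists>B. \<forall>x. f i x \<le> B * g x"
  shows "\<exists>B>0. \<forall>i\<in>I. \<forall>x. f i x \<le> B * g x"
  using assms(1,3)
proof (induction I)
  case (insert i I)
  obtain C where C: "\<And>x. f i x \<le> C * g x" using insert.prems[of i] by auto
  obtain B where B: "B > 0" "\<And>j x. j \<in> I \<Longrightarrow> f j x \<le> B * g x" using insert.IH insert.prems by auto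
  have le: "B * g x \<le> max B C * g x" "C * g x \<le> max B C * g x" for x
    by (rule mult_right_mono[OF _ g], simp)+
  have "f j x \<le> max B C * g x" if "j \<in> insert i I" for j x
    using that order_trans[OF C le(2)] order_trans[OF B(2) le(1)] by blast
  then show ?case using B(1) by (intro exI[of _ "max B C"]) (simp add: less_max_iff_disj)
qed (auto intro: exI[of _ 1])

lemma test_fun_affine_comp:
  fixes g :: "'a::euclidean_space \<Rightarrow> real"
  assumes "test_fun UNIV g" "r \<noteq> 0"
  shows "test_fun UNIV (\<lambda>x. g (a + r *\<^sub>R x))"
proof -
  obtain R where R: "R > 0" "\<And>x. norm x > R \<Longrightarrow> g x = 0"
    using test_fun_zero_outside[OF assms(1)] by blast
  show ?thesis
  proof (rule test_funI)
    show "smooth (\<lambda>x. g (a + r *\<^sub>R x))" using assms smooth_affine_comp test_fun_smooth by blast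
    fix x :: 'a assume "norm x > (R + norm a) / \<bar>r\<bar>"
    then have "\<bar>r\<bar> * norm x > R + norm a" using assms(2) by (simp add: field_simps)
    then have "norm (a + r *\<^sub>R x) > R"
      using norm_triangle_ineq2[of "r *\<^sub>R x" "- a"] by (simp add: algebra_simps)
    then show "g (a + r *\<^sub>R x) = 0" by (rule R)
  qed
qed

lemma test_fun_measurable: "test_fun S f \<Longrightarrow> f \<in> borel_measurable borel"
  by (intro borel_measurable_continuous_onI smooth_continuous_on test_fun_smooth)

lemma test_fun_mult:
  assumes f: "test_fun UNIV f" and g: "smooth g"
  shows "test_fun UNIV (\<lambda>x. f x * g x)"
proof -
  obtain R where R: "R > 0" "\<And>x. norm x > R \<Longrightarrow> f x = 0"
    using test_fun_zero_outside[OF f] by blast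
  show ?thesis
    by (rule test_funI[of _ R]) (use R in \<open>auto intro: smooth_mult test_fun_smooth[OF f] g\<close>)
qed

section \<open>Locally integrable functions and their convolution with test functions\<close>

definition loc_int :: "('a::euclidean_space \<Rightarrow> 'b::euclidean_space) \<Rightarrow> bool" where
  "loc_int f \<longleftrightarrow> f \<in> borel_measurable borel \<and> (\<forall>R. set_integrable lborel (cball 0 R) f)"

lemma loc_int_measurable [measurable_dest]: "loc_int f \<Longrightarrow> f \<in> borel_measurable borel"
  by (simp add: loc_int_def)

lemma loc_int_bounded_mult:
  fixes f :: "'a::euclidean_space \<Rightarrow> 'b::euclidean_space"
  assumes f: "loc_int f" and g: "g \<in> borel_measurable borel"
    and B: "\<And>x. \<bar>g x\<bar> \<le> B" and R: "\<And>x. norm x > R \<Longrightarrow> g x = 0"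
  shows "integrable lborel (\<lambda>x. g x *\<^sub>R f x)"
proof (rule Bochner_Integration.integrable_bound)
  show "integrable lborel (\<lambda>x. B *\<^sub>R (indicator (cball 0 R) x *\<^sub>R f x))"
    using f by (intro integrable_scaleR_right) (auto simp: loc_int_def set_integrable_def)
  show "(\<lambda>x. g x *\<^sub>R f x) \<in> borel_measurable lborel" using f g by measurable
  have "norm (g x *\<^sub>R f x) \<le> norm (B *\<^sub>R indicator (cball 0 R) x *\<^sub>R f x)" for x
    using B[of x] R[of x] by (cases "norm x \<le> R") (auto intro!: mult_right_mono)
  then show "AE x in lborel. norm (g x *\<^sub>R f x) \<le> norm (B *\<^sub>R indicator (cball 0 R) x *\<^sub>R f x)" by auto
qed

lemma loc_int_test_fun:
  assumes "loc_int f" "test_fun UNIV g"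
  shows "integrable lborel (\<lambda>x. g x *\<^sub>R f x)"
proof -
  obtain B where "\<And>x. \<bar>g x\<bar> \<le> B" using test_fun_bounded[OF assms(2)] by metis
  moreover obtain R where "\<And>x. norm x > R \<Longrightarrow> g x = 0" using test_fun_zero_outside[OF assms(2)] by blast
  ultimately show ?thesis
    using assms by (intro loc_int_bounded_mult[of f g B R] test_fun_measurable)
qed

text \<open>A scalar kernel acts on a vector-valued function. The kernels are test functions in the
  mollification arguments and \<open>lp_kernel\<close>, which decays without compact support, in the
  Littlewood--Paley part.\<close>

definition conv :: "('a::euclidean_space \<Rightarrow> real) \<Rightarrow> ('a \<Rightarrow> 'b::euclidean_space) \<Rightarrow> 'a \<Rightarrow> 'b" where
  "conv g f x = (LBINT y. g (x - y) *\<^sub>R f y)"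

lemma test_fun_reflect:
  assumes "test_fun UNIV g"
  shows "test_fun UNIV (\<lambda>y. g (x - y))"
  using test_fun_affine_comp[OF assms, of "-1" x] by simp

lemma conv_integrable:
  "loc_int f \<Longrightarrow> test_fun UNIV g \<Longrightarrow> integrable lborel (\<lambda>y. g (x - y) *\<^sub>R f y)"
  by (rule loc_int_test_fun[OF _ test_fun_reflect])

lemma conv_inner: "loc_int f \<Longrightarrow> test_fun UNIV g \<Longrightarrow> conv g f x \<bullet> c = conv g (\<lambda>y. f y \<bullet> c) x"
  unfolding conv_def by (simp add: integral_inner_left[symmetric] conv_integrable)

text \<open>The same constant bounds the derivative and the increments, so it dominates the whole
  remainder of the first-order expansion in \<open>conv_has_derivative\<close>.\<close>

lemma test_fun_lipschitz:
  fixes g :: "'a::euclidean_space \<Rightarrow> real"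
  assumes "test_fun UNIV g"
  obtains M where "M > 0" "\<And>x h. \<bar>\<Sum>b\<in>Basis. (h \<bullet> b) * pderiv_dir b g x\<bar> \<le> M * norm h"
    "\<And>x y. \<bar>g x - g y\<bar> \<le> M * norm (x - y)"
proof -
  have "\<exists>B. \<forall>x. \<bar>pderiv_dir b g x\<bar> \<le> B" if "b \<in> Basis" for b
    using test_fun_bounded[OF test_fun_pderiv_dir[OF assms that]] by metis
  then obtain B where B: "B > 0" "\<And>b x. b \<in> Basis \<Longrightarrow> \<bar>pderiv_dir b g x\<bar> \<le> B"
    using finite_uniform_bound[of Basis "\<lambda>_. 1" "\<lambda>b x. \<bar>pderiv_dir b g x\<bar>"] by auto
  define M where "M = real DIM('a) * B"
  have M: "M > 0" using B(1) by (simp add: M_def)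
  have bd: "\<bar>\<Sum>b\<in>Basis. (h \<bullet> b) * pderiv_dir b g x\<bar> \<le> M * norm h" for x h
  proof -
    have "\<bar>\<Sum>b\<in>Basis. (h \<bullet> b) * pderiv_dir b g x\<bar> \<le> (\<Sum>b\<in>(Basis :: 'a set). norm h * B)"
      using B by (intro order_trans[OF sum_abs] sum_mono)
        (auto simp: abs_mult intro!: mult_mono Basis_le_norm)
    then show ?thesis by (simp add: M_def mult_ac)
  qed
  have "norm (g x - g y) \<le> M * norm (x - y)" for x y
  proof (rule differentiable_bound[of UNIV g])
    show "onorm (\<lambda>h. \<Sum>b\<in>Basis. (h \<bullet> b) * pderiv_dir b g x) \<le> M" for x
      by (rule onorm_bound) (use bd M in auto)
    show "(g has_derivative (\<lambda>h. \<Sum>b\<in>Basis. (h \<bullet> b) * pderiv_dir b g x)) (at x within UNIV)" for x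
      using smooth_has_derivative[OF test_fun_smooth[OF assms]] by simp
  qed auto
  with bd M show ?thesis using that by (auto simp: real_norm_def)
qed

text \<open>Differentiation under the integral, by dominated convergence along sequences
  \<open>X\<close> that tend to \<open>x\<close>. The normalised remainder \<open>r n\<close> of the
  kernel is bounded by \<open>2 * M\<close>, vanishes outside one ball for all \<open>n\<close>, and
  tends to 0 pointwise; local integrability of \<open>f\<close> then suffices.\<close>

lemma conv_has_derivative:
  fixes f :: "'a::euclidean_space \<Rightarrow> 'b::euclidean_space"
  assumes f: "loc_int f" and g: "test_fun UNIV g"
  shows "(conv g f has_derivative (\<lambda>h. \<Sum>b\<in>Basis. (h \<bullet> b) *\<^sub>R conv (pderiv_dir b g) f x)) (at x)"
proof -
  obtain R where R: "R > 0" "\<And>x. norm x > R \<Longrightarrow> g x = 0"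
    using test_fun_zero_outside[OF g] by blast
  obtain M where M: "M > 0" "\<And>x h. \<bar>\<Sum>b\<in>Basis. (h \<bullet> b) * pderiv_dir b g x\<bar> \<le> M * norm h"
    "\<And>x y. \<bar>g x - g y\<bar> \<le> M * norm (x - y)"
    using test_fun_lipschitz[OF g] by blast
  have R0: "pderiv_dir b g x = 0" if "norm x > R" for x b
    by (rule pderiv_dir_zero_outside[OF R(2) that])
  have gm [measurable]: "g \<in> borel_measurable borel" "\<And>b. b \<in> Basis \<Longrightarrow> pderiv_dir b g \<in> borel_measurable borel"
    using g test_fun_pderiv_dir[OF g] by (auto intro: test_fun_measurable)
  have fm [measurable]: "f \<in> borel_measurable borel" using f by measurable
  define Dg where "Dg z h = (\<Sum>b\<in>Basis. (h \<bullet> b) * pderiv_dir b g z)" for z h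
  let ?D = "\<lambda>h. \<Sum>b\<in>Basis. (h \<bullet> b) *\<^sub>R conv (pderiv_dir b g) f x"
  have "bounded_linear ?D"
    by (intro bounded_linear_sum bounded_linear_scaleR_const bounded_linear_inner_left bounded_linear_ident)
  moreover have "((\<lambda>y. (conv g f y - conv g f x - ?D (y - x)) /\<^sub>R norm (y - x)) \<longlongrightarrow> 0) (at x)"
  proof (subst tendsto_at_iff_sequentially, intro allI impI)
    fix X assume X: "\<forall>i. X i \<in> UNIV - {x}" "X \<longlonglongrightarrow> x"
    define r where "r n y = (g (X n - y) - g (x - y) - Dg (x - y) (X n - x)) / norm (X n - x)" for n y
    have "Bseq X" using X(2) by (rule convergent_imp_Bseq[OF convergentI])
    then obtain K where K: "K > 0" "\<And>n. norm (X n) \<le> K" unfolding Bseq_def by auto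
    \<comment> \<open>For \<open>y\<close> beyond this radius, both \<open>X n - y\<close> and
      \<open>x - y\<close> lie where \<open>g\<close> vanishes, uniformly in
      \<open>n\<close>.\<close>
    define S where "S = R + K + norm x"
    have X0: "norm (X n - x) > 0" for n using X(1) by auto
    have rb: "\<bar>r n y\<bar> \<le> 2 * M" for n y
    proof -
      have "\<bar>g (X n - y) - g (x - y)\<bar> \<le> M * norm (X n - x)" using M(3)[of "X n - y" "x - y"] by simp
      moreover have "\<bar>Dg (x - y) (X n - x)\<bar> \<le> M * norm (X n - x)" using M(2) by (simp add: Dg_def)
      ultimately have "\<bar>g (X n - y) - g (x - y) - Dg (x - y) (X n - x)\<bar> \<le> 2 * M * norm (X n - x)" by linarith
      then show ?thesis using X0[of n] by (simp add: r_def abs_divide divide_le_eq)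
    qed
    have r0: "r n y = 0" if "norm y > S" for n y
    proof -
      have "norm (X n - y) > R" using norm_triangle_ineq3[of "X n" y] K(2)[of n] that R(1) norm_ge_zero[of x] unfolding S_def by linarith
      moreover have "norm (x - y) > R" using norm_triangle_ineq3[of x y] K(1) that unfolding S_def by linarith
      ultimately show ?thesis using R R0 by (simp add: r_def Dg_def)
    qed
    have rm [measurable]: "r n \<in> borel_measurable borel" for n
      unfolding r_def Dg_def by measurable
    have lim: "(\<lambda>n. LBINT y. r n y *\<^sub>R f y) \<longlonglongrightarrow> (\<integral>y. 0 \<partial>(lborel :: 'a measure))"
    proof (rule integral_dominated_convergence[where w="\<lambda>y. (2 * M) * norm (indicator (cball 0 S) y *\<^sub>R f y)"])
      show "integrable lborel (\<lambda>y. (2 * M) * norm (indicator (cball 0 S) y *\<^sub>R f y))"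
        using f by (intro integrable_mult_right integrable_norm) (auto simp: loc_int_def set_integrable_def)
      have "norm (r n y *\<^sub>R f y) \<le> 2 * M * norm (indicator (cball 0 S) y *\<^sub>R f y)" for n y
        using rb[of n y] r0[of y n] M(1) by (cases "norm y \<le> S") (auto intro!: mult_right_mono)
      then show "AE y in lborel. norm (r n y *\<^sub>R f y) \<le> 2 * M * norm (indicator (cball 0 S) y *\<^sub>R f y)" for n
        by auto
      have "(\<lambda>n. r n y) \<longlonglongrightarrow> 0" for y
      proof -
        have "(g has_derivative Dg (x - y)) (at (x - y))"
          unfolding Dg_def by (rule smooth_has_derivative[OF test_fun_smooth[OF g]])
        then have "((\<lambda>z. (g z - g (x - y) - Dg (x - y) (z - (x - y))) /\<^sub>R norm (z - (x - y))) \<longlongrightarrow> 0) (at (x - y))"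
          unfolding has_derivative_at_within by (simp add: divide_inverse_commute)
        moreover have "(\<lambda>n. X n - y) \<longlonglongrightarrow> x - y" using X(2) by (intro tendsto_intros)
        moreover have "\<forall>i. X i - y \<in> UNIV - {x - y}" using X(1) by auto
        ultimately show ?thesis
          unfolding tendsto_at_iff_sequentially
          by (auto simp: r_def o_def divide_inverse_commute dest!: spec[of _ "\<lambda>n. X n - y"])
      qed
      then have "(\<lambda>n. r n y *\<^sub>R f y) \<longlonglongrightarrow> 0 *\<^sub>R f y" for y
        by (intro tendsto_scaleR tendsto_const)
      then show "AE y in lborel. (\<lambda>n. r n y *\<^sub>R f y) \<longlonglongrightarrow> 0"
        by simp
    qed auto
    have "(conv g f (X n) - conv g f x - ?D (X n - x)) /\<^sub>R norm (X n - x) = (LBINT y. r n y *\<^sub>R f y)" for n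
    proof -
      have i: "integrable lborel (\<lambda>y. g (X n - y) *\<^sub>R f y)" "integrable lborel (\<lambda>y. g (x - y) *\<^sub>R f y)"
        "\<And>b. b \<in> Basis \<Longrightarrow> integrable lborel (\<lambda>y. ((X n - x) \<bullet> b) *\<^sub>R (pderiv_dir b g (x - y) *\<^sub>R f y))"
        by (intro integrable_scaleR_right conv_integrable[OF f] g test_fun_pderiv_dir[OF g]; assumption)+
      have "(LBINT y. r n y *\<^sub>R f y) =
        (LBINT y. ((g (X n - y) *\<^sub>R f y - g (x - y) *\<^sub>R f y) -
           (\<Sum>b\<in>Basis. ((X n - x) \<bullet> b) *\<^sub>R (pderiv_dir b g (x - y) *\<^sub>R f y))) /\<^sub>R norm (X n - x))"
      proof (rule Bochner_Integration.integral_cong[OF refl])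
        fix y
        have "(\<Sum>b\<in>Basis. ((X n - x) \<bullet> b) *\<^sub>R (pderiv_dir b g (x - y) *\<^sub>R f y)) = Dg (x - y) (X n - x) *\<^sub>R f y"
          by (simp add: Dg_def scaleR_sum_left)
        then show "r n y *\<^sub>R f y = ((g (X n - y) *\<^sub>R f y - g (x - y) *\<^sub>R f y) -
           (\<Sum>b\<in>Basis. ((X n - x) \<bullet> b) *\<^sub>R (pderiv_dir b g (x - y) *\<^sub>R f y))) /\<^sub>R norm (X n - x)"
          by (simp add: r_def divide_inverse_commute flip: scaleR_diff_left)
      qed
      also have "\<dots> = (conv g f (X n) - conv g f x - ?D (X n - x)) /\<^sub>R norm (X n - x)"
        unfolding conv_def using i by (simp add: Bochner_Integration.integral_sum del: scaleR_scaleR)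
      finally show ?thesis by simp
    qed
    with lim show "((\<lambda>y. (conv g f y - conv g f x - ?D (y - x)) /\<^sub>R norm (y - x)) \<circ> X) \<longlonglongrightarrow> 0"
      by (simp add: o_def)
  qed
  ultimately show ?thesis
    unfolding has_derivative_at_within by simp
qed

lemma pderiv_dir_conv:
  assumes "loc_int f" "test_fun UNIV g" "b \<in> Basis"
  shows "pderiv_dir b (conv g f) x = conv (pderiv_dir b g) f x"
  using pderiv_dir_eq[OF conv_has_derivative[OF assms(1,2)], of b x] assms(3)
  by (simp add: inner_Basis if_distrib[of "\<lambda>t. t * _"] cong: if_cong)

text \<open>Every derivative falls on the kernel, so the convolutions of the fixed \<open>f\<close>
  with arbitrary test functions form the class required for coinduction.\<close>

lemma smooth_conv:
  assumes "loc_int f" "test_fun UNIV g"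
  shows "smooth (conv g f)"
proof (rule smooth_coinduct[of "\<lambda>h. \<exists>g. test_fun UNIV g \<and> h = conv g f"])
  show "\<exists>g'. test_fun UNIV g' \<and> conv g f = conv g' f" using assms by auto
  show "h differentiable (at x)" if "\<exists>g. test_fun UNIV g \<and> h = conv g f" for h x
    using that conv_has_derivative[OF assms(1)] by (auto simp: differentiable_def)
  show "\<exists>g. test_fun UNIV g \<and> pderiv_dir b h = conv g f"
    if "\<exists>g. test_fun UNIV g \<and> h = conv g f" "b \<in> Basis" for h b
    using that pderiv_dir_conv[OF assms(1)] test_fun_pderiv_dir by blast
qed

subsection \<open>Affine substitutions and weighted averages\<close>

lemma integrable_pointwise_bound:
  fixes f :: "'a \<Rightarrow> 'b::{banach, second_countable_topology}" and g :: "'a \<Rightarrow> real"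
  assumes "integrable M g" "f \<in> borel_measurable M" "\<And>x. norm (f x) \<le> g x"
  shows "integrable M f"
  using assms(1,2) by (rule Bochner_Integration.integrable_bound) (use order_trans[OF assms(3) abs_ge_self] in auto)

lemma integrable_pair_bound:
  fixes f :: "'a::euclidean_space \<times> 'b::euclidean_space \<Rightarrow> real" and a b :: "_ \<Rightarrow> real"
  assumes f: "f \<in> borel_measurable (lborel \<Otimes>\<^sub>M lborel)" and a: "integrable lborel a" and b: "integrable lborel b"
    and le: "\<And>x y. \<bar>f (x, y)\<bar> \<le> \<bar>a x\<bar> * \<bar>b y\<bar>"
  shows "integrable (lborel \<Otimes>\<^sub>M lborel) f"
proof (rule integrableI_bounded[OF f])
  have [measurable]: "a \<in> borel_measurable borel" "b \<in> borel_measurable borel" using a b by auto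
  have "(\<integral>\<^sup>+p. ennreal (norm (f p)) \<partial>(lborel \<Otimes>\<^sub>M lborel)) \<le> (\<integral>\<^sup>+p. ennreal \<bar>a (fst p)\<bar> * ennreal \<bar>b (snd p)\<bar> \<partial>(lborel \<Otimes>\<^sub>M lborel))"
    using le by (intro nn_integral_mono) (auto simp flip: ennreal_mult intro!: ennreal_leI)
  also have "\<dots> = (\<integral>\<^sup>+x. \<integral>\<^sup>+y. ennreal \<bar>a x\<bar> * ennreal \<bar>b y\<bar> \<partial>lborel \<partial>lborel)"
    by (subst lborel.nn_integral_fst[symmetric]) simp_all
  also have "\<dots> = (\<integral>\<^sup>+x. ennreal \<bar>a x\<bar> \<partial>lborel) * (\<integral>\<^sup>+y. ennreal \<bar>b y\<bar> \<partial>lborel)"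
    by (simp add: nn_integral_cmult nn_integral_multc)
  also have "\<dots> < \<infinity>" using a b by (simp add: integrable_iff_bounded ennreal_mult_less_top)
  finally show "(\<integral>\<^sup>+p. ennreal (norm (f p)) \<partial>(lborel \<Otimes>\<^sub>M lborel)) < \<infinity>" .
qed

lemma nn_integral_affine:
  fixes f :: "'a::euclidean_space \<Rightarrow> ennreal"
  assumes [measurable]: "f \<in> borel_measurable borel" and c: "c \<noteq> 0"
  shows "(\<integral>\<^sup>+x. f x \<partial>lborel) = ennreal (\<bar>c\<bar> ^ DIM('a)) * (\<integral>\<^sup>+x. f (t + c *\<^sub>R x) \<partial>lborel)"
  by (subst lborel_affine[OF c, of t])
    (simp add: nn_integral_density nn_integral_distr nn_integral_cmult)

lemma integral_affine:
  fixes f :: "'a::euclidean_space \<Rightarrow> 'b::{banach, second_countable_topology}"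
  assumes [measurable]: "f \<in> borel_measurable borel" and c: "c \<noteq> 0"
  shows "(LBINT x. f x) = (\<bar>c\<bar> ^ DIM('a)) *\<^sub>R (LBINT x. f (t + c *\<^sub>R x))"
  by (subst lborel_affine[OF c, of t]) (simp add: integral_density integral_distr)

lemma integrable_affine:
  fixes f :: "'a::euclidean_space \<Rightarrow> 'b::{banach, second_countable_topology}"
  assumes f: "integrable lborel f" and c: "c \<noteq> 0"
  shows "integrable lborel (\<lambda>x. f (t + c *\<^sub>R x))"
proof -
  have [measurable]: "f \<in> borel_measurable borel" using f by simp
  have "(\<integral>\<^sup>+x. norm (f x) \<partial>lborel) < \<infinity>" using f by (simp add: integrable_iff_bounded)
  then have "(\<integral>\<^sup>+x. norm (f (t + c *\<^sub>R x)) \<partial>lborel) < \<infinity>"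
    using nn_integral_affine[of "\<lambda>x. ennreal (norm (f x))" c t] c
    by (auto simp: ennreal_mult_less_top ennreal_mult_eq_top_iff)
  then show ?thesis by (simp add: integrable_iff_bounded)
qed

lemma nn_integral_shift:
  fixes f :: "'a::euclidean_space \<Rightarrow> ennreal"
  assumes "f \<in> borel_measurable borel"
  shows "(\<integral>\<^sup>+x. f (x - z) \<partial>lborel) = (\<integral>\<^sup>+x. f x \<partial>lborel)"
  using nn_integral_affine[OF assms, of 1 "- z"] by (simp add: algebra_simps)

lemma integral_shift:
  fixes f :: "'a::euclidean_space \<Rightarrow> 'b::{banach, second_countable_topology}"
  assumes "f \<in> borel_measurable borel"
  shows "(LBINT x. f (x - z)) = (LBINT x. f x)"
  using integral_affine[OF assms, of 1 "- z"] by (simp add: algebra_simps)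

lemma integrable_shift:
  fixes f :: "'a::euclidean_space \<Rightarrow> 'b::{banach, second_countable_topology}"
  shows "integrable lborel f \<Longrightarrow> integrable lborel (\<lambda>x. f (x - z))"
  using integrable_affine[of f 1 "- z"] by (simp add: algebra_simps)

lemma nn_integral_reflect:
  fixes f :: "'a::euclidean_space \<Rightarrow> ennreal"
  assumes "f \<in> borel_measurable borel"
  shows "(\<integral>\<^sup>+y. f (x - y) \<partial>lborel) = (\<integral>\<^sup>+y. f y \<partial>lborel)"
  using nn_integral_affine[OF assms, of "-1" x] by (simp add: algebra_simps)

lemma integral_reflect:
  fixes f :: "'a::euclidean_space \<Rightarrow> 'b::{banach, second_countable_topology}"
  assumes "f \<in> borel_measurable borel"
  shows "(LBINT y. f (x - y)) = (LBINT y. f y)"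
  using integral_affine[OF assms, of "-1" x] by (simp add: algebra_simps)

text \<open>Cauchy--Schwarz for the measure with density |k|. The kernel may change sign, as
  Littlewood--Paley kernels may, which is why its total variation appears in place of its mass. With
  an \<open>ennreal\<close> right-hand side the bound is available before any increment of
  \<open>w\<close> is known to be square integrable.\<close>

lemma weighted_jensen:
  fixes k :: "'a \<Rightarrow> real" and f :: "'a \<Rightarrow> 'b::euclidean_space"
  assumes k: "integrable M k" and f [measurable]: "f \<in> borel_measurable M"
  shows "ennreal ((norm (\<integral>x. k x *\<^sub>R f x \<partial>M))\<^sup>2)
    \<le> ennreal (\<integral>x. \<bar>k x\<bar> \<partial>M) * (\<integral>\<^sup>+x. ennreal (\<bar>k x\<bar> * (norm (f x))\<^sup>2) \<partial>M)"
proof -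
  have [measurable]: "k \<in> borel_measurable M" using k by simp
  define A where "A = (\<integral>x. \<bar>k x\<bar> \<partial>M)"
  define a where "a = (\<integral>x. k x *\<^sub>R f x \<partial>M)"
  have A: "A \<ge> 0" unfolding A_def by simp
  \<comment> \<open>Three degenerate cases precede the real argument: \<open>k\<close> vanishes
    almost everywhere, the right-hand side is infinite, or the Bochner integral has its default
    value 0.\<close>
  consider "A = 0" | "A > 0" "(\<integral>\<^sup>+x. ennreal (\<bar>k x\<bar> * (norm (f x))\<^sup>2) \<partial>M) = \<infinity>"
    | "\<not> integrable M (\<lambda>x. k x *\<^sub>R f x)"
    | "A > 0" "(\<integral>\<^sup>+x. ennreal (\<bar>k x\<bar> * (norm (f x))\<^sup>2) \<partial>M) < \<infinity>" "integrable M (\<lambda>x. k x *\<^sub>R f x)"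
    using A by (metis infinity_ennreal_def less_eq_real_def top.not_eq_extremum)
  then show ?thesis
  proof cases
    case 1
    then have "AE x in M. k x = 0"
      using k integral_nonneg_eq_0_iff_AE[of M "\<lambda>x. \<bar>k x\<bar>"] by (simp add: A_def)
    then have "a = 0" unfolding a_def by (intro integral_eq_zero_AE) auto
    then show ?thesis by (simp add: a_def)
  next
    case 2
    then show ?thesis by (simp add: A_def[symmetric] ennreal_mult_top)
  next
    case 3
    then show ?thesis by (simp add: not_integrable_integral_eq)
  next
    case 4
    define Q where "Q = (\<integral>x. \<bar>k x\<bar> * (norm (f x))\<^sup>2 \<partial>M)"
    have iQ: "integrable M (\<lambda>x. \<bar>k x\<bar> * (norm (f x))\<^sup>2)"
      using 4(2) by (intro integrableI_nonneg) auto
    have Q: "(\<integral>\<^sup>+x. ennreal (\<bar>k x\<bar> * (norm (f x))\<^sup>2) \<partial>M) = ennreal Q"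
      unfolding Q_def using iQ by (intro nn_integral_eq_integral) auto
    \<comment> \<open>The integral \<open>a\<close> is paired with itself. Young's inequality
      weighted by \<open>A\<close> then gives 2 A |a|^2 \<le> A |a|^2 + A^2 Q, and one copy of A
      |a|^2 is absorbed.\<close>
    have "a \<bullet> a = (\<integral>x. (k x *\<^sub>R f x) \<bullet> a \<partial>M)"
      using integral_inner_left[of a M "\<lambda>x. k x *\<^sub>R f x"] 4(3) by (simp add: a_def del: inner_scaleR_left)
    then have "2 * A * (a \<bullet> a) = (\<integral>x. 2 * A * ((k x *\<^sub>R f x) \<bullet> a) \<partial>M)"
      by (simp only: integral_mult_right_zero)
    also have "\<dots> \<le> (\<integral>x. (a \<bullet> a) * \<bar>k x\<bar> + A\<^sup>2 * (\<bar>k x\<bar> * (norm (f x))\<^sup>2) \<partial>M)"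
    proof (rule integral_mono)
      show "integrable M (\<lambda>x. 2 * A * ((k x *\<^sub>R f x) \<bullet> a))"
        using 4(3) by (intro integrable_mult_right integrable_inner_left) auto
      show "integrable M (\<lambda>x. (a \<bullet> a) * \<bar>k x\<bar> + A\<^sup>2 * (\<bar>k x\<bar> * (norm (f x))\<^sup>2))"
        using k iQ by (intro Bochner_Integration.integrable_add integrable_mult_right integrable_abs) auto
      fix x
      have "(k x *\<^sub>R f x) \<bullet> a \<le> \<bar>k x\<bar> * (norm (f x) * norm a)"
        using Cauchy_Schwarz_ineq2[of "k x *\<^sub>R f x" a] by (simp add: mult.assoc)
      then have "2 * A * ((k x *\<^sub>R f x) \<bullet> a) \<le> 2 * A * (\<bar>k x\<bar> * (norm (f x) * norm a))"
        using A by (intro mult_left_mono) auto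
      also have "\<dots> = \<bar>k x\<bar> * (2 * norm a * (A * norm (f x)))" by simp
      also have "\<dots> \<le> \<bar>k x\<bar> * ((norm a)\<^sup>2 + (A * norm (f x))\<^sup>2)"
        using sum_squares_bound[of "norm a" "A * norm (f x)"] by (intro mult_left_mono) auto
      finally show "2 * A * ((k x *\<^sub>R f x) \<bullet> a) \<le> (a \<bullet> a) * \<bar>k x\<bar> + A\<^sup>2 * (\<bar>k x\<bar> * (norm (f x))\<^sup>2)"
        by (simp add: algebra_simps power_mult_distrib power2_norm_eq_inner)
    qed
    also have "\<dots> = (a \<bullet> a) * A + A\<^sup>2 * Q"
      using k iQ by (simp add: A_def Q_def)
    finally have "A * (norm a)\<^sup>2 \<le> A * (A * Q)"
      by (simp add: dot_square_norm power2_eq_square[of A] algebra_simps)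
    then have "(norm a)\<^sup>2 \<le> A * Q" using 4(1) by simp
    then show ?thesis
      unfolding a_def[symmetric] A_def[symmetric] Q using A
      by (subst ennreal_mult'[symmetric]) (auto intro: ennreal_leI)
  qed
qed

text \<open>The set is squeezed between a compact \<open>K\<close> and an open \<open>U\<close> with
  \<open>U - K\<close> small. A shift shorter than the distance from \<open>K\<close> to the
  complement of \<open>U\<close> can change the indicator only on \<open>U - K\<close> or on its
  translate.\<close>

lemma indicator_translation_L1:
  fixes A :: "'a::euclidean_space set"
  assumes A: "A \<in> sets borel" "emeasure lborel A < \<infinity>" and e: "e > 0"
  shows "\<exists>d>0. \<forall>z. norm z < d \<longrightarrow> (LBINT x. \<bar>indicator A (x - z) - indicator A x\<bar>) \<le> (e::real)"
proof -
  have e4: "e / 4 > 0" using e by simp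
  obtain U where U: "open U" "A \<subseteq> U" "emeasure lborel (U - A) < ennreal (e/4)"
    using outer_regular_lborel[OF A(1) e4] by blast
  \<comment> \<open>Lebesgue measure restricted to \<open>A\<close> is finite, as inner regularity
    by compact sets requires.\<close>
  define M where "M = density lborel (indicator A)"
  have emM: "emeasure M B = emeasure lborel (A \<inter> B)" if "B \<in> sets borel" for B
    unfolding M_def using A that by (subst emeasure_density) (auto simp: indicator_inter_arith[symmetric])
  have "emeasure M A = (SUP K\<in>{K. K \<subseteq> A \<and> compact K}. emeasure M K)"
    by (rule inner_regular) (use A emM in \<open>auto simp: M_def\<close>)
  then have sup: "emeasure lborel A = (SUP K\<in>{K. K \<subseteq> A \<and> compact K}. emeasure M K)"
    using emM[OF A(1)] by simp
  have "\<exists>K. K \<subseteq> A \<and> compact K \<and> emeasure lborel (A - K) \<le> ennreal (e/4)"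
  proof -
    \<comment> \<open>The supremum gives a strict approximation from below only for positive
      measure; a null set is approximated by the empty set.\<close>
    obtain K where K: "K \<subseteq> A" "compact K" "emeasure lborel A \<le> emeasure M K + ennreal (e/4)"
    proof (cases "emeasure lborel A = 0")
      case True
      then show ?thesis using that[of "{}"] by simp
    next
      case False
      then have "emeasure lborel A - ennreal (e/4) < emeasure lborel A"
        using A(2) e4 by (intro ennreal_between) (auto simp: zero_less_iff_neq_zero)
      then obtain K where K: "K \<subseteq> A" "compact K" "emeasure lborel A - ennreal (e/4) < emeasure M K"
        unfolding sup less_SUP_iff by (auto simp: sup[symmetric])
      then show ?thesis using that[of K]
        by (metis ennreal_minus_le_iff add.commute order_less_imp_le ennreal_neq_top)
    qed
    have Kb: "K \<in> sets borel" using K(2) by (simp add: borel_compact)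
    have "A \<inter> K = K" using K by auto
    then have le: "emeasure lborel A \<le> emeasure lborel K + ennreal (e/4)" using K(3) emM[OF Kb] by simp
    have fin: "emeasure lborel K < \<infinity>" using K(2) by (rule emeasure_compact_finite)
    have "emeasure lborel (A - K) = emeasure lborel A - emeasure lborel K"
      using K Kb A fin by (intro emeasure_Diff) auto
    also have "\<dots> \<le> ennreal (e/4)" using le fin A(2) by (auto simp: ennreal_minus_le_iff)
    finally show ?thesis using K by auto
  qed
  then obtain K where K: "K \<subseteq> A" "compact K" "emeasure lborel (A - K) \<le> ennreal (e/4)" by auto
  have [measurable]: "K \<in> sets borel" "U \<in> sets borel" "A \<in> sets borel" using K(2) U(1) A by (auto simp: borel_compact)
  have cl: "closed (- U)" "K \<inter> - U = {}" using U K by auto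
  obtain d where d: "d > 0" "\<And>x y. x \<in> K \<Longrightarrow> y \<in> - U \<Longrightarrow> d \<le> dist x y"
    using separate_compact_closed[OF K(2) cl] by blast
  define V where "V = U - K"
  have [measurable]: "V \<in> sets borel" by (simp add: V_def)
  have "V = (U - A) \<union> (A - K)" using U K by (auto simp: V_def)
  then have "emeasure lborel V \<le> emeasure lborel (U - A) + emeasure lborel (A - K)"
    by (simp add: emeasure_subadditive)
  also have "\<dots> \<le> ennreal (e/4) + ennreal (e/4)" using U K by (intro add_mono) auto
  finally have V: "emeasure lborel V \<le> ennreal (e/2)" using e by (simp flip: ennreal_plus)
  then have Vfin: "emeasure lborel V < \<infinity>" by (simp add: le_less_trans)
  have mV: "measure lborel V \<le> e / 2"
    unfolding measure_def using V e by (intro enn2real_leI) auto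
  have iV: "integrable lborel (indicator V :: 'a \<Rightarrow> real)" using Vfin by simp
  have iA: "integrable lborel (indicator A :: 'a \<Rightarrow> real)" using A by simp
  have "(LBINT x. \<bar>indicator A (x - z) - indicator A x\<bar>) \<le> e" if z: "norm z < d" for z
  proof -
    have pt: "\<bar>indicator A (x - z) - indicator A x\<bar> \<le> (indicator V x + indicator V (x - z) :: real)" for x
    proof -
      have "x - z \<in> U" if "x \<in> K" using d(2)[OF that, of "x - z"] z by (auto simp: dist_norm)
      moreover have "x \<in> U" if "x - z \<in> K" using d(2)[OF that, of x] z by (auto simp: dist_norm)
      ultimately show ?thesis using U(2) K(1) by (auto simp: V_def indicator_def)
    qed
    have "(LBINT x. \<bar>indicator A (x - z) - indicator A x :: real\<bar>) \<le> (LBINT x. indicator V x + indicator V (x - z))"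
      by (rule integral_mono) (use pt integrable_shift[OF iV] integrable_shift[OF iA] iA iV in auto)
    also have "\<dots> = measure lborel V + measure lborel V"
      using integrable_shift[OF iV, of z] iV integral_shift[of "indicator V :: 'a \<Rightarrow> real" z] by simp
    finally show ?thesis using mV by simp
  qed
  with d(1) show ?thesis by blast
qed

text \<open>Density argument: indicators, then sums, then limits. The limit step splits the error
  into three parts, two of which agree by translation invariance. The dominating function there is
  \<open>3 * norm (f x)\<close> since the approximants are bounded by twice
  \<open>norm (f x)\<close>.\<close>

lemma translation_L1:
  fixes f :: "'a::euclidean_space \<Rightarrow> 'b::euclidean_space"
  assumes "integrable lborel f" "e > 0"
  shows "\<exists>d>0. \<forall>z. norm z < d \<longrightarrow> (LBINT x. norm (f (x - z) - f x)) \<le> (e::real)"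
  using assms
proof (induction arbitrary: e rule: integrable_induct)
  case (base A c)
  then have "e / (norm c + 1) > 0" by (simp add: add_nonneg_pos)
  from indicator_translation_L1[OF _ base.hyps(2) this] base.hyps(1)
  obtain d where d: "d > 0" "\<And>z. norm z < d \<Longrightarrow> (LBINT x. \<bar>indicator A (x - z) - indicator A x\<bar>) \<le> e / (norm c + 1)"
    by auto
  have "(LBINT x. norm (indicator A (x - z) *\<^sub>R c - indicator A x *\<^sub>R c)) \<le> e" if "norm z < d" for z
  proof -
    have "(LBINT x. norm (indicator A (x - z) *\<^sub>R c - indicator A x *\<^sub>R c)) =
        (LBINT x. \<bar>indicator A (x - z) - indicator A x\<bar> * norm c)"
      by (simp flip: scaleR_left_diff_distrib)
    also have "\<dots> \<le> e / (norm c + 1) * norm c"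
      using mult_right_mono[OF d(2)[OF that], of "norm c"] by simp
    also have "\<dots> \<le> e"
    proof -
      have n: "norm c + 1 > 0" by (simp add: add_nonneg_pos)
      have "e * norm c \<le> e * (norm c + 1)" using base.prems by simp
      then show ?thesis using n by (simp only: times_divide_eq_left pos_divide_le_eq)
    qed
    finally show ?thesis .
  qed
  with d(1) show ?case by blast
next
  case (add f g)
  from add.prems have "e / 2 > 0" by simp
  from add.IH(1)[OF this] add.IH(2)[OF this] obtain d1 d2 where
    d: "d1 > 0" "d2 > 0" "\<And>z. norm z < d1 \<Longrightarrow> (LBINT x. norm (f (x - z) - f x)) \<le> e / 2"
      "\<And>z. norm z < d2 \<Longrightarrow> (LBINT x. norm (g (x - z) - g x)) \<le> e / 2" by blast
  have "(LBINT x. norm (f (x - z) + g (x - z) - (f x + g x))) \<le> e" if z: "norm z < min d1 d2" for z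
  proof -
    note i = add.hyps integrable_shift[OF add.hyps(1), of z] integrable_shift[OF add.hyps(2), of z]
    have "(LBINT x. norm (f (x - z) + g (x - z) - (f x + g x))) \<le>
        (LBINT x. norm (f (x - z) - f x) + norm (g (x - z) - g x))"
    proof (rule integral_mono)
      show "norm (f (x - z) + g (x - z) - (f x + g x)) \<le> norm (f (x - z) - f x) + norm (g (x - z) - g x)" for x
        using norm_triangle_ineq[of "f (x - z) - f x" "g (x - z) - g x"] by (simp add: algebra_simps)
    qed (use i in auto)
    also have "\<dots> = (LBINT x. norm (f (x - z) - f x)) + (LBINT x. norm (g (x - z) - g x))"
      using i by simp
    also have "\<dots> \<le> e" using d(3)[of z] d(4)[of z] z by simp
    finally show ?thesis .
  qed
  then show ?case using d(1,2) by (intro exI[of _ "min d1 d2"]) auto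
next
  case (lim f s)
  have "(\<lambda>i. LBINT x. norm (s i x - f x)) \<longlonglongrightarrow> (\<integral>x. 0 \<partial>(lborel :: 'a measure))"
  proof (rule integral_dominated_convergence[where w="\<lambda>x. 3 * norm (f x)"])
    have "(\<lambda>i. norm (s i x - f x)) \<longlonglongrightarrow> 0" for x
      using lim.hyps(2)[of x] by (intro tendsto_norm_zero LIM_zero) simp
    then show "AE x in lborel. (\<lambda>i. norm (s i x - f x)) \<longlonglongrightarrow> 0" by simp
    have "norm (s i x - f x) \<le> 3 * norm (f x)" for i x
      using lim.hyps(3)[of x i] norm_triangle_ineq4[of "s i x" "f x"] by simp
    then show "AE x in lborel. norm (norm (s i x - f x)) \<le> 3 * norm (f x)" for i by simp
  qed (use lim.hyps(1,4) in auto)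
  then have "eventually (\<lambda>i. (LBINT x. norm (s i x - f x)) < e / 3) sequentially"
    using lim.prems by (intro order_tendstoD) auto
  then obtain i where i: "(LBINT x. norm (s i x - f x)) < e / 3"
    by (auto simp: eventually_sequentially)
  from lim.prems have "e / 3 > 0" by simp
  from lim.IH[OF this, of i] obtain d where
    d: "d > 0" "\<And>z. norm z < d \<Longrightarrow> (LBINT x. norm (s i (x - z) - s i x)) \<le> e / 3" by blast
  have "(LBINT x. norm (f (x - z) - f x)) \<le> e" if z: "norm z < d" for z
  proof -
    note ii = lim.hyps(1)[of i] lim.hyps(4) integrable_shift[OF lim.hyps(1)[of i], of z] integrable_shift[OF lim.hyps(4), of z]
    have "(LBINT x. norm (f (x - z) - f x)) \<le>
        (LBINT x. norm (s i (x - z) - f (x - z)) + norm (s i (x - z) - s i x) + norm (s i x - f x))"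
    proof (rule integral_mono)
      fix x
      have "f (x - z) - f x = (f (x - z) - s i (x - z)) + (s i (x - z) - s i x) + (s i x - f x)" by simp
      also have "norm \<dots> \<le> norm (f (x - z) - s i (x - z)) + norm (s i (x - z) - s i x) + norm (s i x - f x)"
        by (intro norm_triangle_le add_right_mono norm_triangle_ineq)
      finally show "norm (f (x - z) - f x) \<le> norm (s i (x - z) - f (x - z)) + norm (s i (x - z) - s i x) + norm (s i x - f x)"
        by (simp only: norm_minus_commute)
    qed (use ii in auto)
    also have "\<dots> = (LBINT x. norm (s i (x - z) - f (x - z))) + (LBINT x. norm (s i (x - z) - s i x))
         + (LBINT x. norm (s i x - f x))"
      using ii by simp
    also have "(LBINT x. norm (s i (x - z) - f (x - z))) = (LBINT x. norm (s i x - f x))"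
      using lim.hyps(1)[of i] lim.hyps(4) by (intro integral_shift[of "\<lambda>x. norm (s i x - f x)"]) auto
    finally show ?thesis using i d(2)[OF z] by simp
  qed
  with d(1) show ?case by blast
qed

definition mollifier :: "real \<Rightarrow> ('a::euclidean_space \<Rightarrow> real) \<Rightarrow> bool" where
  "mollifier d r \<longleftrightarrow> test_fun UNIV r \<and> (\<forall>x. 0 \<le> r x) \<and> (LBINT x. r x) = 1 \<and> (\<forall>x. norm x > d \<longrightarrow> r x = 0)"

lemma test_fun_integrable: 
  fixes f :: "'a::euclidean_space \<Rightarrow> real"
  assumes "test_fun UNIV f"
  shows "integrable lborel f"
proof -
  have "loc_int (\<lambda>x::'a. 1::real)"
    unfolding loc_int_def set_integrable_def
    by (auto intro!: integrable_real_indicator emeasure_lborel_cball_finite simp del: infinity_ennreal_def)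
  from loc_int_test_fun[OF this assms] show ?thesis by simp
qed

lemma integrable_loc_int: "integrable lborel f \<Longrightarrow> loc_int f"
  unfolding loc_int_def set_integrable_def
  using borel_measurable_integrable by (auto intro!: integrable_mult_indicator)

subsection \<open>Mollifiers\<close>

lemma lp_cutoffD:
  assumes "lp_cutoff chi"
  shows "test_fun (ball 0 1) chi" "0 \<le> chi x" "x \<in> ball 0 (1/2) \<Longrightarrow> chi x = 1"
  using assms unfolding lp_cutoff_def by blast+

text \<open>Besides defining the projections, the cutoff has three further uses: rescaled and
  normalised it is the mollifier, and dilated it truncates both the position \<open>x\<close> and
  the value \<open>w x\<close> in the transport term.\<close>

locale cutoff =
  fixes chi :: "real^'n \<Rightarrow> real"
  assumes cutoff: "lp_cutoff chi"
begin

lemma test_chi: "test_fun UNIV chi"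
  by (rule test_fun_UNIV[OF lp_cutoffD(1)[OF cutoff]])

lemma chi_zero: "chi 0 = 1"
  using lp_cutoffD(3)[OF cutoff, of 0] by simp

lemma chi_outside:
  assumes "norm x \<ge> 1"
  shows "chi x = 0"
proof (rule ccontr)
  assume "chi x \<noteq> 0"
  then have "x \<in> supp chi" unfolding supp_def using closure_subset by fastforce
  moreover have "supp chi \<subseteq> ball 0 1" using lp_cutoffD(1)[OF cutoff] by (simp add: test_fun_def)
  ultimately show False using assms by auto
qed

text \<open>No bump function has to be constructed: the given cutoff is smooth, nonnegative and
  compactly supported, and its integral is positive because it equals 1 on a ball.\<close>

lemma mollifier_exists:
  assumes d: "d > 0"
  shows "\<exists>r::real^'n \<Rightarrow> real. mollifier d r"
proof -
  note c = lp_cutoffD[OF cutoff] and t = test_chi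
  have i: "integrable lborel chi" by (rule test_fun_integrable[OF t])
  have pos: "(LBINT x. chi x) > 0"
  proof -
    have m: "0 < measure lborel (ball (0::real^'n) (1/2))"
      using content_ball_pos[of "1/2" "0::real^'n"] by simp
    have "(\<integral>x. indicator (ball 0 (1/2)) x \<partial>(lborel :: (real^'n) measure)) \<le> (LBINT x. chi x)"
    proof (rule integral_mono)
      show "integrable lborel (indicator (ball (0::real^'n) (1/2)) :: _ \<Rightarrow> real)"
        by (intro integrable_real_indicator emeasure_lborel_ball_finite) auto
      show "indicator (ball 0 (1/2)) x \<le> chi x" for x
        using c(2,3) by (auto simp: indicator_def)
    qed (rule i)
    then have "measure lborel (ball (0::real^'n) (1/2)) \<le> (LBINT x. chi x)" by simp
    with m show ?thesis by (rule less_le_trans)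
  qed
  define r where "r x = chi (0 + (1/d) *\<^sub>R x) / (d ^ DIM(real^'n) * (LBINT x. chi x))" for x
  have t2: "test_fun UNIV (\<lambda>x. chi (0 + (1/d) *\<^sub>R x))"
    using d by (intro test_fun_affine_comp t) auto
  have [measurable]: "chi \<in> borel_measurable borel" using i by simp
  have I: "(LBINT x. chi x) = (1/d) ^ DIM(real^'n) * (LBINT x. chi (0 + (1/d) *\<^sub>R x))"
    using integral_affine[of chi "1/d" 0] d by simp
  have "mollifier d r"
    unfolding mollifier_def
  proof (intro conjI allI impI)
    have "test_fun UNIV (\<lambda>x. chi (0 + (1/d) *\<^sub>R x) * (1 / (d ^ DIM(real^'n) * (LBINT x. chi x))))"
      by (rule test_fun_mult[OF t2 smooth_const])
    then show "test_fun UNIV r" by (simp add: r_def[abs_def])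
    show "0 \<le> r x" for x
      using c(2) d pos by (auto simp: r_def intro!: divide_nonneg_nonneg mult_nonneg_nonneg)
    have "(LBINT x. r x) = (LBINT x. chi (0 + (1/d) *\<^sub>R x)) / (d ^ DIM(real^'n) * (LBINT x. chi x))"
      unfolding r_def by (rule integral_divide_zero)
    also have "(LBINT x. chi (0 + (1/d) *\<^sub>R x)) = d ^ DIM(real^'n) * (LBINT x. chi x)"
      using I d by (simp add: power_divide)
    finally show "(LBINT x. r x) = 1" using d pos by simp
    show "r x = 0" if "norm x > d" for x
      using chi_outside[of "(1/d) *\<^sub>R x"] that d by (simp add: r_def)
  qed
  then show ?thesis by blast
qed

end

lemma loc_int_reflect:
  assumes f: "loc_int f" and g: "test_fun UNIV g"
  shows "integrable lborel (\<lambda>z. g z *\<^sub>R f (x - z))" "conv g f x = (LBINT z. g z *\<^sub>R f (x - z))"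
proof -
  have [measurable]: "g \<in> borel_measurable borel" "f \<in> borel_measurable borel"
    using f g by (auto intro: test_fun_measurable loc_int_measurable)
  show "integrable lborel (\<lambda>z. g z *\<^sub>R f (x - z))"
    using integrable_affine[OF conv_integrable[OF f g, of x], of "-1" x] by simp
  show "conv g f x = (LBINT z. g z *\<^sub>R f (x - z))"
    using integral_reflect[of "\<lambda>y. g (x - y) *\<^sub>R f y" x] by (simp add: conv_def)
qed

lemma conv_continuous:
  "loc_int f \<Longrightarrow> test_fun UNIV g \<Longrightarrow> continuous_on S (conv g f)"
  by (intro continuous_at_imp_continuous_on ballI has_derivative_continuous[OF conv_has_derivative])

lemma conv_measurable [measurable]:
  "loc_int f \<Longrightarrow> test_fun UNIV g \<Longrightarrow> conv g f \<in> borel_measurable borel"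
  by (intro borel_measurable_continuous_onI conv_continuous)

text \<open>Jensen for the probability density \<open>r\<close>, followed by Tonelli and translation
  invariance; unit mass makes the constant 1, so bounds on mollifications are uniform in the
  mollifier.\<close>

lemma mollifier_young:
  assumes f: "loc_int f" and r: "mollifier d r"
  shows "sq_nnorm (conv r f) \<le> sq_nnorm f"
proof -
  have t: "test_fun UNIV r" "\<And>x. 0 \<le> r x" "(LBINT x. r x) = 1" using r by (auto simp: mollifier_def)
  have [measurable]: "f \<in> borel_measurable borel" "r \<in> borel_measurable borel"
    using f t test_fun_measurable by auto
  have nn: "(\<integral>\<^sup>+z. ennreal (r z) \<partial>lborel) = 1"
    using nn_integral_eq_integral[OF test_fun_integrable[OF t(1)]] t by simp
  have "ennreal ((norm (conv r f x))\<^sup>2) \<le> (\<integral>\<^sup>+z. ennreal (r z) * ennreal ((norm (f (x - z)))\<^sup>2) \<partial>lborel)" for x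
    using weighted_jensen[OF test_fun_integrable[OF t(1)], of "\<lambda>z. f (x - z)"] t
    by (simp add: loc_int_reflect(2)[OF f t(1)] ennreal_mult')
  then have "sq_nnorm (conv r f) \<le>
      (\<integral>\<^sup>+x. (\<integral>\<^sup>+z. ennreal (r z) * ennreal ((norm (f (x - z)))\<^sup>2) \<partial>lborel) \<partial>lborel)"
    by (intro nn_integral_mono)
  also have "\<dots> = (\<integral>\<^sup>+z. (\<integral>\<^sup>+x. ennreal (r z) * ennreal ((norm (f (x - z)))\<^sup>2) \<partial>lborel) \<partial>lborel)"
    by (rule lborel_pair.Fubini'[symmetric]) measurable
  also have "\<dots> = (\<integral>\<^sup>+z. ennreal (r z) * sq_nnorm f \<partial>lborel)"
    using nn_integral_shift[of "\<lambda>x. ennreal ((norm (f x))\<^sup>2)"]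
    by (intro nn_integral_cong) (simp add: nn_integral_cmult)
  also have "\<dots> = sq_nnorm f"
    by (simp add: nn_integral_multc nn)
  finally show ?thesis .
qed

lemma mollifier_L1:
  fixes f :: "'a::euclidean_space \<Rightarrow> 'b::euclidean_space"
  assumes f: "integrable lborel f" and r: "mollifier d r"
    and d: "\<And>z. norm z \<le> d \<Longrightarrow> (LBINT x. norm (f (x - z) - f x)) \<le> e"
  shows "(\<integral>\<^sup>+x. ennreal (norm (conv r f x - f x)) \<partial>lborel) \<le> ennreal e"
proof -
  have t: "test_fun UNIV r" "\<And>x. 0 \<le> r x" "(LBINT x. r x) = 1" "\<And>x. norm x > d \<Longrightarrow> r x = 0"
    using r by (auto simp: mollifier_def)
  have fl: "loc_int f" using f by (rule integrable_loc_int)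
  have [measurable]: "f \<in> borel_measurable borel" "r \<in> borel_measurable borel"
    using fl t test_fun_measurable by auto
  have nn: "(\<integral>\<^sup>+z. ennreal (r z) \<partial>lborel) = 1"
    using nn_integral_eq_integral[OF test_fun_integrable[OF t(1)]] t by simp
  have "ennreal (norm (conv r f x - f x)) \<le> (\<integral>\<^sup>+z. ennreal (r z) * ennreal (norm (f (x - z) - f x)) \<partial>lborel)" for x
  proof -
    have i: "integrable lborel (\<lambda>z. r z *\<^sub>R f (x - z))" "integrable lborel (\<lambda>z. r z *\<^sub>R f x)"
      using loc_int_reflect(1)[OF fl t(1)] test_fun_integrable[OF t(1)] by auto
    then have i2: "integrable lborel (\<lambda>z. r z *\<^sub>R (f (x - z) - f x))"
      by (simp add: scaleR_right_diff_distrib)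
    have "conv r f x - f x = (LBINT z. r z *\<^sub>R (f (x - z) - f x))"
      using i test_fun_integrable[OF t(1)]
      by (simp add: loc_int_reflect(2)[OF fl t(1)] scaleR_right_diff_distrib t(3))
    then have "ennreal (norm (conv r f x - f x)) \<le> (\<integral>\<^sup>+z. ennreal (norm (r z *\<^sub>R (f (x - z) - f x))) \<partial>lborel)"
      using integral_norm_bound_ennreal[OF i2] by simp
    then show ?thesis using t(2) by (simp add: ennreal_mult')
  qed
  then have "(\<integral>\<^sup>+x. ennreal (norm (conv r f x - f x)) \<partial>lborel) \<le>
      (\<integral>\<^sup>+x. (\<integral>\<^sup>+z. ennreal (r z) * ennreal (norm (f (x - z) - f x)) \<partial>lborel) \<partial>lborel)"
    by (intro nn_integral_mono)
  also have "\<dots> = (\<integral>\<^sup>+z. (\<integral>\<^sup>+x. ennreal (r z) * ennreal (norm (f (x - z) - f x)) \<partial>lborel) \<partial>lborel)"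
    by (rule lborel_pair.Fubini'[symmetric]) measurable
  also have "\<dots> \<le> (\<integral>\<^sup>+z. ennreal (r z) * ennreal e \<partial>lborel)"
  proof (rule nn_integral_mono)
    fix z
    show "(\<integral>\<^sup>+x. ennreal (r z) * ennreal (norm (f (x - z) - f x)) \<partial>lborel) \<le> ennreal (r z) * ennreal e"
    proof (cases "norm z \<le> d")
      case True
      have "(\<integral>\<^sup>+x. ennreal (norm (f (x - z) - f x)) \<partial>lborel) = ennreal (LBINT x. norm (f (x - z) - f x))"
        using f integrable_shift[OF f] by (intro nn_integral_eq_integral) auto
      also have "\<dots> \<le> ennreal e" using d[OF True] by (rule ennreal_leI)
      finally show ?thesis by (simp add: nn_integral_cmult mult_left_mono)
    next
      case False
      then show ?thesis using t(4)[of z] by simp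
    qed
  qed
  also have "\<dots> = ennreal e" by (simp add: nn_integral_multc nn)
  finally show ?thesis .
qed

text \<open>For each \<open>n\<close> the function is cut off at radius \<open>n\<close> and
  mollified with L1 error at most 2^(-n). The errors have a finite sum almost everywhere, hence tend
  to 0 there. No subsequence is extracted, because the radius of each mollifier is chosen to suit
  its own error.\<close>

lemma (in cutoff) mollifier_AE:
  fixes f :: "real^'n \<Rightarrow> 'b::euclidean_space"
  assumes f: "loc_int f"
  obtains r where "\<And>n::nat. mollifier 1 (r n)" "AE x in lborel. (\<lambda>n. conv (r n) f x) \<longlonglongrightarrow> f x"
proof -
  define F where "F n x = indicator (cball 0 (real n)) x *\<^sub>R f x" for n x
  have iF: "integrable lborel (F n)" for n
    using f by (auto simp: F_def[abs_def] loc_int_def set_integrable_def)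
  have "\<exists>r. mollifier 1 r \<and> (\<integral>\<^sup>+x. ennreal (norm (conv r (F n) x - F n x)) \<partial>lborel) \<le> ennreal ((1/2)^n)" for n
  proof -
    obtain d where d: "d > 0" "\<And>z. norm z < d \<Longrightarrow> (LBINT x. norm (F n (x - z) - F n x)) \<le> (1/2)^n"
      using translation_L1[OF iF, of "(1/2)^n" n] by auto
    \<comment> \<open>Radii at most 1 keep the values of \<open>conv (r n) f\<close> at
      \<open>x\<close> dependent on the unit ball around \<open>x\<close> only, so the cutoff at
      radius \<open>n\<close> is invisible once \<open>n\<close> is at least
      \<open>norm x + 1\<close>.\<close>
    define d' where "d' = min 1 (d/2)"
    have d': "d' > 0" "d' \<le> 1" "d' < d" using d by (auto simp: d'_def)
    obtain r :: "real^'n \<Rightarrow> real" where r: "mollifier d' r" using mollifier_exists[OF d'(1)] by blast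
    then have "mollifier 1 r" using d' by (auto simp: mollifier_def)
    moreover have "(\<integral>\<^sup>+x. ennreal (norm (conv r (F n) x - F n x)) \<partial>lborel) \<le> ennreal ((1/2)^n)"
      using d' by (intro mollifier_L1[OF iF r] d) auto
    ultimately show ?thesis by blast
  qed
  then obtain r where r: "\<And>n. mollifier 1 (r n)"
    "\<And>n. (\<integral>\<^sup>+x. ennreal (norm (conv (r n) (F n) x - F n x)) \<partial>lborel) \<le> ennreal ((1/2)^n)"
    by metis
  have t: "test_fun UNIV (r n)" for n using r by (auto simp: mollifier_def)
  have [measurable]: "conv (r n) (F n) \<in> borel_measurable borel" "F n \<in> borel_measurable borel" for n
    using t iF[of n] by (auto intro: conv_measurable integrable_loc_int)
  have "(\<integral>\<^sup>+x. (\<Sum>n. ennreal (norm (conv (r n) (F n) x - F n x))) \<partial>lborel) =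
      (\<Sum>n. \<integral>\<^sup>+x. ennreal (norm (conv (r n) (F n) x - F n x)) \<partial>lborel)"
    by (rule nn_integral_suminf) measurable
  also have "\<dots> \<le> (\<Sum>n. ennreal ((1/2)^n))" by (intro suminf_le r(2)) auto
  also have "\<dots> = ennreal (\<Sum>n. (1/2)^n)" by (intro suminf_ennreal2) (auto intro: summable_geometric)
  also have "\<dots> < \<infinity>" by simp
  finally have "(\<integral>\<^sup>+x. (\<Sum>n. ennreal (norm (conv (r n) (F n) x - F n x))) \<partial>lborel) \<noteq> \<infinity>" by simp
  then have "AE x in lborel. (\<Sum>n. ennreal (norm (conv (r n) (F n) x - F n x))) \<noteq> \<infinity>"
    by (rule nn_integral_PInf_AE[rotated]) measurable
  then have "AE x in lborel. (\<lambda>n. conv (r n) f x) \<longlonglongrightarrow> f x"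
  proof eventually_elim
    case (elim x)
    then have "summable (\<lambda>n. norm (conv (r n) (F n) x - F n x))"
      by (intro summable_suminf_not_top) auto
    then have "(\<lambda>n. norm (conv (r n) (F n) x - F n x)) \<longlonglongrightarrow> 0" by (rule summable_LIMSEQ_zero)
    then have lim: "(\<lambda>n. conv (r n) (F n) x - F n x) \<longlonglongrightarrow> 0" by (simp add: tendsto_norm_zero_iff)
    have "eventually (\<lambda>n. conv (r n) (F n) x - F n x = conv (r n) f x - f x) sequentially"
      unfolding eventually_sequentially
    proof (intro exI[of _ "nat \<lceil>norm x + 1\<rceil>"] allI impI)
      fix n assume "nat \<lceil>norm x + 1\<rceil> \<le> n"
      then have n: "norm x + 1 \<le> real n" by linarith
      have eq: "r n (x - y) *\<^sub>R F n y = r n (x - y) *\<^sub>R f y" for y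
      proof (cases "norm y \<le> n")
        case False
        then have "norm (x - y) > 1" using n norm_triangle_ineq3[of x y] by linarith
        then show ?thesis using r(1)[of n] by (simp add: mollifier_def)
      qed (simp add: F_def)
      have "F n x = f x" using n by (simp add: F_def)
      then show "conv (r n) (F n) x - F n x = conv (r n) f x - f x"
        by (simp add: conv_def eq)
    qed
    from tendsto_cong[OF this] lim have "(\<lambda>n. conv (r n) f x - f x) \<longlonglongrightarrow> 0" by simp
    then show ?case by (simp add: LIM_zero_iff)
  qed
  with r(1) that show ?thesis by blast
qed

text \<open>A reflected and shifted mollifier is a test function, so every mollification of
  \<open>f\<close> vanishes identically, and \<open>f\<close> is their limit almost
  everywhere.\<close>

lemma (in cutoff) du_bois_reymond:
  fixes f :: "real^'n \<Rightarrow> real"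
  assumes f: "loc_int f"
    and z: "\<And>g. test_fun UNIV g \<Longrightarrow> (LBINT x. f x * g x) = 0"
  shows "AE x in lborel. f x = 0"
proof -
  obtain r where r: "\<And>n::nat. mollifier 1 (r n)" "AE x in lborel. (\<lambda>n. conv (r n) f x) \<longlonglongrightarrow> f x"
    using mollifier_AE[OF f] by blast
  have "conv (r n) f x = 0" for n x
    using z[OF test_fun_reflect[of "r n" x]] r(1)[of n] by (simp add: conv_def mollifier_def mult.commute)
  with r(2) show ?thesis by (simp add: LIMSEQ_const_iff)
qed

subsection \<open>Weak gradients and translations\<close>

lemma borel_measurable_vec_nth [measurable (raw)]:
  fixes f :: "'a \<Rightarrow> 'b::topological_space ^ 'n"
  assumes "f \<in> borel_measurable M"
  shows "(\<lambda>x. f x $ i) \<in> borel_measurable M"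
  by (rule borel_measurable_continuous_on[OF _ assms]) (intro continuous_intros)

lemma Basis_real_vec: "(Basis :: (real^'n) set) = (\<lambda>j. axis j 1) ` UNIV"
  by (auto simp: Basis_vec_def)

lemma sum_Basis_real_vec: "(\<Sum>b\<in>(Basis :: (real^'n) set). f b) = (\<Sum>j\<in>UNIV. f (axis j 1))"
proof -
  have "inj (\<lambda>j::'n. axis j (1::real))" by (auto simp: inj_on_def axis_eq_axis)
  then show ?thesis unfolding Basis_real_vec by (simp add: sum.reindex)
qed

lemma axis_Basis: "axis j (1::real) \<in> Basis"
  by (simp add: axis_in_Basis_iff)

text \<open>Cauchy--Schwarz row by row; the norm of a matrix is the Frobenius norm, which dominates
  the operator norm.\<close>

lemma norm_matrix_vector_le:
  fixes A :: "real^'n^'m"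
  shows "norm (A *v h) \<le> norm A * norm h"
proof -
  have c: "(A *v h) $ i = (A $ i) \<bullet> h" for i
    by (simp add: matrix_vector_mult_def inner_vec_def)
  have "norm (A *v h) \<le> L2_set (\<lambda>i. norm (A $ i) * norm h) UNIV"
    unfolding norm_vec_def[of "A *v h"] c
    by (intro L2_set_mono) (auto intro: Cauchy_Schwarz_ineq2)
  also have "\<dots> = norm A * norm h"
    unfolding norm_vec_def[of A] by (rule L2_set_left_distrib[symmetric]) simp
  finally show ?thesis .
qed

lemma loc_int_inner: "loc_int f \<Longrightarrow> loc_int (\<lambda>x. f x \<bullet> c)"
  unfolding loc_int_def set_integrable_def
  by (auto simp flip: inner_scaleR_left intro: integrable_inner_left)

lemma loc_int_nth: 
  fixes f :: "'a::euclidean_space \<Rightarrow> real^'n"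
  shows "loc_int f \<Longrightarrow> loc_int (\<lambda>x. f x $ i)"
  using loc_int_inner[of f "axis i 1"] by (simp add: inner_axis)

lemma loc_int_nth_nth:
  fixes f :: "'a::euclidean_space \<Rightarrow> real^'n^'m"
  shows "loc_int f \<Longrightarrow> loc_int (\<lambda>x. f x $ i $ j)"
  using loc_int_inner[of f "axis i (axis j 1)"] by (simp add: inner_axis)

lemma conv_nth:
  fixes f :: "'a::euclidean_space \<Rightarrow> real^'n"
  shows "loc_int f \<Longrightarrow> test_fun UNIV g \<Longrightarrow> conv g f x $ i = conv g (\<lambda>y. f y $ i) x"
  using conv_inner[of f g x "axis i 1"] by (simp add: inner_axis)

lemma conv_nth_nth:
  fixes f :: "'a::euclidean_space \<Rightarrow> real^'n^'m"
  shows "loc_int f \<Longrightarrow> test_fun UNIV g \<Longrightarrow> conv g f x $ i $ j = conv g (\<lambda>y. f y $ i $ j) x"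
  using conv_inner[of f g x "axis i (axis j 1)"] by (simp add: inner_axis)

text \<open>The counterpart of \<open>has_weak_grad\<close> for Borel representatives and
  \<open>lborel\<close>; the passage is \<open>has_weak_grad_borel\<close>.\<close>

definition weak_gradient :: "(real^'n \<Rightarrow> real^'n) \<Rightarrow> (real^'n \<Rightarrow> real^'n^'n) \<Rightarrow> bool" where
  "weak_gradient f F \<longleftrightarrow> loc_int f \<and> loc_int F \<and>
     (\<forall>g i j. test_fun UNIV g \<longrightarrow>
        (LBINT x. f x $ i * pderiv_dir (axis j 1) g x) = - (LBINT x. F x $ i $ j * g x))"

text \<open>For fixed \<open>x\<close> the function \<open>g (x - y)\<close> of \<open>y\<close> is
  a test function. The sign from differentiating the reflected argument cancels the sign in the
  definition of the weak gradient.\<close>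

lemma pderiv_dir_conv_weak_gradient:
  assumes w: "weak_gradient w F" and g: "test_fun UNIV g"
  shows "pderiv_dir (axis j 1) (\<lambda>x. conv g w x $ i) x = conv g F x $ i $ j"
proof -
  have l: "loc_int w" "loc_int F" using w by (auto simp: weak_gradient_def)
  have "pderiv_dir (axis j 1) (\<lambda>x. conv g w x $ i) x = pderiv_dir (axis j 1) (conv g (\<lambda>y. w y $ i)) x"
    using l g by (simp add: conv_nth)
  also have "\<dots> = conv (pderiv_dir (axis j 1) g) (\<lambda>y. w y $ i) x"
    by (rule pderiv_dir_conv[OF loc_int_nth[OF l(1)] g axis_Basis])
  also have "\<dots> = - (LBINT y. w y $ i * pderiv_dir (axis j 1) (\<lambda>y. g (x - y)) y)"
    using pderiv_dir_affine[OF test_fun_smooth[OF g], of "axis j 1" x "-1"]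
    by (simp add: conv_def mult.commute)
  also have "\<dots> = (LBINT y. F y $ i $ j * g (x - y))"
    using w test_fun_reflect[OF g, of x] by (simp add: weak_gradient_def)
  also have "\<dots> = conv g F x $ i $ j"
    using l g by (simp add: conv_nth_nth) (simp add: conv_def mult.commute)
  finally show ?thesis .
qed

lemma conv_has_derivative_weak_gradient:
  assumes w: "weak_gradient w F" and g: "test_fun UNIV g"
  shows "(conv g w has_derivative (\<lambda>h. conv g F x *v h)) (at x)"
proof -
  have l: "loc_int w" "loc_int F" using w by (auto simp: weak_gradient_def)
  have "(\<Sum>b\<in>Basis. (h \<bullet> b) *\<^sub>R conv (pderiv_dir b g) w x) = conv g F x *v h" for h
  proof (rule vec_eq_iff[THEN iffD2], intro allI)
    fix i
    have "conv (pderiv_dir (axis j 1) g) w x $ i = conv g F x $ i $ j" for j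
      using pderiv_dir_conv_weak_gradient[OF w g, of j i x]
        pderiv_dir_conv[OF loc_int_nth[OF l(1)] g axis_Basis, of j i x]
        test_fun_pderiv_dir[OF g axis_Basis, of j]
      by (simp add: conv_nth[OF l(1)] g)
    then show "(\<Sum>b\<in>Basis. (h \<bullet> b) *\<^sub>R conv (pderiv_dir b g) w x) $ i = (conv g F x *v h) $ i"
      by (simp add: sum_Basis_real_vec inner_axis matrix_vector_mult_def mult.commute)
  qed
  with conv_has_derivative[OF l(1) g, of x] show ?thesis by simp
qed

text \<open>The fundamental theorem of calculus along the segment from \<open>x\<close> to
  \<open>x - z\<close>, made scalar by pairing with the increment \<open>a\<close> itself. Young's
  inequality leaves half of |a|^2 on the right, where it is absorbed.\<close>

lemma conv_increment:
  assumes w: "weak_gradient w F" and g: "test_fun UNIV g"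
  shows "ennreal ((norm (conv g w x - conv g w (x - z)))\<^sup>2) \<le>
    (\<integral>\<^sup>+s. indicator {0..1} s * ennreal ((norm z)\<^sup>2 * (norm (conv g F (x - s *\<^sub>R z)))\<^sup>2) \<partial>lborel)"
proof -
  have l: "loc_int w" "loc_int F" using w by (auto simp: weak_gradient_def)
  define a where "a = conv g w x - conv g w (x - z)"
  define G where "G s = conv g F (x - s *\<^sub>R z)" for s
  have cG: "continuous_on S G" for S
    unfolding G_def by (rule continuous_on_compose2[OF conv_continuous[OF l(2) g, of UNIV]]) (auto intro!: continuous_intros)
  have d: "((\<lambda>s. a \<bullet> conv g w (x - s *\<^sub>R z)) has_vector_derivative - (a \<bullet> (G s *v z))) (at s within {0..1})" for s
  proof -
    have 1: "((\<lambda>s. x - s *\<^sub>R z) has_derivative (\<lambda>h. - (h *\<^sub>R z))) (at s within {0..1})"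
      by (auto intro!: derivative_eq_intros)
    have "((\<lambda>s. conv g w (x - s *\<^sub>R z)) has_derivative (\<lambda>h. G s *v (- (h *\<^sub>R z)))) (at s within {0..1})"
      unfolding G_def
      by (rule has_derivative_compose[OF 1 conv_has_derivative_weak_gradient[OF w g]])
    then have "((\<lambda>s. a \<bullet> conv g w (x - s *\<^sub>R z)) has_derivative (\<lambda>h. a \<bullet> (G s *v (- (h *\<^sub>R z))))) (at s within {0..1})"
      by (rule has_derivative_inner_right)
    moreover have "G s *v (- (h *\<^sub>R z)) = - (h *\<^sub>R (G s *v z))" for h
      using matrix_vector_mult_scaleR[of "G s" "- h" z] by simp
    ultimately show ?thesis by (simp add: has_vector_derivative_def)
  qed
  have cc: "continuous_on {0..1} (\<lambda>s. a \<bullet> (G s *v z))"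
    unfolding inner_vec_def matrix_vector_mult_def using cG by (auto intro!: continuous_intros)
  have i1: "integrable lborel (\<lambda>s. indicator {0..1} s *\<^sub>R (a \<bullet> (G s *v z)))"
    using borel_integrable_atLeastAtMost'[OF cc] by (simp add: set_integrable_def)
  have i2: "integrable lborel (\<lambda>s. indicator {0..1} s *\<^sub>R ((norm z)\<^sup>2 * (norm (G s))\<^sup>2))"
  proof -
    have "continuous_on {0..1} (\<lambda>s. (norm z)\<^sup>2 * (norm (G s))\<^sup>2)" by (intro continuous_intros cG)
    from borel_integrable_atLeastAtMost'[OF this] show ?thesis by (simp add: set_integrable_def)
  qed
  have i3: "integrable lborel (\<lambda>s. indicator {0..1::real} s * (norm a)\<^sup>2 :: real)"
    by (intro integrable_mult_left integrable_real_indicator) auto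
  have "(LBINT s. indicator {0..1} s *\<^sub>R (- (a \<bullet> (G s *v z)))) = a \<bullet> conv g w (x - 1 *\<^sub>R z) - a \<bullet> conv g w (x - 0 *\<^sub>R z)"
    by (rule integral_FTC_atLeastAtMost) (use d cc in \<open>auto intro: continuous_intros\<close>)
  also have "\<dots> = - (norm a)\<^sup>2"
    by (simp add: a_def power2_norm_eq_inner inner_diff_left inner_diff_right)
  finally have "(norm a)\<^sup>2 = (LBINT s. indicator {0..1} s *\<^sub>R (a \<bullet> (G s *v z)))" by simp
  also have "\<dots> \<le> (LBINT s. (indicator {0..1} s * (norm a)\<^sup>2) / 2 + (indicator {0..1} s *\<^sub>R ((norm z)\<^sup>2 * (norm (G s))\<^sup>2)) / 2)"
  proof (rule integral_mono[OF i1])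
    show "integrable lborel (\<lambda>s. (indicator {0..1} s * (norm a)\<^sup>2) / 2 + (indicator {0..1} s *\<^sub>R ((norm z)\<^sup>2 * (norm (G s))\<^sup>2)) / 2)"
      using i2 i3 by (intro Bochner_Integration.integrable_add integrable_divide_zero) auto
    fix s
    have "a \<bullet> (G s *v z) \<le> norm a * (norm z * norm (G s))"
      using Cauchy_Schwarz_ineq2[of a "G s *v z"] norm_matrix_vector_le[of "G s" z]
      by (smt (verit) mult.commute mult_left_mono norm_ge_zero)
    also have "\<dots> \<le> ((norm a)\<^sup>2 + (norm z * norm (G s))\<^sup>2) / 2"
      using sum_squares_bound[of "norm a" "norm z * norm (G s)"] by simp
    finally have "a \<bullet> (G s *v z) \<le> (norm a)\<^sup>2 / 2 + (norm z)\<^sup>2 * (norm (G s))\<^sup>2 / 2"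
      by (simp add: power_mult_distrib add_divide_distrib)
    then show "indicator {0..1} s *\<^sub>R (a \<bullet> (G s *v z)) \<le>
        (indicator {0..1} s * (norm a)\<^sup>2) / 2 + (indicator {0..1} s *\<^sub>R ((norm z)\<^sup>2 * (norm (G s))\<^sup>2)) / 2"
      by (simp add: indicator_def)
  qed
  also have "\<dots> = (norm a)\<^sup>2 / 2 + (LBINT s. indicator {0..1} s *\<^sub>R ((norm z)\<^sup>2 * (norm (G s))\<^sup>2)) / 2"
    using i2 i3 by (subst Bochner_Integration.integral_add) auto
  finally have "(norm a)\<^sup>2 \<le> (LBINT s. indicator {0..1} s *\<^sub>R ((norm z)\<^sup>2 * (norm (G s))\<^sup>2))" by simp
  then have "ennreal ((norm a)\<^sup>2) \<le> ennreal (LBINT s. indicator {0..1} s *\<^sub>R ((norm z)\<^sup>2 * (norm (G s))\<^sup>2))"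
    by (rule ennreal_leI)
  also have "\<dots> = (\<integral>\<^sup>+s. ennreal (indicator {0..1} s *\<^sub>R ((norm z)\<^sup>2 * (norm (G s))\<^sup>2)) \<partial>lborel)"
    by (rule nn_integral_eq_integral[symmetric, OF i2]) (auto simp: indicator_def)
  also have "\<dots> = (\<integral>\<^sup>+s. indicator {0..1} s * ennreal ((norm z)\<^sup>2 * (norm (G s))\<^sup>2) \<partial>lborel)"
    by (intro nn_integral_cong) (auto simp: indicator_def)
  finally show ?thesis by (simp add: a_def G_def)
qed

text \<open>After Tonelli the inner integral over \<open>x\<close> is independent of the position on
  the segment, so the average over the segment costs nothing.\<close>

lemma conv_translation:
  assumes w: "weak_gradient w F" and r: "mollifier d r"
  shows "(\<integral>\<^sup>+x. ennreal ((norm (conv r w x - conv r w (x - z)))\<^sup>2) \<partial>lborel) \<le>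
    ennreal ((norm z)\<^sup>2) * sq_nnorm F"
proof -
  have l: "loc_int w" "loc_int F" using w by (auto simp: weak_gradient_def)
  have g: "test_fun UNIV r" using r by (simp add: mollifier_def)
  have [measurable]: "conv r F \<in> borel_measurable borel" by (rule conv_measurable[OF l(2) g])
  have "(\<integral>\<^sup>+x. ennreal ((norm (conv r w x - conv r w (x - z)))\<^sup>2) \<partial>lborel) \<le>
      (\<integral>\<^sup>+x. (\<integral>\<^sup>+s. indicator {0..1} s * ennreal ((norm z)\<^sup>2 * (norm (conv r F (x - s *\<^sub>R z)))\<^sup>2) \<partial>lborel) \<partial>lborel)"
    by (intro nn_integral_mono conv_increment[OF w g])
  also have "\<dots> = (\<integral>\<^sup>+s. (\<integral>\<^sup>+x. indicator {0..1} s * ennreal ((norm z)\<^sup>2 * (norm (conv r F (x - s *\<^sub>R z)))\<^sup>2) \<partial>lborel) \<partial>lborel)"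
    by (rule pair_sigma_finite.Fubini'[symmetric])
      (auto intro!: pair_sigma_finite.intro sigma_finite_lborel, measurable)
  also have "\<dots> = (\<integral>\<^sup>+s. indicator {0..1} (s::real) * (ennreal ((norm z)\<^sup>2) * sq_nnorm (conv r F)) \<partial>lborel)"
    using nn_integral_shift[of "\<lambda>x. ennreal ((norm (conv r F x))\<^sup>2)"]
    by (intro nn_integral_cong) (simp add: nn_integral_cmult ennreal_mult')
  also have "\<dots> = ennreal ((norm z)\<^sup>2) * sq_nnorm (conv r F)"
    by (simp add: nn_integral_multc)
  also have "\<dots> \<le> ennreal ((norm z)\<^sup>2) * sq_nnorm F"
    by (intro mult_left_mono mollifier_young[OF l(2) r]) auto
  finally show ?thesis .
qed

lemma AE_lborel_shift:
  fixes z :: "'a::euclidean_space"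
  assumes "AE x in lborel. P x"
  shows "AE x in lborel. P (x - z)"
proof -
  obtain N where N: "N \<in> null_sets lborel" "{x. \<not> P x} \<subseteq> N"
    using assms by (auto elim!: AE_E simp: null_sets_def)
  then have [measurable]: "N \<in> sets borel" by auto
  have "(\<integral>\<^sup>+x. indicator N (x - z) \<partial>lborel) = 0"
    using N nn_integral_shift[of "indicator N" z] by (simp add: null_sets_def)
  then have "AE x in lborel. indicator N (x - z) = (0::ennreal)"
    by (subst (asm) nn_integral_0_iff_AE) auto
  then show ?thesis by eventually_elim (use N in \<open>auto simp: indicator_def split: if_splits\<close>)
qed

text \<open>Fatou's lemma: the bound for mollifications is independent of the mollifier, and they
  converge almost everywhere both at \<open>x\<close> and at \<open>x - z\<close>.\<close>

lemma (in cutoff) weak_gradient_translation: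
  fixes w :: "real^'n \<Rightarrow> real^'n"
  assumes w: "weak_gradient w F"
  shows "(\<integral>\<^sup>+x. ennreal ((norm (w x - w (x - z)))\<^sup>2) \<partial>lborel) \<le>
    ennreal ((norm z)\<^sup>2) * sq_nnorm F" (is "_ \<le> ?B")
proof -
  have l: "loc_int w" "loc_int F" using w by (auto simp: weak_gradient_def)
  obtain r where r: "\<And>n::nat. mollifier 1 (r n)" "AE x in lborel. (\<lambda>n. conv (r n) w x) \<longlonglongrightarrow> w x"
    using mollifier_AE[OF l(1)] by blast
  have [measurable]: "conv (r n) w \<in> borel_measurable borel" for n
    using r(1)[of n] by (intro conv_measurable[OF l(1)]) (simp add: mollifier_def)
  let ?u = "\<lambda>n x. ennreal ((norm (conv (r n) w x - conv (r n) w (x - z)))\<^sup>2)"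
  have "(\<integral>\<^sup>+x. ennreal ((norm (w x - w (x - z)))\<^sup>2) \<partial>lborel) = (\<integral>\<^sup>+x. liminf (\<lambda>n. ?u n x) \<partial>lborel)"
  proof (rule nn_integral_cong_AE)
    show "AE x in lborel. ennreal ((norm (w x - w (x - z)))\<^sup>2) = liminf (\<lambda>n. ?u n x)"
      using r(2) AE_lborel_shift[OF r(2), of z]
    proof eventually_elim
      case (elim x)
      then have "(\<lambda>n. ?u n x) \<longlonglongrightarrow> ennreal ((norm (w x - w (x - z)))\<^sup>2)"
        by (intro tendsto_intros) auto
      from lim_imp_Liminf[OF sequentially_bot this] show ?case by (rule sym)
    qed
  qed
  also have "\<dots> \<le> liminf (\<lambda>n. \<integral>\<^sup>+x. ?u n x \<partial>lborel)" by (rule nn_integral_liminf) measurable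
  also have "\<dots> \<le> liminf (\<lambda>n::nat. ?B)"
    by (intro Liminf_mono always_eventually allI conv_translation[OF w r(1)])
  also have "\<dots> = ?B" by (simp add: Liminf_const)
  finally show ?thesis .
qed

text \<open>Both high-frequency parts have the form \<open>x \<mapsto> \<integral>k x z (w x - w (x - z)) dz\<close> with a kernel that has
  a finite second moment, which makes Fourier analysis of \<open>w\<close> unnecessary.\<close>

lemma (in cutoff) increment_average:
  fixes w H :: "real^'n \<Rightarrow> real^'n"
  assumes w: "weak_gradient w F"
    and K [measurable]: "K \<in> borel_measurable borel"
    and H: "\<And>x. ennreal ((norm (H x))\<^sup>2) \<le> (\<integral>\<^sup>+z. K z * ennreal ((norm (w x - w (x - z)))\<^sup>2) \<partial>lborel)"
    and B: "(\<integral>\<^sup>+z. K z * ennreal ((norm z)\<^sup>2) \<partial>lborel) \<le> B"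
  shows "sq_nnorm H \<le> B * sq_nnorm F"
proof -
  have [measurable]: "w \<in> borel_measurable borel" using w by (auto simp: weak_gradient_def loc_int_def)
  have "sq_nnorm H \<le>
      (\<integral>\<^sup>+x. (\<integral>\<^sup>+z. K z * ennreal ((norm (w x - w (x - z)))\<^sup>2) \<partial>lborel) \<partial>lborel)"
    by (intro nn_integral_mono H)
  also have "\<dots> = (\<integral>\<^sup>+z. (\<integral>\<^sup>+x. K z * ennreal ((norm (w x - w (x - z)))\<^sup>2) \<partial>lborel) \<partial>lborel)"
    by (rule lborel_pair.Fubini'[symmetric]) measurable
  also have "\<dots> \<le> (\<integral>\<^sup>+z. K z * ennreal ((norm z)\<^sup>2) * sq_nnorm F \<partial>lborel)"
    by (intro nn_integral_mono)
      (simp add: nn_integral_cmult mult.assoc mult_left_mono weak_gradient_translation[OF w])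
  also have "\<dots> = (\<integral>\<^sup>+z. K z * ennreal ((norm z)\<^sup>2) \<partial>lborel) * sq_nnorm F"
    by (rule nn_integral_multc) measurable
  also have "\<dots> \<le> B * sq_nnorm F"
    by (rule mult_right_mono[OF B]) simp
  finally show ?thesis .
qed

section \<open>Borel representatives of Lebesgue measurable data, and uniqueness of weak
  gradients\<close>

lemma borel_version:
  fixes f :: "'a::euclidean_space \<Rightarrow> 'b::euclidean_space"
  assumes "f \<in> borel_measurable lebesgue"
  obtains g where "g \<in> borel_measurable borel" "AE x in lborel. f x = g x"
proof -
  have "\<exists>g\<in>borel_measurable lborel. AE x in lborel. f x \<bullet> b = g x" for b
    by (intro completion_ex_borel_measurable_real borel_measurable_inner assms borel_measurable_const)
  then have "\<forall>b. \<exists>g. g \<in> borel_measurable borel \<and> (AE x in lborel. f x \<bullet> b = g x)" by auto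
  from choice[OF this] obtain g
    where g: "\<And>b. g b \<in> borel_measurable borel" "\<And>b. AE x in lborel. f x \<bullet> b = g b x"
    by blast
  show thesis
  proof
    show "(\<lambda>x. \<Sum>b\<in>Basis. g b x *\<^sub>R b) \<in> borel_measurable borel" using g(1) by measurable
    have "AE x in lborel. \<forall>b\<in>Basis. f x \<bullet> b = g b x" using g(2) by (simp add: AE_finite_all)
    then show "AE x in lborel. f x = (\<Sum>b\<in>Basis. g b x *\<^sub>R b)"
      by eventually_elim (subst euclidean_representation[symmetric], auto intro: sum.cong)
  qed
qed

lemma loc_integrable_measurable:
  assumes "loc_integrable UNIV f"
  shows "f \<in> borel_measurable lebesgue"
proof (rule borel_measurable_LIMSEQ_metric)
  show "(\<lambda>x. indicator (cball 0 (real n)) x *\<^sub>R f x) \<in> borel_measurable lebesgue" for n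
    using assms unfolding loc_integrable_def set_integrable_def
    by (intro borel_measurable_integrable) auto
  fix x
  have "eventually (\<lambda>n. indicator (cball 0 (real n)) x *\<^sub>R f x = f x) sequentially"
    unfolding eventually_sequentially
    by (intro exI[of _ "nat \<lceil>norm x\<rceil>"]) (auto simp: indicator_def)
  then show "(\<lambda>n. indicator (cball 0 (real n)) x *\<^sub>R f x) \<longlonglongrightarrow> f x"
    by (rule tendsto_eventually)
qed

lemma loc_integrable_loc_int:
  assumes "loc_integrable UNIV f" "g \<in> borel_measurable borel" "AE x in lborel. f x = g x"
  shows "loc_int g"
  unfolding loc_int_def set_integrable_def
proof (intro conjI allI assms(2))
  fix R :: real
  have i: "integrable lebesgue (\<lambda>x. indicator (cball 0 R) x *\<^sub>R f x)"
    using assms(1) by (auto simp: loc_integrable_def set_integrable_def)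
  have m: "(\<lambda>x. indicator (cball 0 R) x *\<^sub>R g x) \<in> borel_measurable borel"
    by (intro borel_measurable_scaleR borel_measurable_indicator assms(2)) auto
  have "AE x in lebesgue. indicator (cball 0 R) x *\<^sub>R f x = indicator (cball 0 R) x *\<^sub>R g x"
    using AE_completion[OF assms(3)] by eventually_elim simp
  then have "integrable lebesgue (\<lambda>x. indicator (cball 0 R) x *\<^sub>R g x)"
    using i m by (subst integrable_cong_AE[symmetric]) (auto intro: measurable_completion borel_measurable_integrable)
  then show "integrable lborel (\<lambda>x. indicator (cball 0 R) x *\<^sub>R g x)"
    using m by (simp add: integrable_completion)
qed

lemma lebesgue_integral_AE_lborel:
  fixes f g :: "'a::euclidean_space \<Rightarrow> 'b::{banach, second_countable_topology}"
  assumes f: "f \<in> borel_measurable lebesgue" and g: "g \<in> borel_measurable borel" and e: "AE x in lborel. f x = g x"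
  shows "(\<integral>x. f x \<partial>lebesgue) = (LBINT x. g x)"
    "integrable lebesgue f \<longleftrightarrow> integrable lborel g"
proof -
  have g': "g \<in> borel_measurable lebesgue" using g by (simp add: measurable_completion)
  show "(\<integral>x. f x \<partial>lebesgue) = (LBINT x. g x)"
    using integral_cong_AE[OF f g' AE_completion[OF e]] g by (simp add: integral_completion)
  show "integrable lebesgue f \<longleftrightarrow> integrable lborel g"
    using integrable_cong_AE[OF f g' AE_completion[OF e]] g by (simp add: integrable_completion)
qed

lemma has_weak_grad_borel:
  fixes f :: "real^'n \<Rightarrow> real^'n"
  assumes h: "has_weak_grad f F"
    and g: "g \<in> borel_measurable borel" "AE x in lborel. f x = g x"
    and G: "G \<in> borel_measurable borel" "AE x in lborel. F x = G x"
  shows "weak_gradient g G"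
  unfolding weak_gradient_def
proof (intro conjI allI impI)
  have l: "loc_integrable UNIV f" "loc_integrable UNIV F" using h by (auto simp: has_weak_grad_def)
  note m = loc_integrable_measurable[OF l(1)] loc_integrable_measurable[OF l(2)]
  show "loc_int g" "loc_int G" by (rule loc_integrable_loc_int[OF l(1) g] loc_integrable_loc_int[OF l(2) G])+
  fix p :: "real^'n \<Rightarrow> real" and i j assume p: "test_fun UNIV p"
  have [measurable]: "p \<in> borel_measurable borel" "pderiv_dir (axis j 1) p \<in> borel_measurable borel"
    using test_fun_measurable[OF p] test_fun_measurable[OF test_fun_pderiv_dir[OF p axis_Basis]] by auto
  have ml: "p \<in> borel_measurable lebesgue" "pderiv_dir (axis j 1) p \<in> borel_measurable lebesgue"
    by (simp_all add: measurable_completion)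
  have "(\<integral>x. f x $ i * pderiv_dir (axis j 1) p x \<partial>lebesgue) = (LBINT x. g x $ i * pderiv_dir (axis j 1) p x)"
  proof (rule lebesgue_integral_AE_lborel)
    show "(\<lambda>x. f x $ i * pderiv_dir (axis j 1) p x) \<in> borel_measurable lebesgue"
      by (intro borel_measurable_times borel_measurable_vec_nth m ml)
    show "(\<lambda>x. g x $ i * pderiv_dir (axis j 1) p x) \<in> borel_measurable borel" using g by measurable
    show "AE x in lborel. f x $ i * pderiv_dir (axis j 1) p x = g x $ i * pderiv_dir (axis j 1) p x"
      using g(2) by eventually_elim simp
  qed
  moreover have "(\<integral>x. F x $ i $ j * p x \<partial>lebesgue) = (LBINT x. G x $ i $ j * p x)"
  proof (rule lebesgue_integral_AE_lborel)
    show "(\<lambda>x. F x $ i $ j * p x) \<in> borel_measurable lebesgue"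
      by (intro borel_measurable_times borel_measurable_vec_nth m ml)
    show "(\<lambda>x. G x $ i $ j * p x) \<in> borel_measurable borel" using G by measurable
    show "AE x in lborel. F x $ i $ j * p x = G x $ i $ j * p x"
      using G(2) by eventually_elim simp
  qed
  ultimately show "(LBINT x. g x $ i * pderiv_dir (axis j 1) p x) = - (LBINT x. G x $ i $ j * p x)"
    using h p by (simp add: has_weak_grad_def)
qed

text \<open>\<open>weak_grad\<close> is a choice, while \<open>in_H1\<close> speaks of some square
  integrable gradient. Uniqueness, by testing the difference of corresponding entries, makes the two
  interchangeable.\<close>

lemma (in cutoff) weak_gradient_unique:
  fixes w :: "real^'n \<Rightarrow> real^'n"
  assumes "weak_gradient w F" "weak_gradient w G"
  shows "AE x in lborel. F x = G x"
proof -
  have l: "loc_int F" "loc_int G" using assms by (auto simp: weak_gradient_def)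
  have "AE x in lborel. F x $ i $ j - G x $ i $ j = 0" for i j
  proof (rule du_bois_reymond)
    note ll = loc_int_nth_nth[OF l(1), of i j] loc_int_nth_nth[OF l(2), of i j]
    show "loc_int (\<lambda>x. F x $ i $ j - G x $ i $ j)"
      using ll unfolding loc_int_def by (auto intro: set_integral_diff)
    fix g :: "real^'n \<Rightarrow> real" assume g: "test_fun UNIV g"
    have "integrable lborel (\<lambda>x. F x $ i $ j * g x)" "integrable lborel (\<lambda>x. G x $ i $ j * g x)"
      using loc_int_test_fun[OF ll(1) g] loc_int_test_fun[OF ll(2) g] by (simp_all add: mult.commute)
    then have "(LBINT x. (F x $ i $ j - G x $ i $ j) * g x) =
        (LBINT x. F x $ i $ j * g x) - (LBINT x. G x $ i $ j * g x)"
      by (simp add: left_diff_distrib)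
    also have "\<dots> = 0"
    proof -
      have "(LBINT x. w x $ i * pderiv_dir (axis j 1) g x) = - (LBINT x. F x $ i $ j * g x)"
        using assms(1) g unfolding weak_gradient_def by blast
      moreover have "(LBINT x. w x $ i * pderiv_dir (axis j 1) g x) = - (LBINT x. G x $ i $ j * g x)"
        using assms(2) g unfolding weak_gradient_def by blast
      ultimately show ?thesis by linarith
    qed
    finally show "(LBINT x. (F x $ i $ j - G x $ i $ j) * g x) = 0" .
  qed
  then have "AE x in lborel. \<forall>i j. F x $ i $ j - G x $ i $ j = 0"
    by (simp add: AE_all_countable)
  then show ?thesis by eventually_elim (simp add: vec_eq_iff)
qed

subsection \<open>Cell averages\<close>

text \<open>The floor is the index of the half-open cube containing the point. The relation replaces
  the sum over cubes by a single jointly measurable kernel.\<close>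

definition same_cell :: "real \<Rightarrow> real^'n \<Rightarrow> real^'n \<Rightarrow> bool" where
  "same_cell h x y \<longleftrightarrow> (\<forall>i. \<lfloor>x $ i / h + 1/2\<rfloor> = \<lfloor>y $ i / h + 1/2\<rfloor>)"

lemma mem_grid_cube_iff:
  assumes "h > 0"
  shows "y \<in> grid_cube h k \<longleftrightarrow> (\<forall>i. \<lfloor>y $ i / h + 1/2\<rfloor> = k $ i)"
proof -
  have "h * (of_int (k $ i) - 1/2) \<le> y $ i \<longleftrightarrow> of_int (k $ i) \<le> y $ i / h + 1/2" for i
    using assms by (simp add: field_simps)
  moreover have "y $ i < h * (of_int (k $ i) + 1/2) \<longleftrightarrow> y $ i / h + 1/2 < of_int (k $ i) + 1" for i
    using assms by (simp add: field_simps)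
  ultimately show ?thesis by (simp add: grid_cube_def floor_eq_iff)
qed

lemma grid_cube_borel [measurable]: 
  fixes k :: "int^'n"
  shows "grid_cube h k \<in> sets borel"
proof -
  have "Measurable.pred borel (\<lambda>x::real^'n. \<forall>i. h * (of_int (k $ i) - 1/2) \<le> x $ i \<and> x $ i < h * (of_int (k $ i) + 1/2))"
    by measurable
  then show ?thesis by (simp add: grid_cube_def pred_def)
qed

lemma emeasure_cube:
  fixes l u :: "real^'n"
  assumes "\<And>i. u $ i - l $ i = s" "s \<ge> 0"
  shows "emeasure lborel (cbox l u) = ennreal (s ^ CARD('n))" "emeasure lborel (box l u) = ennreal (s ^ CARD('n))"
proof -
  have b: "(u - l) \<bullet> b = s" if "b \<in> Basis" for b
    using that assms by (auto simp: Basis_real_vec inner_axis)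
  then have le: "l \<bullet> b \<le> u \<bullet> b" if "b \<in> Basis" for b
    using that assms(2) by (metis diff_ge_0_iff_ge inner_diff_left)
  show "emeasure lborel (cbox l u) = ennreal (s ^ CARD('n))" "emeasure lborel (box l u) = ennreal (s ^ CARD('n))"
    using le b assms(2) by (simp_all add: prod_ennreal[symmetric] ennreal_power)
qed

lemma emeasure_grid_cube:
  assumes h: "h > 0"
  shows "emeasure lborel (grid_cube h k :: (real^'n) set) = ennreal (h ^ CARD('n))"
proof (rule antisym)
  let ?l = "\<chi> i. h * (of_int (k $ i) - 1/2) :: real^'n" and ?u = "\<chi> i. h * (of_int (k $ i) + 1/2) :: real^'n"
  have d: "?u $ i - ?l $ i = h" for i by (simp add: algebra_simps)
  have "grid_cube h k \<subseteq> cbox ?l ?u" by (auto simp: grid_cube_def mem_box_cart less_imp_le)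
  then have "emeasure lborel (grid_cube h k) \<le> emeasure lborel (cbox ?l ?u)" by (rule emeasure_mono) simp
  then show "emeasure lborel (grid_cube h k) \<le> ennreal (h ^ CARD('n))"
    using emeasure_cube(1)[of ?u ?l h, OF d] h by simp
  have "box ?l ?u \<subseteq> grid_cube h k" by (auto simp: grid_cube_def mem_box_cart less_imp_le)
  then have "emeasure lborel (box ?l ?u) \<le> emeasure lborel (grid_cube h k)" by (rule emeasure_mono) simp
  then show "ennreal (h ^ CARD('n)) \<le> emeasure lborel (grid_cube h k)"
    using emeasure_cube(2)[of ?u ?l h, OF d] h by simp
qed

text \<open>The half-open cubes partition the space, so the infinite sum has one nonzero indicator,
  at the cube of \<open>x\<close>.\<close>

lemma cube_interp_eq:
  fixes f g :: "real^'n \<Rightarrow> real^'n"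
  assumes h: "h > 0" and f: "f \<in> borel_measurable lebesgue" and g: "g \<in> borel_measurable borel"
    and e: "AE x in lborel. f x = g x"
  shows "cube_interp h f x = (LBINT y. ((if same_cell h x y then 1 else 0) / h ^ CARD('n)) *\<^sub>R g y)"
proof -
  define k where "k = (\<chi> i. \<lfloor>x $ i / h + 1/2\<rfloor>)"
  have sc: "same_cell h x y \<longleftrightarrow> y \<in> grid_cube h k" for y
    using h by (auto simp: mem_grid_cube_iff same_cell_def k_def)
  have xk: "x \<in> grid_cube h k'  \<longleftrightarrow> k' = k" for k'
    using h by (auto simp: mem_grid_cube_iff k_def vec_eq_iff)
  let ?Q = "grid_cube h k"
  have m: "measure lebesgue ?Q = h ^ CARD('n)"
    using emeasure_grid_cube[OF h, of k] h by (simp add: measure_completion measure_def)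
  have "cube_interp h f x = (\<Sum>\<^sub>\<infinity>k'\<in>{k}. indicator (grid_cube h k') x *\<^sub>R
        ((1 / measure lebesgue (grid_cube h k')) *\<^sub>R (LINT y:grid_cube h k'|lebesgue. f y)))"
    unfolding cube_interp_def by (rule infsum_cong_neutral) (auto simp: xk)
  also have "\<dots> = (1 / h ^ CARD('n)) *\<^sub>R (LINT y:?Q|lebesgue. f y)"
    using xk[of k] m by simp
  also have "(LINT y:?Q|lebesgue. f y) = (LBINT y. indicator ?Q y *\<^sub>R g y)"
    unfolding set_lebesgue_integral_def
  proof (rule lebesgue_integral_AE_lborel)
    show "(\<lambda>y. indicator ?Q y *\<^sub>R f y) \<in> borel_measurable lebesgue"
      by (intro borel_measurable_scaleR borel_measurable_indicator f) auto
    show "(\<lambda>y. indicator ?Q y *\<^sub>R g y) \<in> borel_measurable borel"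
      by (intro borel_measurable_scaleR borel_measurable_indicator g) auto
    show "AE y in lborel. indicator ?Q y *\<^sub>R f y = indicator ?Q y *\<^sub>R g y"
      using e by eventually_elim simp
  qed
  also have "(1 / h ^ CARD('n)) *\<^sub>R \<dots> = (LBINT y. (1 / h ^ CARD('n)) *\<^sub>R (indicator ?Q y *\<^sub>R g y))"
    by (rule integral_scaleR_right[symmetric])
  also have "\<dots> = (LBINT y. ((if same_cell h x y then 1 else 0) / h ^ CARD('n)) *\<^sub>R g y)"
    by (intro Bochner_Integration.integral_cong refl) (auto simp: sc indicator_def)
  finally show ?thesis .
qed

lemma same_cell_measurable [measurable]:
  "Measurable.pred (borel \<Otimes>\<^sub>M borel) (\<lambda>(x, y). same_cell h x (y :: real^'n))"
proof -
  define c where "c i x = real_of_int \<lfloor>x $ i / h + 1/2\<rfloor>" for i and x :: "real^'n"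
  have [measurable]: "c i \<in> borel_measurable borel" for i
    unfolding c_def by (rule measurable_compose[OF _ borel_measurable_real_floor]) measurable
  have "Measurable.pred (borel \<Otimes>\<^sub>M borel) (\<lambda>p::(real^'n) \<times> (real^'n). \<forall>i. c i (fst p) = c i (snd p))"
    by measurable
  then show ?thesis by (simp add: same_cell_def case_prod_beta c_def)
qed

lemma cube_average_measurable:
  fixes g :: "real^'n \<Rightarrow> real^'n"
  assumes [measurable]: "g \<in> borel_measurable borel"
  shows "(\<lambda>x. LBINT y. ((if same_cell h x y then 1 else 0) / h ^ CARD('n)) *\<^sub>R g y) \<in> borel_measurable borel"
proof (rule lborel.borel_measurable_lebesgue_integral)
  have "Measurable.pred (borel \<Otimes>\<^sub>M lborel) (\<lambda>(x, y). same_cell h x (y :: real^'n))"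
    using same_cell_measurable[where h=h and 'n='n] by simp
  then show "(\<lambda>(x, y). ((if same_cell h x y then 1 else 0) / h ^ CARD('n)) *\<^sub>R g y) \<in> borel_measurable (borel \<Otimes>\<^sub>M lborel)"
    unfolding case_prod_beta' by measurable
qed

text \<open>The kernel \<open>q x y\<close> is not a function of \<open>x - y\<close>, but two
  points of one cell differ by less than \<open>h\<close> in each coordinate, so it is dominated by
  the constant density \<open>1 / h ^ CARD('n)\<close> on the cube \<open>S\<close> of half-width
  \<open>h\<close>. Since \<open>q x\<close> has mass 1, the error is an average of
  increments.\<close>

lemma (in cutoff) cube_average_estimate:
  fixes w :: "real^'n \<Rightarrow> real^'n"
  assumes w: "weak_gradient w F"
    and h: "h > 0"
  shows "(\<integral>\<^sup>+x. ennreal ((norm (w x - (LBINT y. ((if same_cell h x y then 1 else 0) / h ^ CARD('n)) *\<^sub>R w y)))\<^sup>2) \<partial>lborel)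
    \<le> ennreal (real CARD('n) * 2 ^ CARD('n) * h\<^sup>2) * sq_nnorm F"
proof -
  have l: "loc_int w" using w by (simp add: weak_gradient_def)
  have wm [measurable]: "w \<in> borel_measurable borel" using l by (rule loc_int_measurable)
  define q where "q x y = (if same_cell h x y then 1 else 0) / h ^ CARD('n)" for x y :: "real^'n"
  define S where "S = cbox (\<chi> i. - h) (\<chi> i. h :: real^'n)"
  define K where "K z = ennreal (indicator S z / h ^ CARD('n))" for z
  have [measurable]: "S \<in> sets borel" by (simp add: S_def)
  have "(- h \<le> t \<and> t \<le> h) \<longleftrightarrow> \<bar>t\<bar> \<le> h" for t by linarith
  then have S: "z \<in> S \<longleftrightarrow> (\<forall>i. \<bar>z $ i\<bar> \<le> h)" for z by (simp add: S_def mem_box_cart)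
  have q0: "q x y \<ge> 0" for x y using h by (simp add: q_def)
  have qK: "ennreal (q x (x - z)) \<le> K z" for x z
  proof (cases "same_cell h x (x - z)")
    case True
    have "\<bar>z $ i\<bar> \<le> h" for i
    proof -
      have "\<bar>(x $ i / h + 1/2) - ((x - z) $ i / h + 1/2)\<bar> < 1"
      proof -
        have "real_of_int \<lfloor>x $ i / h + 1/2\<rfloor> = real_of_int \<lfloor>(x - z) $ i / h + 1/2\<rfloor>"
          using True by (simp add: same_cell_def)
        then show ?thesis
          using floor_correct[of "x $ i / h + 1/2"] floor_correct[of "(x - z) $ i / h + 1/2"] by linarith
      qed
      then have "\<bar>z $ i / h\<bar> < 1" by (simp add: diff_divide_distrib)
      then show ?thesis using h by (simp add: field_simps)
    qed
    then have "z \<in> S" by (simp add: S)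
    then show ?thesis using True by (simp add: q_def K_def)
  qed (simp add: q_def)
  have qm [measurable]: "q x \<in> borel_measurable borel" for x
  proof -
    have "Measurable.pred borel (same_cell h x)"
      using measurable_compose[OF measurable_Pair1'[of x borel] same_cell_measurable[of h]] by simp
    then show ?thesis unfolding q_def by measurable
  qed
  have qn: "(\<integral>\<^sup>+y. ennreal (q x y) \<partial>lborel) = 1" for x
  proof -
    define k where "k = (\<chi> i. \<lfloor>x $ i / h + 1/2\<rfloor>)"
    have sc: "same_cell h x y \<longleftrightarrow> y \<in> grid_cube h k" for y
      using h by (auto simp: mem_grid_cube_iff same_cell_def k_def)
    have "(\<integral>\<^sup>+y. ennreal (q x y) \<partial>lborel) = (\<integral>\<^sup>+y. ennreal (1 / h ^ CARD('n)) * indicator (grid_cube h k) y \<partial>lborel)"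
      by (intro nn_integral_cong) (auto simp: q_def sc indicator_def)
    also have "\<dots> = ennreal (1 / h ^ CARD('n)) * ennreal (h ^ CARD('n))"
      by (simp add: nn_integral_cmult_indicator emeasure_grid_cube[OF h])
    also have "\<dots> = 1" using h by (subst ennreal_mult'[symmetric]) auto
    finally show ?thesis .
  qed
  have qi: "integrable lborel (q x)" "(LBINT y. q x y) = 1" for x
  proof -
    show "integrable lborel (q x)" using q0 qn by (intro integrableI_nonneg) auto
    from nn_integral_eq_integral[OF this] q0 qn[of x] show "(LBINT y. q x y) = 1"
      by (simp add: ennreal_eq_1)
  qed
  have H: "ennreal ((norm (w x - (LBINT y. q x y *\<^sub>R w y)))\<^sup>2)
      \<le> (\<integral>\<^sup>+z. K z * ennreal ((norm (w x - w (x - z)))\<^sup>2) \<partial>lborel)" for x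
  proof -
    have i: "integrable lborel (\<lambda>y. q x y *\<^sub>R w y)"
    proof (rule loc_int_bounded_mult[OF l qm])
      show "\<bar>q x y\<bar> \<le> 1 / h ^ CARD('n)" for y using h by (simp add: q_def)
      fix y :: "real^'n" assume y: "norm y > norm x + real CARD('n) * h"
      show "q x y = 0"
      proof (rule ccontr)
        assume "q x y \<noteq> 0"
        then have "ennreal (q x (x - (x - y))) > 0" using q0[of x y] by (simp add: less_le)
        then have "K (x - y) > 0" using qK[of x "x - y"] by (rule less_le_trans)
        then have "x - y \<in> S" by (cases "x - y \<in> S") (auto simp: K_def)
        then have "\<bar>(x - y) $ i\<bar> \<le> h" for i by (simp add: S)
        then have "norm (x - y) \<le> real CARD('n) * h"
          using norm_le_l1_cart[of "x - y"] sum_bounded_above[of UNIV "\<lambda>i. \<bar>(x - y) $ i\<bar>" h] by simp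
        then show False using y norm_triangle_ineq3[of x y] by linarith
      qed
    qed
    have "w x - (LBINT y. q x y *\<^sub>R w y) = (LBINT y. q x y *\<^sub>R (w x - w y))"
      using i qi by (simp add: scaleR_right_diff_distrib)
    then have "ennreal ((norm (w x - (LBINT y. q x y *\<^sub>R w y)))\<^sup>2)
        \<le> (\<integral>\<^sup>+y. ennreal (q x y * (norm (w x - w y))\<^sup>2) \<partial>lborel)"
      using weighted_jensen[OF qi(1)[of x], of "\<lambda>y. w x - w y"] q0 qi by simp
    also have "\<dots> = (\<integral>\<^sup>+z. ennreal (q x (x - z) * (norm (w x - w (x - z)))\<^sup>2) \<partial>lborel)"
      by (rule nn_integral_reflect[symmetric]) measurable
    also have "\<dots> \<le> (\<integral>\<^sup>+z. K z * ennreal ((norm (w x - w (x - z)))\<^sup>2) \<partial>lborel)"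
      using qK q0 by (intro nn_integral_mono) (simp add: ennreal_mult mult_right_mono)
    finally show ?thesis .
  qed
  \<comment> \<open>On \<open>S\<close> the squared norm is at most n h^2, and \<open>S\<close> has
    volume (2h)^n; after division by h^n this gives n 2^n h^2, where n is the dimension.\<close>
  have B: "(\<integral>\<^sup>+z. K z * ennreal ((norm z)\<^sup>2) \<partial>lborel) \<le> ennreal (real CARD('n) * 2 ^ CARD('n) * h\<^sup>2)"
  proof -
    have "K z * ennreal ((norm z)\<^sup>2) \<le> ennreal (real CARD('n) * h\<^sup>2 / h ^ CARD('n)) * indicator S z" for z
    proof (cases "z \<in> S")
      case True
      then have "\<bar>z $ i\<bar> \<le> h" for i by (simp add: S)
      then have "(norm z)\<^sup>2 \<le> real CARD('n) * h\<^sup>2"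
        using sum_bounded_above[of UNIV "\<lambda>i. (z $ i)\<^sup>2" "h\<^sup>2"] h
        by (simp add: power2_norm_eq_inner inner_vec_def power2_eq_square[symmetric] abs_le_square_iff[symmetric])
      then show ?thesis using True h
        by (simp add: K_def flip: ennreal_mult) (auto intro!: ennreal_leI divide_right_mono)
    qed (simp add: K_def)
    then have "(\<integral>\<^sup>+z. K z * ennreal ((norm z)\<^sup>2) \<partial>lborel) \<le>
        (\<integral>\<^sup>+z. ennreal (real CARD('n) * h\<^sup>2 / h ^ CARD('n)) * indicator S z \<partial>lborel)"
      by (intro nn_integral_mono)
    also have "\<dots> = ennreal (real CARD('n) * h\<^sup>2 / h ^ CARD('n)) * ennreal ((2 * h) ^ CARD('n))"
      using h by (simp add: nn_integral_cmult_indicator S_def) (subst emeasure_cube, auto)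
    also have "\<dots> = ennreal (real CARD('n) * 2 ^ CARD('n) * h\<^sup>2)"
      using h by (simp add: power_mult_distrib flip: ennreal_mult)
    finally show ?thesis .
  qed
  show ?thesis
    using increment_average[OF w _ H B] by (simp add: q_def K_def)
qed

subsection \<open>The cosine transform of a test function\<close>

text \<open>Integration by parts in the cosine transform yields the sine transform and conversely,
  so decay has to be proved for both at once.\<close>

definition cos_transform :: "('a::euclidean_space \<Rightarrow> real) \<Rightarrow> 'a \<Rightarrow> real" where
  "cos_transform g x = (LBINT \<xi>. g \<xi> * cos (x \<bullet> \<xi>))"

definition sin_transform :: "('a::euclidean_space \<Rightarrow> real) \<Rightarrow> 'a \<Rightarrow> real" where
  "sin_transform g x = (LBINT \<xi>. g \<xi> * sin (x \<bullet> \<xi>))"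

lemma smooth_trig: "smooth (\<lambda>\<xi>. c * cos (x \<bullet> \<xi>) + d * sin (x \<bullet> \<xi>))"
proof (rule smooth_coinduct[of "\<lambda>f. \<exists>c d. f = (\<lambda>\<xi>. c * cos (x \<bullet> \<xi>) + d * sin (x \<bullet> \<xi>))"])
  fix g and b z assume "\<exists>c d. g = (\<lambda>\<xi>. c * cos (x \<bullet> \<xi>) + d * sin (x \<bullet> \<xi>))"
  then obtain c d where g: "g = (\<lambda>\<xi>. c * cos (x \<bullet> \<xi>) + d * sin (x \<bullet> \<xi>))" by blast
  have D: "(g has_derivative (\<lambda>h. (- c * sin (x \<bullet> z) + d * cos (x \<bullet> z)) * (x \<bullet> h))) (at z)" for z
    unfolding g by (auto intro!: derivative_eq_intros simp: algebra_simps)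
  then show "g differentiable (at z)" by (auto simp: differentiable_def)
  have "pderiv_dir b g = (\<lambda>z. d * (x \<bullet> b) * cos (x \<bullet> z) + (- c * (x \<bullet> b)) * sin (x \<bullet> z))"
    using pderiv_dir_eq[OF D] by (auto simp: algebra_simps)
  then show "\<exists>c d. pderiv_dir b g = (\<lambda>\<xi>. c * cos (x \<bullet> \<xi>) + d * sin (x \<bullet> \<xi>))" by blast
qed blast

lemma smooth_cos: "smooth (\<lambda>\<xi>. cos (x \<bullet> \<xi>))" and smooth_sin: "smooth (\<lambda>\<xi>. sin (x \<bullet> \<xi>))"
  using smooth_trig[of 1 x 0] smooth_trig[of 0 x 1] by simp_all

text \<open>Convolution of a test function with 1 is the constant function with value its integral.
  Its derivative is 0 on the one hand and the integral of the derivative on the other.\<close>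

lemma integral_pderiv_dir:
  fixes g :: "'a::euclidean_space \<Rightarrow> real"
  assumes g: "test_fun UNIV g" and b: "b \<in> Basis"
  shows "(LBINT x. pderiv_dir b g x) = 0"
proof -
  have l: "loc_int (\<lambda>x::'a. 1::real)"
    unfolding loc_int_def set_integrable_def
    by (auto intro!: integrable_real_indicator emeasure_lborel_cball_finite simp del: infinity_ennreal_def)
  have c: "conv g (\<lambda>x. 1) x = (LBINT y. g y)" if "test_fun UNIV g" for g x
    using integral_reflect[OF test_fun_measurable[OF that], of x] by (simp add: conv_def)
  have "pderiv_dir b (conv g (\<lambda>x. 1)) 0 = (LBINT y. pderiv_dir b g y)"
    using pderiv_dir_conv[OF l g b, of 0] c[OF test_fun_pderiv_dir[OF g b]] by simp
  moreover have "conv g (\<lambda>x. 1) = (\<lambda>x. LBINT y. g y)" using c[OF g] by auto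
  ultimately show ?thesis by (simp add: pderiv_dir_def)
qed

lemma transform_by_parts:
  assumes g: "test_fun UNIV g" and b: "b \<in> Basis"
  shows "(x \<bullet> b) * sin_transform g x = cos_transform (pderiv_dir b g) x"
    "(x \<bullet> b) * cos_transform g x = - sin_transform (pderiv_dir b g) x"
proof -
  note g' = test_fun_pderiv_dir[OF g b]
  have dg: "(g has_derivative frechet_derivative g (at z)) (at z)" for z
    using smooth_differentiable[OF test_fun_smooth[OF g]] frechet_derivative_works by blast
  note i = test_fun_integrable[OF test_fun_mult[OF g smooth_cos]] test_fun_integrable[OF test_fun_mult[OF g smooth_sin]]
    test_fun_integrable[OF test_fun_mult[OF g' smooth_cos]] test_fun_integrable[OF test_fun_mult[OF g' smooth_sin]]
  have "pderiv_dir b (\<lambda>\<xi>. g \<xi> * cos (x \<bullet> \<xi>)) z = pderiv_dir b g z * cos (x \<bullet> z) - (x \<bullet> b) * (g z * sin (x \<bullet> z))" for z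
  proof (rule pderiv_dir_eq[THEN trans])
    show "((\<lambda>\<xi>. g \<xi> * cos (x \<bullet> \<xi>)) has_derivative
        (\<lambda>h. frechet_derivative g (at z) h * cos (x \<bullet> z) - (x \<bullet> h) * (g z * sin (x \<bullet> z)))) (at z)"
      by (rule derivative_eq_intros dg refl | simp add: fun_eq_iff algebra_simps)+
  qed (simp add: pderiv_dir_def)
  then have "(LBINT z. pderiv_dir b g z * cos (x \<bullet> z) - (x \<bullet> b) * (g z * sin (x \<bullet> z))) =
      (LBINT z. pderiv_dir b (\<lambda>\<xi>. g \<xi> * cos (x \<bullet> \<xi>)) z)" by (simp only:)
  also have "\<dots> = 0" by (rule integral_pderiv_dir[OF test_fun_mult[OF g smooth_cos] b])
  finally show "(x \<bullet> b) * sin_transform g x = cos_transform (pderiv_dir b g) x"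
    using i by (simp add: sin_transform_def cos_transform_def)
  have "pderiv_dir b (\<lambda>\<xi>. g \<xi> * sin (x \<bullet> \<xi>)) z = pderiv_dir b g z * sin (x \<bullet> z) + (x \<bullet> b) * (g z * cos (x \<bullet> z))" for z
  proof (rule pderiv_dir_eq[THEN trans])
    show "((\<lambda>\<xi>. g \<xi> * sin (x \<bullet> \<xi>)) has_derivative
        (\<lambda>h. frechet_derivative g (at z) h * sin (x \<bullet> z) + (x \<bullet> h) * (g z * cos (x \<bullet> z)))) (at z)"
      by (rule derivative_eq_intros dg refl | simp add: fun_eq_iff algebra_simps)+
  qed (simp add: pderiv_dir_def)
  then have "(LBINT z. pderiv_dir b g z * sin (x \<bullet> z) + (x \<bullet> b) * (g z * cos (x \<bullet> z))) =
      (LBINT z. pderiv_dir b (\<lambda>\<xi>. g \<xi> * sin (x \<bullet> \<xi>)) z)" by (simp only:)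
  also have "\<dots> = 0" by (rule integral_pderiv_dir[OF test_fun_mult[OF g smooth_sin] b])
  finally show "(x \<bullet> b) * cos_transform g x = - sin_transform (pderiv_dir b g) x"
    using i by (simp add: sin_transform_def cos_transform_def)
qed

text \<open>Multiplication by a coordinate turns into a partial derivative of the symbol, so
  every polynomial tempers the transforms of all test functions.\<close>

definition tempers :: "('a::euclidean_space \<Rightarrow> real) \<Rightarrow> bool" where
  "tempers p \<longleftrightarrow> (\<forall>g. test_fun UNIV g \<longrightarrow>
     (\<exists>B. \<forall>x. \<bar>p x * cos_transform g x\<bar> \<le> B \<and> \<bar>p x * sin_transform g x\<bar> \<le> B))"

lemma tempers_one: "tempers (\<lambda>x. 1)"
  unfolding tempers_def
proof (intro allI impI)
  fix g :: "'a \<Rightarrow> real" assume g: "test_fun UNIV g"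
  note i = test_fun_integrable[OF g] test_fun_integrable[OF test_fun_mult[OF g smooth_cos]]
    test_fun_integrable[OF test_fun_mult[OF g smooth_sin]]
  have "\<bar>cos_transform g x\<bar> \<le> (LBINT \<xi>. \<bar>g \<xi>\<bar>)" for x
    unfolding cos_transform_def
    by (rule order_trans[OF integral_abs_bound integral_mono[OF integrable_abs[OF i(2)] integrable_abs[OF i(1)]]])
      (simp add: abs_mult mult_left_le)
  moreover have "\<bar>sin_transform g x\<bar> \<le> (LBINT \<xi>. \<bar>g \<xi>\<bar>)" for x
    unfolding sin_transform_def
    by (rule order_trans[OF integral_abs_bound integral_mono[OF integrable_abs[OF i(3)] integrable_abs[OF i(1)]]])
      (simp add: abs_mult mult_left_le)
  ultimately show "\<exists>B. \<forall>x. \<bar>1 * cos_transform g x\<bar> \<le> B \<and> \<bar>1 * sin_transform g x\<bar> \<le> B" by auto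
qed

lemma tempers_coord:
  assumes "tempers p" "b \<in> Basis"
  shows "tempers (\<lambda>x. (x \<bullet> b) * p x)"
  unfolding tempers_def
proof (intro allI impI)
  fix g :: "'a \<Rightarrow> real" assume g: "test_fun UNIV g"
  obtain B where B: "\<And>x. \<bar>p x * cos_transform (pderiv_dir b g) x\<bar> \<le> B \<and> \<bar>p x * sin_transform (pderiv_dir b g) x\<bar> \<le> B"
    using assms test_fun_pderiv_dir[OF g assms(2)] unfolding tempers_def by blast
  have e: "(x \<bullet> b) * p x * cos_transform g x = - (p x * sin_transform (pderiv_dir b g) x)"
    "(x \<bullet> b) * p x * sin_transform g x = p x * cos_transform (pderiv_dir b g) x" for x
    using transform_by_parts[OF g assms(2), of x] by (metis mult.assoc mult.commute mult_minus_right)+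
  show "\<exists>B. \<forall>x. \<bar>(x \<bullet> b) * p x * cos_transform g x\<bar> \<le> B \<and> \<bar>(x \<bullet> b) * p x * sin_transform g x\<bar> \<le> B"
    unfolding e abs_minus_cancel using B by blast
qed

lemma tempers_add:
  assumes "tempers p" "tempers q"
  shows "tempers (\<lambda>x. p x + q x)"
  unfolding tempers_def
proof (intro allI impI)
  fix g :: "'a \<Rightarrow> real" assume g: "test_fun UNIV g"
  obtain A B where A: "\<And>x. \<bar>p x * cos_transform g x\<bar> \<le> A \<and> \<bar>p x * sin_transform g x\<bar> \<le> A"
    and B: "\<And>x. \<bar>q x * cos_transform g x\<bar> \<le> B \<and> \<bar>q x * sin_transform g x\<bar> \<le> B"
    using assms g unfolding tempers_def by meson
  have "\<bar>(p x + q x) * cos_transform g x\<bar> \<le> A + B \<and> \<bar>(p x + q x) * sin_transform g x\<bar> \<le> A + B" for x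
    using A[of x] B[of x] abs_triangle_ineq[of "p x * cos_transform g x" "q x * cos_transform g x"]
      abs_triangle_ineq[of "p x * sin_transform g x" "q x * sin_transform g x"]
    by (simp add: distrib_right)
  then show "\<exists>B. \<forall>x. \<bar>(p x + q x) * cos_transform g x\<bar> \<le> B \<and> \<bar>(p x + q x) * sin_transform g x\<bar> \<le> B" by blast
qed

lemma tempers_sum:
  assumes "finite S" "tempers q" "\<And>i. i \<in> S \<Longrightarrow> tempers (p i)"
  shows "tempers (\<lambda>x. q x + (\<Sum>i\<in>S. p i x))"
  using assms
proof (induction S)
  case (insert i S)
  have "tempers (\<lambda>x. p i x + (q x + (\<Sum>i\<in>S. p i x)))"
    by (rule tempers_add[OF _ insert.IH]) (use insert.prems in auto)
  then show ?case using insert.hyps by (simp add: add.left_commute)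
qed simp

text \<open>The product over coordinates has an integrable reciprocal; the extra factor
  \<open>1 + (norm x)\<^sup>2\<close> pays for the second moment of the kernel.\<close>

lemma tempers_weight: 
  "tempers (\<lambda>x::'a::euclidean_space. (1 + (norm x)\<^sup>2) * (\<Prod>b\<in>Basis. 1 + (x \<bullet> b)\<^sup>2))"
proof -
  have "tempers (\<lambda>x::'a. \<Prod>b\<in>A. 1 + (x \<bullet> b)\<^sup>2)" if "finite A" "A \<subseteq> Basis" for A
    using that
  proof (induction A)
    case (insert b A)
    then have p: "tempers (\<lambda>x::'a. \<Prod>b\<in>A. 1 + (x \<bullet> b)\<^sup>2)" and b: "b \<in> Basis" by auto
    have "tempers (\<lambda>x::'a. (\<Prod>b\<in>A. 1 + (x \<bullet> b)\<^sup>2) + (x \<bullet> b) * ((x \<bullet> b) * (\<Prod>b\<in>A. 1 + (x \<bullet> b)\<^sup>2)))"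
      by (intro tempers_add tempers_coord p b)
    then show ?case using insert by (simp add: algebra_simps power2_eq_square)
  qed (simp add: tempers_one)
  then have p: "tempers (\<lambda>x::'a. \<Prod>b\<in>Basis. 1 + (x \<bullet> b)\<^sup>2)" by simp
  have "tempers (\<lambda>x::'a. (\<Prod>b\<in>Basis. 1 + (x \<bullet> b)\<^sup>2) + (\<Sum>c\<in>Basis. (x \<bullet> c) * ((x \<bullet> c) * (\<Prod>b\<in>Basis. 1 + (x \<bullet> b)\<^sup>2))))"
    by (intro tempers_sum tempers_coord p) auto
  moreover have "(norm x)\<^sup>2 = (\<Sum>c\<in>Basis. (x \<bullet> c) * (x \<bullet> c))" for x :: 'a
    by (simp add: power2_norm_eq_inner flip: euclidean_inner)
  ultimately show ?thesis by (simp add: distrib_right sum_distrib_right mult.assoc)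
qed

lemma integrable_weight:
  "integrable lborel (\<lambda>x::'a::euclidean_space. \<Prod>b\<in>Basis. inverse (1 + (x \<bullet> b)\<^sup>2))"
proof (rule integrableI_nonneg)
  have i: "integrable lborel (\<lambda>x::real. inverse (1 + x\<^sup>2))"
    using integrable_inverse_1_plus_square by (simp add: set_integrable_def einterval_def)
  have f: "(\<integral>\<^sup>+x. ennreal (inverse (1 + x\<^sup>2)) \<partial>(lborel :: real measure)) < \<infinity>"
    using i by (simp add: integrable_iff_bounded)
  have "(\<integral>\<^sup>+x. ennreal (\<Prod>b\<in>(Basis::'a set). inverse (1 + (x \<bullet> b)\<^sup>2)) \<partial>lborel) =
      (\<integral>\<^sup>+x. (\<Prod>b\<in>(Basis::'a set). ennreal (inverse (1 + (x \<bullet> b)\<^sup>2))) \<partial>lborel)"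
    by (simp add: prod_ennreal)
  also have "\<dots> = (\<Prod>b\<in>(Basis::'a set). \<integral>\<^sup>+x. ennreal (inverse (1 + x\<^sup>2)) \<partial>(lborel :: real measure))"
    by (rule nn_integral_lborel_prod) auto
  also have "\<dots> < \<infinity>" using f by (simp add: power_less_top_ennreal)
  finally show "(\<integral>\<^sup>+x. ennreal (\<Prod>b\<in>(Basis::'a set). inverse (1 + (x \<bullet> b)\<^sup>2)) \<partial>lborel) < \<infinity>" .
qed (auto intro!: AE_I2 prod_nonneg)

lemma cos_transform_measurable:
  assumes [measurable]: "g \<in> borel_measurable borel"
  shows "cos_transform g \<in> borel_measurable borel"
  unfolding cos_transform_def by measurable

lemma cos_transform_decay:
  fixes g :: "'a::euclidean_space \<Rightarrow> real"
  assumes g: "test_fun UNIV g"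
  shows "integrable lborel (\<lambda>x. (1 + (norm x)\<^sup>2) * cos_transform g x)"
proof -
  have [measurable]: "cos_transform g \<in> borel_measurable borel"
    by (rule cos_transform_measurable[OF test_fun_measurable[OF g]])
  obtain B where B: "\<And>x. \<bar>(1 + (norm x)\<^sup>2) * (\<Prod>b\<in>Basis. 1 + (x \<bullet> b)\<^sup>2) * cos_transform g x\<bar> \<le> B"
    using tempers_weight g unfolding tempers_def by blast
  show ?thesis
  proof (rule integrable_pointwise_bound)
    show "integrable lborel (\<lambda>x::'a. B * (\<Prod>b\<in>Basis. inverse (1 + (x \<bullet> b)\<^sup>2)))"
      by (intro integrable_mult_right integrable_weight)
    fix x :: 'a
    define P where "P = (\<Prod>b\<in>Basis. 1 + (x \<bullet> b)\<^sup>2)"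
    have P: "P > 0" unfolding P_def by (intro prod_pos) (auto intro: add_pos_nonneg)
    have "\<bar>(1 + (norm x)\<^sup>2) * cos_transform g x\<bar> * P \<le> B"
      using B[of x] P by (simp add: P_def[symmetric] abs_mult mult_ac)
    then have "\<bar>(1 + (norm x)\<^sup>2) * cos_transform g x\<bar> \<le> B * inverse P"
      using P by (simp add: field_simps)
    then show "norm ((1 + (norm x)\<^sup>2) * cos_transform g x) \<le> B * (\<Prod>b\<in>Basis. inverse (1 + (x \<bullet> b)\<^sup>2))"
      by (simp add: P_def prod_inversef[symmetric] o_def)
  qed measurable
qed

lemma cos_transform_integrable:
  fixes g :: "'a::euclidean_space \<Rightarrow> real"
  assumes g: "test_fun UNIV g"
  shows "integrable lborel (cos_transform g)"
    "integrable lborel (\<lambda>x. (norm x)\<^sup>2 * \<bar>cos_transform g x\<bar>)"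
    "integrable lborel (\<lambda>x. (cos_transform g x)\<^sup>2)"
proof -
  have [measurable]: "cos_transform g \<in> borel_measurable borel"
    by (rule cos_transform_measurable[OF test_fun_measurable[OF g]])
  have d: "integrable lborel (\<lambda>x. (1 + (norm x)\<^sup>2) * \<bar>cos_transform g x\<bar>)"
    using integrable_abs[OF cos_transform_decay[OF g]] by (simp add: abs_mult)
  show 1: "integrable lborel (cos_transform g)"
    by (rule integrable_pointwise_bound[OF d]) (simp_all add: distrib_right)
  show "integrable lborel (\<lambda>x. (norm x)\<^sup>2 * \<bar>cos_transform g x\<bar>)"
    by (rule integrable_pointwise_bound[OF d]) (simp_all add: distrib_right)
  obtain B where B: "\<And>x. \<bar>cos_transform g x\<bar> \<le> B"
    using tempers_one g unfolding tempers_def by fastforce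
  have "(cos_transform g x)\<^sup>2 \<le> B * \<bar>cos_transform g x\<bar>" for x
    using mult_right_mono[OF B[of x] abs_ge_zero[of "cos_transform g x"]] by (simp add: power2_eq_square)
  then show "integrable lborel (\<lambda>x. (cos_transform g x)\<^sup>2)"
    by (intro integrable_pointwise_bound[OF integrable_mult_right[OF integrable_abs[OF 1], of B]]) simp_all
qed

section \<open>Product integrals and the Fourier transform of the Gaussian\<close>

lemma integral_lborel_prod:
  fixes f :: "'a::euclidean_space \<Rightarrow> real \<Rightarrow> complex"
  assumes f: "\<And>b. b \<in> Basis \<Longrightarrow> integrable lborel (f b)"
  shows "integrable lborel (\<lambda>x. \<Prod>b\<in>Basis. f b (x \<bullet> b))"
    "(LBINT x. (\<Prod>b\<in>Basis. f b (x \<bullet> b))) = (\<Prod>b\<in>Basis. LBINT x. f b x)"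
proof -
  interpret product_sigma_finite "\<lambda>_::'a. lborel :: real measure" by standard
  have [measurable]: "f b \<in> borel_measurable borel" if "b \<in> Basis" for b using f[OF that] by simp
  have T [measurable]: "(\<lambda>z. \<Sum>b\<in>Basis. z b *\<^sub>R b) \<in> (\<Pi>\<^sub>M b\<in>(Basis::'a set). lborel) \<rightarrow>\<^sub>M borel"
    by measurable
  have m: "(\<lambda>x. \<Prod>b\<in>Basis. f b (x \<bullet> b)) \<in> borel_measurable borel" by measurable
  have e: "(\<Prod>b\<in>Basis. f b ((\<Sum>c\<in>Basis. z c *\<^sub>R c) \<bullet> b)) = (\<Prod>b\<in>Basis. f b (z b))" for z
    by (intro prod.cong refl) simp
  show "integrable lborel (\<lambda>x. \<Prod>b\<in>Basis. f b (x \<bullet> b))"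
    unfolding lborel_eq[where 'a='a] using product_integrable_prod[of Basis f] f m
    by (subst integrable_distr_eq[OF T]) (auto simp: e)
  show "(LBINT x. (\<Prod>b\<in>Basis. f b (x \<bullet> b))) = (\<Prod>b\<in>Basis. LBINT x. f b x)"
    unfolding lborel_eq[where 'a='a] using product_integral_prod[of Basis f] f m
    by (subst integral_distr[OF T]) (auto simp: e)
qed

text \<open>Read off from the characteristic function of the standard normal distribution.\<close>

lemma gaussian_transform_1:
  "integrable lborel (\<lambda>x. exp (- x\<^sup>2 / 2) *\<^sub>R cis (t * x))"
  "(LBINT x. exp (- x\<^sup>2 / 2) *\<^sub>R cis (t * x)) = complex_of_real (sqrt (2 * pi) * exp (- t\<^sup>2 / 2))"
proof -
  have d: "exp (- x\<^sup>2 / 2) = sqrt (2 * pi) * std_normal_density x" for x :: real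
    by (simp add: std_normal_density_def)
  have i: "integrable lborel std_normal_density" by (rule integrable_normal_density) simp
  have [measurable]: "(\<lambda>x. cis (t * x)) \<in> borel_measurable borel"
    by (intro borel_measurable_continuous_onI continuous_intros)
  have i2: "integrable lborel (\<lambda>x. std_normal_density x *\<^sub>R cis (t * x))"
    by (rule Bochner_Integration.integrable_bound[OF i]) auto
  show "integrable lborel (\<lambda>x. exp (- x\<^sup>2 / 2) *\<^sub>R cis (t * x))"
    unfolding d scaleR_scaleR[symmetric] using i2 by (intro integrable_scaleR_right)
  have "(LBINT x. std_normal_density x *\<^sub>R cis (t * x)) = char std_normal_distribution t"
    unfolding char_def by (subst integral_density) (auto simp: normal_density_nonneg cis_conv_exp)
  also have "\<dots> = complex_of_real (exp (- t\<^sup>2 / 2))" by (simp add: char_std_normal_distribution)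
  finally show "(LBINT x. exp (- x\<^sup>2 / 2) *\<^sub>R cis (t * x)) = complex_of_real (sqrt (2 * pi) * exp (- t\<^sup>2 / 2))"
    unfolding d scaleR_scaleR[symmetric] integral_scaleR_right
    by (simp add: scaleR_conv_of_real)
qed

definition gaussian :: "'a::euclidean_space \<Rightarrow> real" where
  "gaussian x = exp (- (norm x)\<^sup>2 / 2)"

lemma gaussian_transform:
  fixes \<xi> :: "'a::euclidean_space"
  shows "integrable lborel (gaussian :: 'a \<Rightarrow> real)"
    "(LBINT x. gaussian x * cos (x \<bullet> \<xi>)) = sqrt (2 * pi) ^ DIM('a) * gaussian \<xi>"
proof -
  have g: "gaussian x = (\<Prod>b\<in>Basis. exp (- (x \<bullet> b)\<^sup>2 / 2))" for x :: 'a
  proof -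
    have "(norm x)\<^sup>2 = x \<bullet> x" by (rule power2_norm_eq_inner)
    also have "\<dots> = (\<Sum>b\<in>Basis. (x \<bullet> b)\<^sup>2)"
      by (subst euclidean_inner) (simp add: power2_eq_square)
    finally have "(norm x)\<^sup>2 = (\<Sum>b\<in>Basis. (x \<bullet> b)\<^sup>2)" .
    then show ?thesis by (simp add: gaussian_def exp_sum[symmetric] sum_divide_distrib sum_negf)
  qed
  have c: "cis (x \<bullet> \<xi>) = (\<Prod>b\<in>Basis. cis ((\<xi> \<bullet> b) * (x \<bullet> b)))" for x \<xi> :: 'a
  proof -
    have "x \<bullet> \<xi> = (\<Sum>b\<in>Basis. (\<xi> \<bullet> b) * (x \<bullet> b))"
      by (subst euclidean_inner) (simp add: mult.commute)
    then show ?thesis by (simp add: cis_conv_exp exp_sum[symmetric] sum_distrib_left)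
  qed
  have gc: "gaussian x *\<^sub>R cis (x \<bullet> \<xi>) = (\<Prod>b\<in>Basis. exp (- (x \<bullet> b)\<^sup>2 / 2) *\<^sub>R cis ((\<xi> \<bullet> b) * (x \<bullet> b)))" for x \<xi> :: 'a
    unfolding g c by (simp add: scaleR_conv_of_real prod.distrib)
  have i: "integrable lborel (\<lambda>x::'a. gaussian x *\<^sub>R cis (x \<bullet> \<xi>))" for \<xi>
    unfolding gc by (rule integral_lborel_prod) (rule gaussian_transform_1)
  from integrable_Re[OF i[of 0]] show "integrable lborel (gaussian :: 'a \<Rightarrow> real)" by simp
  have "(\<integral>x. gaussian x *\<^sub>R cis (x \<bullet> \<xi>) \<partial>(lborel :: 'a measure)) = (\<Prod>b\<in>Basis. complex_of_real (sqrt (2 * pi) * exp (- (\<xi> \<bullet> b)\<^sup>2 / 2)))"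
    unfolding gc integral_lborel_prod(2)[OF gaussian_transform_1(1)] gaussian_transform_1(2) ..
  also have "\<dots> = complex_of_real (sqrt (2 * pi) ^ DIM('a) * gaussian \<xi>)"
    by (simp add: g prod.distrib)
  finally have "(\<integral>x. gaussian x *\<^sub>R cis (x \<bullet> \<xi>) \<partial>(lborel :: 'a measure)) = complex_of_real (sqrt (2 * pi) ^ DIM('a) * gaussian \<xi>)" .
  then have "Re (\<integral>x. gaussian x *\<^sub>R cis (x \<bullet> \<xi>) \<partial>(lborel :: 'a measure)) = sqrt (2 * pi) ^ DIM('a) * gaussian \<xi>" by simp
  then show "(LBINT x. gaussian x * cos (x \<bullet> \<xi>)) = sqrt (2 * pi) ^ DIM('a) * gaussian \<xi>"
    using integral_Re[OF i[of \<xi>]] by simp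
qed

subsection \<open>Littlewood--Paley projections\<close>

lemma gaussian_measurable [measurable]: "gaussian \<in> borel_measurable borel"
  unfolding gaussian_def by measurable

text \<open>Without damping, the double integral over position and frequency does not converge
  absolutely. The Gaussian factor makes Fubini applicable and is its own transform up to scaling;
  substitution then moves \<open>e\<close> into the argument of \<open>g\<close>.\<close>

lemma cos_transform_gaussian_mean:
  fixes g :: "'a::euclidean_space \<Rightarrow> real"
  assumes g: "test_fun UNIV g" and e: "e > 0"
  shows "(LBINT x. cos_transform g x * gaussian (e *\<^sub>R x)) = sqrt (2 * pi) ^ DIM('a) * (LBINT \<eta>. g (e *\<^sub>R \<eta>) * gaussian \<eta>)"
proof -
  let ?s = "sqrt (2 * pi) ^ DIM('a)"
  have [measurable]: "g \<in> borel_measurable borel" by (rule test_fun_measurable[OF g])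
  have ge: "integrable lborel (\<lambda>x::'a. gaussian (e *\<^sub>R x))"
    using integrable_affine[OF gaussian_transform(1), of e 0] e by simp
  have inner: "(LBINT x. cos (x \<bullet> \<xi>) * gaussian (e *\<^sub>R x)) = (1/e) ^ DIM('a) * (?s * gaussian ((1/e) *\<^sub>R \<xi>))" for \<xi> :: 'a
  proof -
    have "(LBINT x. cos (x \<bullet> \<xi>) * gaussian (e *\<^sub>R x)) =
        (1/e) ^ DIM('a) * (LBINT x. gaussian x * cos (x \<bullet> ((1/e) *\<^sub>R \<xi>)))"
      using integral_affine[of "\<lambda>x. cos (x \<bullet> \<xi>) * gaussian (e *\<^sub>R x)" "1/e" 0] e by (simp add: mult.commute)
    then show ?thesis by (simp only: gaussian_transform(2))
  qed
  have J: "integrable (lborel \<Otimes>\<^sub>M lborel) (\<lambda>(x, \<xi>). g \<xi> * cos (x \<bullet> \<xi>) * gaussian (e *\<^sub>R x))"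
  proof (rule integrable_pair_bound[OF _ ge test_fun_integrable[OF g]])
    show "\<bar>case (x, \<xi>) of (x, \<xi>) \<Rightarrow> g \<xi> * cos (x \<bullet> \<xi>) * gaussian (e *\<^sub>R x)\<bar> \<le> \<bar>gaussian (e *\<^sub>R x)\<bar> * \<bar>g \<xi>\<bar>" for x \<xi>
      using mult_right_mono[OF mult_left_le[OF abs_cos_le_one abs_ge_zero], of "\<bar>gaussian (e *\<^sub>R x)\<bar>" "g \<xi>" "x \<bullet> \<xi>"]
      by (simp add: abs_mult mult_ac)
  qed measurable
  have "(LBINT x. cos_transform g x * gaussian (e *\<^sub>R x)) = (LBINT x. (LBINT \<xi>. g \<xi> * cos (x \<bullet> \<xi>) * gaussian (e *\<^sub>R x)))"
    by (simp add: cos_transform_def)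
  also have "\<dots> = (LBINT \<xi>. (LBINT x. g \<xi> * cos (x \<bullet> \<xi>) * gaussian (e *\<^sub>R x)))"
    using lborel_pair.Fubini_integral[OF J] by simp
  also have "\<dots> = (LBINT \<xi>. g \<xi> * ((1/e) ^ DIM('a) * (?s * gaussian ((1/e) *\<^sub>R \<xi>))))"
    by (simp add: mult.assoc inner)
  also have "\<dots> = ?s * ((1/e) ^ DIM('a) * (LBINT \<xi>. g \<xi> * gaussian ((1/e) *\<^sub>R \<xi>)))"
    by (simp add: mult.assoc mult.left_commute flip: integral_mult_right_zero)
  also have "(LBINT \<xi>. g \<xi> * gaussian ((1/e) *\<^sub>R \<xi>)) = e ^ DIM('a) * (LBINT \<eta>. g (e *\<^sub>R \<eta>) * gaussian \<eta>)"
    using integral_affine[of "\<lambda>\<xi>. g \<xi> * gaussian ((1/e) *\<^sub>R \<xi>)" e 0] e by simp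
  also have "(1/e) ^ DIM('a) * (e ^ DIM('a) * (LBINT \<eta>. g (e *\<^sub>R \<eta>) * gaussian \<eta>)) = (LBINT \<eta>. g (e *\<^sub>R \<eta>) * gaussian \<eta>)"
    using e by (simp add: power_divide)
  finally show ?thesis .
qed

text \<open>Fourier inversion at the origin, obtained by letting the damping tend to 0 on both sides
  of \<open>cos_transform_gaussian_mean\<close>. One factor \<open>sqrt (2 * pi)\<close> per
  dimension comes from the transform of the Gaussian and another from its integral.\<close>

lemma integral_cos_transform:
  fixes g :: "'a::euclidean_space \<Rightarrow> real"
  assumes g: "test_fun UNIV g"
  shows "(LBINT x. cos_transform g x) = (2 * pi) ^ DIM('a) * g 0"
proof -
  let ?s = "sqrt (2 * pi) ^ DIM('a)"
  have [measurable]: "g \<in> borel_measurable borel" by (rule test_fun_measurable[OF g])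
  have [measurable]: "cos_transform g \<in> borel_measurable borel" by (rule cos_transform_measurable) measurable
  obtain B where B: "\<And>x. \<bar>g x\<bar> \<le> B" using test_fun_bounded[OF g] by blast
  define e where "e n = inverse (real (Suc n))" for n
  have e: "e n > 0" "e \<longlonglongrightarrow> 0" for n
    unfolding e_def by (simp, rule LIMSEQ_inverse_real_of_nat)
  have e0: "(\<lambda>n. e n *\<^sub>R x) \<longlonglongrightarrow> 0" for x :: 'a
    using tendsto_scaleR[OF e(2) tendsto_const[of x]] by simp
  have "(\<lambda>n. LBINT x. cos_transform g x * gaussian (e n *\<^sub>R x)) \<longlonglongrightarrow> (LBINT x. cos_transform g x)"
  proof (rule integral_dominated_convergence[where w="\<lambda>x. \<bar>cos_transform g x\<bar>"])
    show "integrable lborel (\<lambda>x. \<bar>cos_transform g x\<bar>)" using cos_transform_integrable(1)[OF g] by simp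
    have "(\<lambda>n. gaussian (e n *\<^sub>R x)) \<longlonglongrightarrow> gaussian (0::'a)" for x :: 'a
    proof -
      have "continuous_on UNIV (gaussian :: 'a \<Rightarrow> real)"
        unfolding gaussian_def by (intro continuous_intros) auto
      then show ?thesis using e0[of x] by (rule continuous_on_tendsto_compose) auto
    qed
    then have "(\<lambda>n. cos_transform g x * gaussian (e n *\<^sub>R x)) \<longlonglongrightarrow> cos_transform g x * gaussian (0::'a)" for x
      by (intro tendsto_mult tendsto_const)
    then show "AE x in lborel. (\<lambda>n. cos_transform g x * gaussian (e n *\<^sub>R x)) \<longlonglongrightarrow> cos_transform g x"
      by (simp add: gaussian_def)
    have "gaussian x \<ge> 0" "gaussian x \<le> 1" for x :: 'a by (simp_all add: gaussian_def)
    then show "AE x in lborel. norm (cos_transform g x * gaussian (e n *\<^sub>R x)) \<le> \<bar>cos_transform g x\<bar>" for n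
      by (simp add: abs_mult mult_left_le)
  qed measurable
  moreover have "(\<lambda>n. LBINT \<eta>. g (e n *\<^sub>R \<eta>) * gaussian \<eta>) \<longlonglongrightarrow> (\<integral>\<eta>. g 0 * gaussian \<eta> \<partial>(lborel :: 'a measure))"
  proof (rule integral_dominated_convergence[where w="\<lambda>\<eta>. B * gaussian \<eta>"])
    show "integrable lborel (\<lambda>\<eta>::'a. B * gaussian \<eta>)" by (intro integrable_mult_right gaussian_transform(1))
    have "(\<lambda>n. g (e n *\<^sub>R \<eta>)) \<longlonglongrightarrow> g 0" for \<eta>
      using smooth_continuous_on[OF test_fun_smooth[OF g], of UNIV] e0[of \<eta>]
      by (rule continuous_on_tendsto_compose) auto
    then show "AE \<eta> in lborel. (\<lambda>n. g (e n *\<^sub>R \<eta>) * gaussian \<eta>) \<longlonglongrightarrow> g 0 * gaussian \<eta>"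
      by (simp add: tendsto_mult_right)
    show "AE \<eta> in lborel. norm (g (e n *\<^sub>R \<eta>) * gaussian \<eta>) \<le> B * gaussian \<eta>" for n
      using B by (simp add: abs_mult gaussian_def mult_right_mono)
  qed measurable
  then have "(\<lambda>n. ?s * (LBINT \<eta>. g (e n *\<^sub>R \<eta>) * gaussian \<eta>)) \<longlonglongrightarrow> ?s * (\<integral>\<eta>. g 0 * gaussian \<eta> \<partial>(lborel :: 'a measure))"
    by (intro tendsto_mult_left)
  ultimately have "(LBINT x. cos_transform g x) = ?s * (\<integral>\<eta>. g 0 * gaussian \<eta> \<partial>(lborel :: 'a measure))"
    unfolding cos_transform_gaussian_mean[OF g e(1)] by (rule LIMSEQ_unique)
  moreover have "(\<integral>\<eta>. gaussian \<eta> \<partial>(lborel :: 'a measure)) = ?s"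
    using gaussian_transform(2)[of "0::'a"] by (simp add: gaussian_def)
  moreover have "?s * ?s = (sqrt (2 * pi) * sqrt (2 * pi)) ^ DIM('a)" by (rule power_mult_distrib[symmetric])
  moreover have "sqrt (2 * pi) * sqrt (2 * pi) = 2 * pi" by simp
  ultimately have "(LBINT x. cos_transform g x) = ?s * (g 0 * ?s)" "?s * ?s = (2 * pi) ^ DIM('a)"
    by (simp_all only: integral_mult_right_zero)
  then show ?thesis by (simp only: mult.left_commute mult.commute)
qed

lemma cos_transform_scale:
  fixes g :: "'a::euclidean_space \<Rightarrow> real"
  assumes "g \<in> borel_measurable borel" "r > 0"
  shows "cos_transform (\<lambda>\<xi>. g ((1/r) *\<^sub>R \<xi>)) x = r ^ DIM('a) * cos_transform g (r *\<^sub>R x)"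
  using integral_affine[of "\<lambda>\<xi>. g ((1/r) *\<^sub>R \<xi>) * cos (x \<bullet> \<xi>)" r 0] assms
  by (simp add: cos_transform_def)

text \<open>The real part of the inverse Fourier transform of \<open>chi\<close>. Accordingly
  \<open>lp_kernel chi c\<close> belongs to the symbol \<open>chi\<close> dilated by
  \<open>c\<close>, so \<open>c\<close> is a frequency and \<open>1 / c\<close> a length.\<close>

definition lp_profile :: "(real^'n \<Rightarrow> real) \<Rightarrow> real^'n \<Rightarrow> real" where
  "lp_profile chi x = cos_transform chi x / (2 * pi) ^ CARD('n)"

definition lp_kernel :: "(real^'n \<Rightarrow> real) \<Rightarrow> real \<Rightarrow> real^'n \<Rightarrow> real" where
  "lp_kernel chi c x = c ^ CARD('n) * lp_profile chi (c *\<^sub>R x)"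

lemma Re_inv_fourier:
  fixes g :: "real^'n \<Rightarrow> real"
  assumes g: "test_fun UNIV g"
  shows "Re (inv_fourier g x) = cos_transform g x / (2 * pi) ^ CARD('n)"
proof -
  have [measurable]: "g \<in> borel_measurable borel" by (rule test_fun_measurable[OF g])
  have c: "(\<lambda>\<xi>. cis (x \<bullet> \<xi>)) \<in> borel_measurable borel"
    by (intro borel_measurable_continuous_onI continuous_intros)
  have m: "(\<lambda>\<xi>. g \<xi> *\<^sub>R cis (x \<bullet> \<xi>)) \<in> borel_measurable borel"
    by (intro borel_measurable_scaleR c) measurable
  have i: "integrable lborel (\<lambda>\<xi>. g \<xi> *\<^sub>R cis (x \<bullet> \<xi>))"
    by (rule Bochner_Integration.integrable_bound[OF test_fun_integrable[OF g]]) (use m in auto)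
  have "Re (LINT \<xi>|lebesgue. g \<xi> *\<^sub>R cis (x \<bullet> \<xi>)) = cos_transform g x"
    using integral_Re[OF i] m by (simp add: integral_completion cos_transform_def)
  then show ?thesis unfolding inv_fourier_def Re_divide_of_real by simp
qed

text \<open>The symbol of a block is a difference of two dilates of \<open>chi\<close>, at
  frequencies 2^(j+1) and 2^j. This makes the blocks telescope, and it is why the block with index
  \<open>j\<close> brings in the scale 2^(j+1).\<close>

lemma Re_inv_fourier_lp_symbol:
  fixes chi :: "real^'n \<Rightarrow> real"
  assumes chi: "test_fun UNIV chi"
  shows "Re (inv_fourier (lp_symbol chi j) x) = lp_kernel chi (2 powi (j + 1)) x - lp_kernel chi (2 powi j) x"
proof -
  have [measurable]: "chi \<in> borel_measurable borel" by (rule test_fun_measurable[OF chi])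
  define g where "g c \<xi> = chi ((1 / c) *\<^sub>R \<xi>)" for c \<xi>
  have tg: "test_fun UNIV (g c)" if "c > 0" for c
    using test_fun_affine_comp[OF chi, of "1/c" 0] that by (simp add: g_def[abs_def])
  have p: "(2::real) powi (j + 1) > 0" "(2::real) powi j > 0" by auto
  have s: "lp_symbol chi j = (\<lambda>\<xi>. g (2 powi (j + 1)) \<xi> - g (2 powi j) \<xi>)"
    by (auto simp: lp_symbol_def Let_def g_def power_int_add power_int_minus field_simps)
  have "test_fun UNIV (\<lambda>\<xi>. g (2 powi (j + 1)) \<xi> - g (2 powi j) \<xi>)"
  proof -
    obtain R1 where R1: "\<And>x. norm x > R1 \<Longrightarrow> g (2 powi (j + 1)) x = 0" using test_fun_zero_outside[OF tg[OF p(1)]] by blast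
    obtain R2 where R2: "\<And>x. norm x > R2 \<Longrightarrow> g (2 powi j) x = 0" using test_fun_zero_outside[OF tg[OF p(2)]] by blast
    have "smooth (\<lambda>\<xi>. g (2 powi (j + 1)) \<xi> + (- 1) * g (2 powi j) \<xi>)"
      by (intro smooth_add smooth_mult smooth_const test_fun_smooth[OF tg[OF p(1)]] test_fun_smooth[OF tg[OF p(2)]])
    then show ?thesis using R1 R2 by (intro test_funI[of _ "max R1 R2"]) auto
  qed
  then have "Re (inv_fourier (lp_symbol chi j) x) =
      cos_transform (\<lambda>\<xi>. g (2 powi (j + 1)) \<xi> - g (2 powi j) \<xi>) x / (2 * pi) ^ CARD('n)"
    unfolding s by (rule Re_inv_fourier)
  also have "cos_transform (\<lambda>\<xi>. g (2 powi (j + 1)) \<xi> - g (2 powi j) \<xi>) x =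
      cos_transform (g (2 powi (j + 1))) x - cos_transform (g (2 powi j)) x"
    unfolding cos_transform_def left_diff_distrib
    by (intro Bochner_Integration.integral_diff test_fun_integrable test_fun_mult tg p smooth_cos)
  also have "cos_transform (g c) x = c ^ CARD('n) * cos_transform chi (c *\<^sub>R x)" if "c > 0" for c
    unfolding g_def[abs_def] using cos_transform_scale[of chi c x] that by simp
  then have "cos_transform (g (2 powi (j + 1))) x - cos_transform (g (2 powi j)) x =
      (2 powi (j + 1)) ^ CARD('n) * cos_transform chi ((2 powi (j + 1)) *\<^sub>R x) - (2 powi j) ^ CARD('n) * cos_transform chi ((2 powi j) *\<^sub>R x)"
    using p by simp
  finally show ?thesis by (simp add: lp_kernel_def lp_profile_def diff_divide_distrib)
qed

lemma lp_profile_measurable: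
  "test_fun UNIV chi \<Longrightarrow> lp_profile chi \<in> borel_measurable borel"
  unfolding lp_profile_def[abs_def]  by (rule borel_measurable_divide[OF cos_transform_measurable[OF test_fun_measurable] borel_measurable_const])

lemma lp_kernel_measurable:
  "test_fun UNIV chi \<Longrightarrow> lp_kernel chi c \<in> borel_measurable borel"
  unfolding lp_kernel_def[abs_def]
  by (intro borel_measurable_times measurable_compose[OF _ lp_profile_measurable]) auto

lemma lp_profile_integrable:
  fixes chi :: "real^'n \<Rightarrow> real"
  assumes chi: "test_fun UNIV chi"
  shows "integrable lborel (lp_profile chi)" "(LBINT x. lp_profile chi x) = chi 0"
    "integrable lborel (\<lambda>x. (norm x)\<^sup>2 * \<bar>lp_profile chi x\<bar>)"
    "integrable lborel (\<lambda>x. (lp_profile chi x)\<^sup>2)"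
  using cos_transform_integrable[OF chi] integral_cos_transform[OF chi]
  unfolding lp_profile_def[abs_def] by (simp_all add: power_divide)

text \<open>Everything follows by scaling: mass and total variation are independent of
  \<open>c\<close>, the second moment gains 1/c^2, which becomes the squared length in the
  high-frequency bound, and the square integral grows like \<open>c ^ CARD('n)\<close>.\<close>

lemma lp_kernel_integrable:
  fixes chi :: "real^'n \<Rightarrow> real"
  assumes chi: "test_fun UNIV chi" and c: "c > 0"
  shows "integrable lborel (lp_kernel chi c)" "(LBINT x. lp_kernel chi c x) = chi 0"
    "(LBINT x. \<bar>lp_kernel chi c x\<bar>) = (LBINT x. \<bar>lp_profile chi x\<bar>)"
    "integrable lborel (\<lambda>x. (norm x)\<^sup>2 * \<bar>lp_kernel chi c x\<bar>)"
    "(LBINT x. (norm x)\<^sup>2 * \<bar>lp_kernel chi c x\<bar>) = (LBINT x. (norm x)\<^sup>2 * \<bar>lp_profile chi x\<bar>) / c\<^sup>2"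
    "integrable lborel (\<lambda>x. (lp_kernel chi c x)\<^sup>2)"
    "(LBINT x. (lp_kernel chi c x)\<^sup>2) = c ^ CARD('n) * (LBINT x. (lp_profile chi x)\<^sup>2)"
proof -
  note p = lp_profile_integrable[OF chi]
  have [measurable]: "lp_profile chi \<in> borel_measurable borel" by (rule lp_profile_measurable[OF chi])
  have c0: "c \<noteq> 0" using c by simp
  have m: "(norm x)\<^sup>2 * \<bar>lp_kernel chi c x\<bar> = (c ^ CARD('n) / c\<^sup>2) * ((norm (c *\<^sub>R x))\<^sup>2 * \<bar>lp_profile chi (c *\<^sub>R x)\<bar>)" for x
    using c by (simp add: lp_kernel_def abs_mult power_mult_distrib)
  have q: "(lp_kernel chi c x)\<^sup>2 = (c ^ CARD('n) * c ^ CARD('n)) * (lp_profile chi (c *\<^sub>R x))\<^sup>2" for x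
    by (simp add: lp_kernel_def power_mult_distrib power2_eq_square)
  have a: "\<bar>lp_kernel chi c x\<bar> = c ^ CARD('n) * \<bar>lp_profile chi (c *\<^sub>R x)\<bar>" for x
    using c by (simp add: lp_kernel_def abs_mult)
  show "integrable lborel (lp_kernel chi c)"
    unfolding lp_kernel_def[abs_def] using integrable_affine[OF p(1) c0, of 0] by simp
  show "integrable lborel (\<lambda>x. (norm x)\<^sup>2 * \<bar>lp_kernel chi c x\<bar>)"
    unfolding m using integrable_affine[OF p(3) c0, of 0] by (intro integrable_mult_right) simp
  show "integrable lborel (\<lambda>x. (lp_kernel chi c x)\<^sup>2)"
    unfolding q using integrable_affine[OF p(4) c0, of 0] by (intro integrable_mult_right) simp
  show "(LBINT x. lp_kernel chi c x) = chi 0"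
    using integral_affine[of "lp_profile chi" c 0] c p(2) by (simp add: lp_kernel_def)
  show "(LBINT x. \<bar>lp_kernel chi c x\<bar>) = (LBINT x. \<bar>lp_profile chi x\<bar>)"
    unfolding a using integral_affine[of "\<lambda>x. \<bar>lp_profile chi x\<bar>" c 0] c by simp
  show "(LBINT x. (norm x)\<^sup>2 * \<bar>lp_kernel chi c x\<bar>) = (LBINT x. (norm x)\<^sup>2 * \<bar>lp_profile chi x\<bar>) / c\<^sup>2"
    unfolding m integral_mult_right_zero
    using integral_affine[of "\<lambda>x. (norm x)\<^sup>2 * \<bar>lp_profile chi x\<bar>" c 0] c by simp
  show "(LBINT x. (lp_kernel chi c x)\<^sup>2) = c ^ CARD('n) * (LBINT x. (lp_profile chi x)\<^sup>2)"
    unfolding q integral_mult_right_zero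
    using integral_affine[of "\<lambda>x. (lp_profile chi x)\<^sup>2" c 0] c by simp
qed

text \<open>Young's inequality under the integral stands in for Cauchy--Schwarz; the free parameter
  \<open>s\<close> is chosen later to balance the two terms.\<close>

lemma conv_L2_bound:
  fixes k :: "'a::euclidean_space \<Rightarrow> real" and f :: "'a \<Rightarrow> 'b::euclidean_space"
  assumes k: "integrable lborel (\<lambda>x. (k x)\<^sup>2)" and km [measurable]: "k \<in> borel_measurable borel"
    and f: "sq_integrable f" and fm [measurable]: "f \<in> borel_measurable borel"
    and s: "s > 0"
  shows "integrable lborel (\<lambda>y. k (x - y) *\<^sub>R f y)"
    "norm (conv k f x) \<le> ((LBINT y. (k y)\<^sup>2) / s + s * sq_norm f) / 2"
proof -
  have k': "integrable lborel (\<lambda>y. (k (x - y))\<^sup>2)"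
    using integrable_affine[OF k, of "-1" x] by simp
  have i: "integrable lborel (\<lambda>y. ((k (x - y))\<^sup>2 / s + s * (norm (f y))\<^sup>2) / 2)"
    using k' f by simp
  have b: "norm (k (x - y) *\<^sub>R f y) \<le> ((k (x - y))\<^sup>2 / s + s * (norm (f y))\<^sup>2) / 2" for y
  proof -
    have "0 \<le> (\<bar>k (x - y)\<bar> - s * norm (f y))\<^sup>2 / s" using s by simp
    also have "\<dots> = (k (x - y))\<^sup>2 / s + s * (norm (f y))\<^sup>2 - 2 * (\<bar>k (x - y)\<bar> * norm (f y))"
      using s by (simp add: power2_eq_square field_simps)
    finally show ?thesis by simp
  qed
  show I: "integrable lborel (\<lambda>y. k (x - y) *\<^sub>R f y)"
    by (rule integrable_pointwise_bound[OF i _ b]) measurable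
  have "norm (conv k f x) \<le> (LBINT y. norm (k (x - y) *\<^sub>R f y))"
    unfolding conv_def by (rule integral_norm_bound)
  also have "\<dots> \<le> (LBINT y. ((k (x - y))\<^sup>2 / s + s * (norm (f y))\<^sup>2) / 2)"
    by (rule integral_mono[OF integrable_norm[OF I] i b])
  also have "\<dots> = ((LBINT y. (k (x - y))\<^sup>2) / s + s * sq_norm f) / 2"
    using k' f by simp
  also have "(LBINT y. (k (x - y))\<^sup>2) = (LBINT y. (k y)\<^sup>2)"
    by (rule integral_reflect[of "\<lambda>y. (k y)\<^sup>2"]) measurable
  finally show "norm (conv k f x) \<le> ((LBINT y. (k y)\<^sup>2) / s + s * sq_norm f) / 2" .
qed

lemma lp_block_eq:
  fixes f g :: "real^'n \<Rightarrow> real^'n"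
  assumes chi: "test_fun UNIV chi" and f: "f \<in> borel_measurable lebesgue" and g: "g \<in> borel_measurable borel"
    and e: "AE x in lborel. f x = g x" and L2: "sq_integrable g"
  shows "lp_block chi j f x = conv (lp_kernel chi (2 powi (j + 1))) g x - conv (lp_kernel chi (2 powi j)) g x"
proof -
  let ?k = "\<lambda>y. lp_kernel chi (2 powi (j + 1)) (x - y) - lp_kernel chi (2 powi j) (x - y)"
  have [measurable]: "lp_kernel chi c \<in> borel_measurable borel" for c by (rule lp_kernel_measurable[OF chi])
  have km: "?k \<in> borel_measurable borel" by measurable
  have "lp_block chi j f x = (LINT y|lebesgue. ?k y *\<^sub>R f y)"
    by (simp add: lp_block_def Re_inv_fourier_lp_symbol[OF chi])
  also have "\<dots> = (LBINT y. ?k y *\<^sub>R g y)"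
  proof (rule lebesgue_integral_AE_lborel)
    show "(\<lambda>y. ?k y *\<^sub>R f y) \<in> borel_measurable lebesgue"
      by (intro borel_measurable_scaleR f) (use km in \<open>simp add: measurable_completion\<close>)
    show "(\<lambda>y. ?k y *\<^sub>R g y) \<in> borel_measurable borel" by (intro borel_measurable_scaleR g km)
    show "AE y in lborel. ?k y *\<^sub>R f y = ?k y *\<^sub>R g y" using e by eventually_elim simp
  qed
  also have "\<dots> = conv (lp_kernel chi (2 powi (j + 1))) g x - conv (lp_kernel chi (2 powi j)) g x"
    unfolding conv_def scaleR_left_diff_distrib
    by (intro Bochner_Integration.integral_diff conv_L2_bound(1)[OF _ _ L2 g zero_less_one]
        lp_kernel_integrable(6)[OF chi] lp_kernel_measurable[OF chi]) auto
  finally show ?thesis .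
qed

text \<open>With \<open>A m\<close> the convolution at scale 2^(J+1-m), the block of index J - m is
  \<open>A m - A (Suc m)\<close>. Square integrability makes \<open>A m\<close> decay geometrically
  as the frequency tends to 0, so the telescoping series converges absolutely, as the unordered sum
  in \<open>lp_low\<close> requires, and nothing remains at low frequency.\<close>

lemma lp_low_eq:
  fixes f g :: "real^'n \<Rightarrow> real^'n"
  assumes chi: "test_fun UNIV chi" and f: "f \<in> borel_measurable lebesgue" and g: "g \<in> borel_measurable borel"
    and e: "AE x in lborel. f x = g x" and L2: "sq_integrable g"
  shows "lp_low chi J f x = conv (lp_kernel chi (2 powi (J + 1))) g x"
proof -
  define a where "a j = conv (lp_kernel chi (2 powi j)) g x" for j :: int
  define A where "A m = a (J + 1 - int m)" for m :: nat
  define Q where "Q = ((LBINT y. (lp_profile chi y)\<^sup>2) + sq_norm g) / 2"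
  \<comment> \<open>Each halving of the frequency costs a factor 2^(-n/2) in the pointwise bound,
    where n is the dimension.\<close>
  define q where "q = sqrt (1/2) ^ CARD('n)"
  define P where "P = sqrt (2 powi (J + 1)) ^ CARD('n) * Q"
  have q: "0 \<le> q" "q < 1"
    unfolding q_def by (simp, intro power_Suc_less_one[of _ "CARD('n) - 1", simplified])
       (auto simp: real_sqrt_divide)
  have b: "norm (A m) \<le> P * q ^ m" for m
  proof -
    define c where "c = (2::real) powi (J + 1 - int m)"
    have c: "c > 0" by (simp add: c_def)
    \<comment> \<open>This parameter in \<open>conv_L2_bound\<close> gives both terms the size
      \<open>sqrt c ^ CARD('n)\<close>.\<close>
    have s: "sqrt c ^ CARD('n) > 0" using c by simp
    have s2: "c ^ CARD('n) / sqrt c ^ CARD('n) = sqrt c ^ CARD('n)"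
      using c by (simp add: real_div_sqrt flip: power_divide)
    have "norm (A m) \<le> (c ^ CARD('n) * (LBINT y. (lp_profile chi y)\<^sup>2) / sqrt c ^ CARD('n)
        + sqrt c ^ CARD('n) * sq_norm g) / 2"
      using conv_L2_bound(2)[OF lp_kernel_integrable(6)[OF chi c] lp_kernel_measurable[OF chi] L2 g s, of x]
      by (simp add: A_def a_def c_def[symmetric] lp_kernel_integrable(7)[OF chi c])
    also have "\<dots> = sqrt c ^ CARD('n) * Q"
    proof -
      have "c ^ CARD('n) * t / sqrt c ^ CARD('n) = sqrt c ^ CARD('n) * t" for t
        unfolding times_divide_eq_left[symmetric] s2 ..
      then show ?thesis by (simp add: Q_def add_divide_distrib distrib_left)
    qed
    also have "sqrt c ^ CARD('n) = sqrt (2 powi (J + 1)) ^ CARD('n) * q ^ m"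
    proof -
      have "c = 2 powi (J + 1) * (1/2) ^ m"
        unfolding c_def by (subst power_int_diff) (auto simp: power_one_over field_simps)
      then have "sqrt c = sqrt (2 powi (J + 1)) * sqrt (1/2) ^ m"
        by (simp add: real_sqrt_mult real_sqrt_power)
      then show ?thesis by (simp add: q_def power_mult_distrib mult.commute flip: power_mult)
    qed
    finally show ?thesis by (simp add: P_def mult_ac)
  qed
  have sq: "summable (\<lambda>m. P * q ^ m)" using q by (intro summable_mult summable_geometric) simp
  have A: "summable (\<lambda>m. norm (A m))"
    by (rule summable_comparison_test'[OF sq]) (use b in auto)
  then have A0: "A \<longlonglongrightarrow> 0" using summable_LIMSEQ_zero tendsto_norm_zero_iff by blast
  \<comment> \<open>the symbols telescope\<close>
  have s: "(\<lambda>m. A m - A (Suc m)) sums (A 0)" using telescope_sums'[OF A0] by simp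
  have "summable (\<lambda>m. norm (A m) + norm (A (Suc m)))"
    using A summable_Suc_iff[of "\<lambda>m. norm (A m)"] by (intro summable_add) auto
  then have "summable (\<lambda>m. norm (A m - A (Suc m)))"
    by (rule summable_comparison_test') (auto intro: norm_triangle_ineq4)
  from norm_summable_imp_has_sum[OF this s] have hs: "((\<lambda>m. A m - A (Suc m)) has_sum A 0) UNIV" .
  have bij: "bij_betw (\<lambda>m. J - int m) UNIV {..J}"
    by (rule bij_betw_byWitness[where f'="\<lambda>j. nat (J - j)"]) auto
  have "lp_block chi (J - int m) f x = A m - A (Suc m)" for m
    unfolding lp_block_eq[OF chi f g e L2] A_def a_def by (simp add: algebra_simps)
  then have "((\<lambda>m. lp_block chi (J - int m) f x) has_sum A 0) UNIV" using hs by simp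
  then have "((\<lambda>j. lp_block chi j f x) has_sum A 0) {..J}"
    using has_sum_reindex_bij_betw[OF bij, of "\<lambda>j. lp_block chi j f x" "A 0"] by simp
  then show ?thesis by (simp add: lp_low_def infsumI A_def a_def)
qed

lemma conv_kernel_measurable:
  fixes k :: "'a::euclidean_space \<Rightarrow> real" and f :: "'a \<Rightarrow> 'b::euclidean_space"
  assumes [measurable]: "k \<in> borel_measurable borel" "f \<in> borel_measurable borel"
  shows "conv k f \<in> borel_measurable borel"
  unfolding conv_def[abs_def] by measurable

text \<open>Because the kernel has integral \<open>chi 0 = 1\<close>, the remainder is the kernel
  integrated against increments of \<open>w\<close>. The constant is its total variation, from
  \<open>weighted_jensen\<close>, times its second moment.\<close>

lemma (in cutoff) lp_low_estimate:
  fixes w :: "real^'n \<Rightarrow> real^'n"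
  assumes w: "weak_gradient w F"
    and c: "c > 0"
    and L2: "sq_integrable w"
  shows "(\<integral>\<^sup>+x. ennreal ((norm (w x - conv (lp_kernel chi c) w x))\<^sup>2) \<partial>lborel)
    \<le> ennreal ((LBINT x. \<bar>lp_profile chi x\<bar>) * (LBINT x. (norm x)\<^sup>2 * \<bar>lp_profile chi x\<bar>) / c\<^sup>2)
      * sq_nnorm F"
proof -
  define A where "A = (LBINT x. \<bar>lp_profile chi x\<bar>)"
  define M where "M = (LBINT x. (norm x)\<^sup>2 * \<bar>lp_profile chi x\<bar>)"
  have A0: "A \<ge> 0" by (simp add: A_def)
  let ?k = "lp_kernel chi c"
  note k = lp_kernel_integrable[OF test_chi c]
  have km [measurable]: "?k \<in> borel_measurable borel" by (rule lp_kernel_measurable[OF test_chi])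
  have wm [measurable]: "w \<in> borel_measurable borel" using w by (auto simp: weak_gradient_def loc_int_def)
  have H: "ennreal ((norm (w x - conv ?k w x))\<^sup>2)
      \<le> (\<integral>\<^sup>+z. (ennreal A * ennreal \<bar>?k z\<bar>) * ennreal ((norm (w x - w (x - z)))\<^sup>2) \<partial>lborel)" for x
  proof -
    have i: "integrable lborel (\<lambda>y. ?k (x - y) *\<^sub>R w y)"
      by (rule conv_L2_bound(1)[OF k(6) km L2 wm zero_less_one])
    have i2: "integrable lborel (\<lambda>z. ?k z *\<^sub>R w (x - z))"
      using integrable_affine[OF i, of "-1" x] by simp
    have "conv ?k w x = (LBINT z. ?k z *\<^sub>R w (x - z))"
      using integral_reflect[of "\<lambda>y. ?k (x - y) *\<^sub>R w y" x] by (simp add: conv_def)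
    then have "w x - conv ?k w x = (LBINT z. ?k z *\<^sub>R (w x - w (x - z)))"
      using i2 k(1,2) chi_zero by (simp add: scaleR_right_diff_distrib)
    then have "ennreal ((norm (w x - conv ?k w x))\<^sup>2) \<le>
        ennreal A * (\<integral>\<^sup>+z. ennreal (\<bar>?k z\<bar> * (norm (w x - w (x - z)))\<^sup>2) \<partial>lborel)"
      using weighted_jensen[OF k(1), of "\<lambda>z. w x - w (x - z)"] by (simp add: k(3) A_def)
    also have "\<dots> = (\<integral>\<^sup>+z. (ennreal A * ennreal \<bar>?k z\<bar>) * ennreal ((norm (w x - w (x - z)))\<^sup>2) \<partial>lborel)"
      by (subst nn_integral_cmult[symmetric]) (auto simp: ennreal_mult mult.assoc)
    finally show ?thesis .
  qed
  have "(\<integral>\<^sup>+z. (ennreal A * ennreal \<bar>?k z\<bar>) * ennreal ((norm z)\<^sup>2) \<partial>lborel) =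
      ennreal A * (\<integral>\<^sup>+z. ennreal ((norm z)\<^sup>2 * \<bar>?k z\<bar>) \<partial>lborel)"
    by (subst nn_integral_cmult[symmetric]) (auto simp: ennreal_mult mult_ac)
  also have "\<dots> = ennreal A * ennreal (M / c\<^sup>2)"
    using k(4,5) by (subst nn_integral_eq_integral) (auto simp: M_def)
  also have "\<dots> = ennreal (A * M / c\<^sup>2)"
    by (subst ennreal_mult'[OF A0, symmetric]) simp
  finally have B: "(\<integral>\<^sup>+z. (ennreal A * ennreal \<bar>?k z\<bar>) * ennreal ((norm z)\<^sup>2) \<partial>lborel) \<le> ennreal (A * M / c\<^sup>2)"
    by simp
  show ?thesis
    using increment_average[OF w _ H B] by (simp add: A_def M_def)
qed

subsection \<open>The transport term\<close>

text \<open>The cutoff acts on the value \<open>y\<close> of the vector field, not on the position;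
  a second cutoff in position is applied separately.\<close>

definition trunc_product :: "(real^'n \<Rightarrow> real) \<Rightarrow> real \<Rightarrow> 'n \<Rightarrow> 'n \<Rightarrow> real^'n \<Rightarrow> real" where
  "trunc_product chi R i j y = y $ i * y $ j * chi ((1/R) *\<^sub>R y)"

text \<open>One constant depending on \<open>chi\<close> alone, uniform in the truncation radius
  \<open>R\<close>, keeps the final constants independent of the flow.\<close>

locale bounded_cutoff = cutoff chi for chi :: "real^'n \<Rightarrow> real" +
  fixes M :: real
  assumes M_pos: "M > 0"
    and chi_le: "\<bar>chi x\<bar> \<le> M"
    and pderiv_chi_le: "\<bar>pderiv_dir (axis j 1) chi x\<bar> \<le> M"
    and pderiv_trunc_product_le:
      "R > 0 \<Longrightarrow> c \<in> Basis \<Longrightarrow> \<bar>pderiv_dir c (trunc_product chi R i j) y\<bar> \<le> M * norm y"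

lemma (in cutoff) smooth_trunc_product: "R > 0 \<Longrightarrow> smooth (trunc_product chi R i j)"
proof -
  have "smooth (\<lambda>y. ((y \<bullet> axis i 1) * (y \<bullet> axis j 1)) * chi (0 + (1/R) *\<^sub>R y))"
    by (intro smooth_mult smooth_inner smooth_affine_comp test_fun_smooth[OF test_chi])
  then show ?thesis by (simp add: trunc_product_def[abs_def] inner_axis)
qed

text \<open>The last bound is scale invariant: the truncated product is R^2 p(y/R) for the fixed
  test function p with p(y) = y_i y_j chi(y). Its gradient is R times that of p at y/R. The gradient
  of p is Lipschitz and vanishes at the origin, where p is of second order, so \<open>R\<close>
  cancels.\<close>

lemma (in cutoff) bounded_cutoff_exists: "\<exists>M. bounded_cutoff chi M"
proof -
  note chi = test_chi
  obtain M0 where M0: "M0 > 0" "\<And>x. \<bar>chi x\<bar> \<le> M0" using test_fun_bounded[OF chi] by blast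
  define p where "p i j y = (y \<bullet> axis i 1) * (y \<bullet> axis j 1) * chi y" for i j and y :: "real^'n"
  have p: "trunc_product chi R i j = (\<lambda>y. R\<^sup>2 * p i j (0 + (1/R) *\<^sub>R y))" if "R > 0" for R i j
    using that by (auto simp: trunc_product_def p_def inner_axis power2_eq_square)
  have tp: "test_fun UNIV (p i j)" for i j
  proof -
    have "test_fun UNIV (\<lambda>y. chi y * ((y \<bullet> axis i 1) * (y \<bullet> axis j 1)))"
      by (intro test_fun_mult chi smooth_mult smooth_inner)
    then show ?thesis by (simp add: p_def[abs_def] mult_ac)
  qed
  have "\<exists>K. \<forall>y. \<bar>pderiv_dir (fst z) (p (fst (snd z)) (snd (snd z))) y\<bar> \<le> K * norm y" if z: "z \<in> Basis \<times> UNIV" for z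
  proof -
    obtain c i j where cz: "z = (c, i, j)" by (metis prod.exhaust)
    then have c: "c \<in> Basis" using z by simp
    obtain M where M: "M > 0" "\<And>x y. \<bar>pderiv_dir c (p i j) x - pderiv_dir c (p i j) y\<bar> \<le> M * norm (x - y)"
      by (rule test_fun_lipschitz[OF test_fun_pderiv_dir[OF tp[of i j] c]], rule that)
    have d: "(chi has_derivative frechet_derivative chi (at 0)) (at 0)"
      using smooth_differentiable[OF test_fun_smooth[OF chi]] frechet_derivative_works by blast
    have A: "((\<lambda>y. y \<bullet> a) has_derivative (\<lambda>h. h \<bullet> a)) (at 0)" for a :: "real^'n"
      by (intro has_derivative_inner_left has_derivative_ident)
    have "(p i j has_derivative (\<lambda>h. 0)) (at 0)"
      unfolding p_def[abs_def] using has_derivative_mult[OF has_derivative_mult[OF A A] d] by simp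
    then have "pderiv_dir c (p i j) 0 = 0" by (rule pderiv_dir_eq)
    then show ?thesis using M(1) M(2)[of _ 0] by (intro exI[of _ M]) (simp add: cz)
  qed
  then obtain M where M: "M > 0" "\<And>c i j y. c \<in> Basis \<Longrightarrow> \<bar>pderiv_dir c (p i j) y\<bar> \<le> M * norm y"
    using finite_uniform_bound[of "Basis \<times> UNIV" norm "\<lambda>z y. \<bar>pderiv_dir (fst z) (p (fst (snd z)) (snd (snd z))) y\<bar>"]
    by auto
  have "\<exists>B. \<forall>x. \<bar>pderiv_dir (axis j 1) chi x\<bar> \<le> B" for j
    using test_fun_bounded[OF test_fun_pderiv_dir[OF chi axis_Basis]] by metis
  then obtain B where B: "B > 0" "\<And>j x. \<bar>pderiv_dir (axis j 1) chi x\<bar> \<le> B"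
    using finite_uniform_bound[of UNIV "\<lambda>_. 1" "\<lambda>j x. \<bar>pderiv_dir (axis j 1) chi x\<bar>"] by auto
  define K where "K = M0 + B + M"
  have K: "K > 0" "M0 \<le> K" "B \<le> K" "M \<le> K" using M0(1) B(1) M(1) by (auto simp: K_def)
  have "bounded_cutoff chi K"
  proof
    show "K > 0" by (rule K)
    show "\<bar>chi x\<bar> \<le> K" for x using M0(2)[of x] K by linarith
    show "\<bar>pderiv_dir (axis j 1) chi x\<bar> \<le> K" for j x using B(2)[of j x] K by linarith
    show "\<bar>pderiv_dir c (trunc_product chi R i j) y\<bar> \<le> K * norm y" if R: "R > 0" and c: "c \<in> Basis" for R i j c y
    proof -
      have "pderiv_dir c (trunc_product chi R i j) y = R\<^sup>2 * ((1/R) * pderiv_dir c (p i j) (0 + (1/R) *\<^sub>R y))"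
        unfolding p[OF R]
        by (simp only: pderiv_dir_cmult[OF smooth_differentiable[OF smooth_affine_comp[OF test_fun_smooth[OF tp]]]] pderiv_dir_affine[OF test_fun_smooth[OF tp]])
      also have "\<dots> = R * pderiv_dir c (p i j) ((1/R) *\<^sub>R y)" using R by (simp add: power2_eq_square)
      finally have "\<bar>pderiv_dir c (trunc_product chi R i j) y\<bar> = R * \<bar>pderiv_dir c (p i j) ((1/R) *\<^sub>R y)\<bar>"
        using R by (simp add: abs_mult)
      also have "\<dots> \<le> R * (M * norm ((1/R) *\<^sub>R y))"
      proof (rule mult_left_mono)
        show "\<bar>pderiv_dir c (p i j) ((1/R) *\<^sub>R y)\<bar> \<le> M * norm ((1/R) *\<^sub>R y)" by (rule M(2)[OF c])
      qed (use R in simp)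
      also have "\<dots> = M * norm y" using R by simp
      also have "\<dots> \<le> K * norm y" by (rule mult_right_mono[OF K(4)]) simp
      finally show ?thesis .
    qed
  qed
  then show ?thesis by blast
qed

lemma mollifier_L2:
  assumes f: "loc_int f" and r: "mollifier d r" and i: "sq_integrable f"
  shows "sq_integrable (conv r f)"
    "(LBINT x. (norm (conv r f x))\<^sup>2) \<le> sq_norm f"
proof -
  have [measurable]: "conv r f \<in> borel_measurable borel"
    using r by (intro conv_measurable[OF f]) (simp add: mollifier_def)
  have e: "sq_nnorm f = ennreal (sq_norm f)"
    using i by (intro nn_integral_eq_integral) auto
  have le: "sq_nnorm (conv r f) \<le> ennreal (sq_norm f)"
    using mollifier_young[OF f r] e by simp
  then have "sq_nnorm (conv r f) < \<infinity>"
    by (rule le_less_trans) simp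
  then show I: "sq_integrable (conv r f)"
    by (intro integrableI_nonneg) auto
  have "ennreal (LBINT x. (norm (conv r f x))\<^sup>2) \<le> ennreal (sq_norm f)"
    using le nn_integral_eq_integral[OF I] by simp
  then show "(LBINT x. (norm (conv r f x))\<^sup>2) \<le> sq_norm f"
    by (subst (asm) ennreal_le_iff) auto
qed

lemma (in bounded_cutoff) trunc_product_le: "\<bar>trunc_product chi R i j y\<bar> \<le> M * (norm y)\<^sup>2"
proof -
  have "\<bar>trunc_product chi R i j y\<bar> = \<bar>chi ((1/R) *\<^sub>R y)\<bar> * (\<bar>y $ i\<bar> * \<bar>y $ j\<bar>)"
    by (simp add: trunc_product_def abs_mult mult_ac)
  also have "\<dots> \<le> M * (norm y * norm y)"
    using M_pos by (intro mult_mono component_le_norm_cart chi_le) auto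
  finally show ?thesis by (simp add: power2_eq_square)
qed

lemma (in bounded_cutoff) trunc_product_bounded:
  assumes R: "R > 0"
  shows "\<bar>trunc_product chi R i j y\<bar> \<le> M * R\<^sup>2"
proof (cases "norm y \<le> R")
  case True
  then have "M * (norm y)\<^sup>2 \<le> M * R\<^sup>2" using M_pos by (intro mult_left_mono power_mono) auto
  with trunc_product_le[of R i j y] show ?thesis by linarith
next
  case False
  then have "norm ((1/R) *\<^sub>R y) \<ge> 1" using R by simp
  then have "trunc_product chi R i j y = 0" unfolding trunc_product_def by (simp add: chi_outside del: norm_scaleR)
  then show ?thesis using M_pos by simp
qed

text \<open>The data of one fixed time in Borel form. As in \<open>energy_ineq_at\<close>,
  integrability is asked of the whole quadratic form, not of its summands.\<close>

definition flow :: "(real^'n \<Rightarrow> real^'n) \<Rightarrow> (real^'n \<Rightarrow> real^'n^'n) \<Rightarrow> (real^'n \<Rightarrow> real^'n) \<Rightarrow> (real^'n \<Rightarrow> real^'n^'n) \<Rightarrow> bool" where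
  "flow w F u U \<longleftrightarrow> weak_gradient w F \<and> weak_gradient u U \<and> sq_integrable w \<and> sq_integrable F \<and>
     integrable lborel (\<lambda>x. (U x *v w x) \<bullet> w x)"

lemma flowD:
  assumes "flow w F u U"
  shows "weak_gradient w F" "weak_gradient u U" "sq_integrable w" "sq_integrable F"
    "integrable lborel (\<lambda>x. (U x *v w x) \<bullet> w x)" "loc_int w" "loc_int F" "loc_int u" "loc_int U"
  using assms by (auto simp: flow_def weak_gradient_def)

text \<open>The two dimension factors count the index pairs. The outer \<open>M\<close> bounds a
  cutoff or the truncated product, the inner \<open>real CARD('n) * M\<close> comes from the chain
  rule, and the last \<open>M\<close> from differentiating the position cutoff.\<close>

definition (in bounded_cutoff) transport_const :: real where
  "transport_const = real CARD('n) * real CARD('n) * (M * (real CARD('n) * M + M))"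

lemma (in bounded_cutoff) transport_const_pos: "transport_const > 0"
  using M_pos by (simp add: transport_const_def add_nonneg_pos)

text \<open>The weak gradient \<open>U\<close> is only tested against smooth functions, hence the mollification of \<open>w\<close>.
  Only the full sum \<open>(U w) \<bullet> w\<close> is integrable, not its summands, hence the truncation: it
  makes the products bounded while keeping their gradient below \<open>norm w * norm (\<nabla>w)\<close> uniformly in \<open>R\<close>.
  No divergence condition enters, because \<open>\<nabla>(w\<^sub>i w\<^sub>j)\<close> is estimated as a whole.\<close>

lemma (in bounded_cutoff) transport_bound_mollified:
  assumes fl: "flow w F u U" and um: "AE x in lborel. norm (u x) \<le> m" and m: "m \<ge> 0"
    and r: "mollifier d r" and R: "R > 0" and t: "t > 0"
  shows "\<bar>\<Sum>i\<in>UNIV. \<Sum>j\<in>UNIV. LBINT x. U x $ i $ j * (trunc_product chi R i j (conv r w x) * chi ((1/R) *\<^sub>R x))\<bar>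
    \<le> m * transport_const * (t * sq_norm w + sq_norm F / t + sq_norm w / R)"
proof -
  let ?n = "real CARD('n)"
  note w = flowD[OF fl]
  have rt: "test_fun UNIV r" using r by (simp add: mollifier_def)
  define a0 where "a0 = M * (?n * M + M)"
  have a0: "a0 > 0" unfolding a0_def using M_pos by (intro mult_pos_pos add_nonneg_pos) auto
  define v where "v = conv r w"
  define G where "G = conv r F"
  define cut where "cut x = chi (0 + (1/R) *\<^sub>R x)" for x
  have cut: "test_fun UNIV cut" unfolding cut_def[abs_def] using R by (intro test_fun_affine_comp test_chi) auto
  have dcut: "pderiv_dir b cut x = (1/R) * pderiv_dir b chi ((1/R) *\<^sub>R x)" for b x
    unfolding cut_def[abs_def] pderiv_dir_affine[OF test_fun_smooth[OF test_chi]] by simp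
  have vs: "smooth (\<lambda>x. v x \<bullet> c)" for c
  proof -
    have "(\<lambda>x. v x \<bullet> c) = conv r (\<lambda>y. w y \<bullet> c)" unfolding v_def using conv_inner[OF w(6) rt] by auto
    then show ?thesis using smooth_conv[OF loc_int_inner[OF w(6)] rt] by simp
  qed
  have dv: "\<bar>pderiv_dir (axis j 1) (\<lambda>x. v x \<bullet> c) x\<bar> \<le> norm (G x)" if c: "c \<in> Basis" for j c x
  proof -
    obtain k where k: "c = axis k 1" using c by (auto simp: Basis_real_vec)
    have "pderiv_dir (axis j 1) (\<lambda>x. v x \<bullet> c) x = G x $ k $ j"
      using pderiv_dir_conv_weak_gradient[OF w(1) rt, of j k x] by (simp add: v_def G_def k inner_axis)
    moreover have "\<bar>G x $ k $ j\<bar> \<le> norm (G x)"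
      using component_le_norm_cart[of "G x $ k" j] Finite_Cartesian_Product.norm_nth_le[of "G x" k] by linarith
    ultimately show ?thesis by simp
  qed
  \<comment> \<open>The position cutoff gives compact support and the mollification gives
    smoothness, so \<Phi> may be tested against the weak gradient of \<open>u\<close>.\<close>
  define \<Phi> where "\<Phi> i j x = cut x * trunc_product chi R i j (v x)" for i j x
  note sT = smooth_trunc_product[OF R]
  have sP: "smooth (\<lambda>x. trunc_product chi R i j (v x))" for i j
    by (rule smooth_comp[OF sT vs])
  have \<Phi>: "test_fun UNIV (\<Phi> i j)" for i j
    unfolding \<Phi>_def[abs_def] by (rule test_fun_mult[OF cut sP])
  have b: "\<bar>pderiv_dir (axis j 1) (\<Phi> i j) x\<bar> \<le> a0 * (t * (norm (v x))\<^sup>2 + (norm (G x))\<^sup>2 / t + (norm (v x))\<^sup>2 / R)" for i j x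
  proof -
    have 1: "\<bar>pderiv_dir (axis j 1) (\<lambda>x. trunc_product chi R i j (v x)) x\<bar> \<le> ?n * (norm (G x) * (M * norm (v x)))"
    proof -
      have "\<bar>pderiv_dir (axis j 1) (\<lambda>x. trunc_product chi R i j (v x)) x\<bar> \<le>
          (\<Sum>c\<in>(Basis :: (real^'n) set). norm (G x) * (M * norm (v x)))"
        unfolding pderiv_dir_comp[OF sT vs axis_Basis]
        by (intro order_trans[OF sum_abs] sum_mono) (auto simp: abs_mult intro!: mult_mono dv pderiv_trunc_product_le R)
      then show ?thesis by simp
    qed
    have "pderiv_dir (axis j 1) (\<Phi> i j) x = cut x * pderiv_dir (axis j 1) (\<lambda>x. trunc_product chi R i j (v x)) x
        + pderiv_dir (axis j 1) cut x * trunc_product chi R i j (v x)"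
      unfolding \<Phi>_def[abs_def]
      by (rule pderiv_dir_mult[OF smooth_differentiable[OF test_fun_smooth[OF cut]] smooth_differentiable[OF sP]])
    also have "\<bar>\<dots>\<bar> \<le> M * (?n * (norm (G x) * (M * norm (v x)))) + (1/R * M) * (M * (norm (v x))\<^sup>2)"
    proof (rule order_trans[OF abs_triangle_ineq], unfold abs_mult, intro add_mono mult_mono 1 trunc_product_le)
      show "\<bar>pderiv_dir (axis j 1) cut x\<bar> \<le> 1/R * M"
        unfolding dcut abs_mult using R by (intro mult_mono pderiv_chi_le) auto
    qed (use M_pos R chi_le in \<open>auto simp: cut_def\<close>)
    also have "\<dots> = M * (?n * M) * (norm (v x) * norm (G x)) + M * M * ((norm (v x))\<^sup>2 / R)" by simp
    also have "\<dots> \<le> a0 * (norm (v x) * norm (G x)) + a0 * ((norm (v x))\<^sup>2 / R)"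
      unfolding a0_def using M_pos R by (intro add_mono mult_right_mono mult_left_mono) auto
    also have "\<dots> \<le> a0 * (t * (norm (v x))\<^sup>2 + (norm (G x))\<^sup>2 / t) + a0 * ((norm (v x))\<^sup>2 / R)"
    proof (intro add_right_mono mult_left_mono)
      \<comment> \<open>Young's inequality with the weight \<open>t\<close> left free, so that the
        gradient term can later be absorbed by the dissipation.\<close>
      have "0 \<le> (t * norm (v x) - norm (G x))\<^sup>2 / t" using t by simp
      also have "\<dots> = t * (norm (v x))\<^sup>2 + (norm (G x))\<^sup>2 / t - 2 * (norm (v x) * norm (G x))"
        using t by (simp add: power2_eq_square field_simps)
      finally show "norm (v x) * norm (G x) \<le> t * (norm (v x))\<^sup>2 + (norm (G x))\<^sup>2 / t"
        using mult_nonneg_nonneg[OF norm_ge_zero[of "v x"] norm_ge_zero[of "G x"]] by linarith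
    qed (use a0 in simp)
    finally show ?thesis by (simp add: distrib_left)
  qed
  note v2 = mollifier_L2[OF w(6) r w(3), folded v_def]
  note G2 = mollifier_L2[OF w(7) r w(4), folded G_def]
  have bi: "integrable lborel (\<lambda>x. t * (norm (v x))\<^sup>2 + (norm (G x))\<^sup>2 / t + (norm (v x))\<^sup>2 / R)"
    using v2(1) G2(1) by simp
  have bI: "(LBINT x. t * (norm (v x))\<^sup>2 + (norm (G x))\<^sup>2 / t + (norm (v x))\<^sup>2 / R) \<le> t * sq_norm w + sq_norm F / t + sq_norm w / R"
    using v2 G2 t R by (simp add: add_mono divide_right_mono mult_left_mono)
  have ij: "\<bar>LBINT x. U x $ i $ j * \<Phi> i j x\<bar> \<le> m * (a0 * (t * sq_norm w + sq_norm F / t + sq_norm w / R))" for i j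
  proof -
    have i: "integrable lborel (\<lambda>x. u x $ i * pderiv_dir (axis j 1) (\<Phi> i j) x)"
      using loc_int_test_fun[OF loc_int_nth[OF w(8)] test_fun_pderiv_dir[OF \<Phi> axis_Basis]] by (simp add: mult.commute)
    have "(LBINT x. U x $ i $ j * \<Phi> i j x) = - (LBINT x. u x $ i * pderiv_dir (axis j 1) (\<Phi> i j) x)"
      using w(2) \<Phi> by (simp add: weak_gradient_def)
    then have "\<bar>LBINT x. U x $ i $ j * \<Phi> i j x\<bar> \<le> (LBINT x. \<bar>u x $ i * pderiv_dir (axis j 1) (\<Phi> i j) x\<bar>)"
      by (simp add: integral_abs_bound)
    also have "\<dots> \<le> (LBINT x. m * (a0 * (t * (norm (v x))\<^sup>2 + (norm (G x))\<^sup>2 / t + (norm (v x))\<^sup>2 / R)))"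
    proof (rule integral_mono_AE[OF integrable_abs[OF i] integrable_mult_right[OF integrable_mult_right[OF bi]]])
      show "AE x in lborel. \<bar>u x $ i * pderiv_dir (axis j 1) (\<Phi> i j) x\<bar> \<le> m * (a0 * (t * (norm (v x))\<^sup>2 + (norm (G x))\<^sup>2 / t + (norm (v x))\<^sup>2 / R))"
        using um
      proof eventually_elim
        case (elim x)
        then have "\<bar>u x $ i\<bar> \<le> m" using component_le_norm_cart[of "u x" i] by linarith
        then show ?case unfolding abs_mult using b[of j i x] m by (intro mult_mono) auto
      qed
    qed
    also have "\<dots> = m * (a0 * (LBINT x. t * (norm (v x))\<^sup>2 + (norm (G x))\<^sup>2 / t + (norm (v x))\<^sup>2 / R))"
      by (simp only: integral_mult_right_zero)
    also have "\<dots> \<le> m * (a0 * (t * sq_norm w + sq_norm F / t + sq_norm w / R))"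
      using m a0 bI by (intro mult_left_mono) auto
    finally show ?thesis .
  qed
  have "\<bar>\<Sum>i\<in>UNIV. \<Sum>j\<in>UNIV. LBINT x. U x $ i $ j * \<Phi> i j x\<bar> \<le>
      (\<Sum>i\<in>(UNIV::'n set). \<Sum>j\<in>(UNIV::'n set). m * (a0 * (t * sq_norm w + sq_norm F / t + sq_norm w / R)))"
    by (intro order_trans[OF sum_abs] sum_mono ij)
  also have "\<dots> = m * transport_const * (t * sq_norm w + sq_norm F / t + sq_norm w / R)"
    by (simp add: transport_const_def a0_def)
  finally show ?thesis by (simp add: \<Phi>_def cut_def v_def mult.commute)
qed

lemma quadratic_form_sum:
  fixes A :: "real^'n^'n"
  shows "(\<Sum>i\<in>UNIV. \<Sum>j\<in>UNIV. A $ i $ j * (y $ i * y $ j)) = (A *v y) \<bullet> y"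
  by (simp add: inner_vec_def matrix_vector_mult_def sum_distrib_right sum_distrib_left mult_ac)

text \<open>Removal of the mollification at fixed \<open>R\<close>. The truncated products are
  bounded by \<open>M * R\<^sup>2\<close> and the position cutoff has compact support, so local
  integrability of \<open>U\<close> provides the dominating function; afterwards the finite sum over
  indices may enter the integral.\<close>

lemma (in bounded_cutoff) transport_bound_truncated:
  assumes fl: "flow w F u U" and um: "AE x in lborel. norm (u x) \<le> m" and m: "m \<ge> 0"
    and R: "R > 0" and t: "t > 0"
  shows "\<bar>LBINT x. ((U x *v w x) \<bullet> w x) * (chi ((1/R) *\<^sub>R w x) * chi ((1/R) *\<^sub>R x))\<bar>
    \<le> m * transport_const * (t * sq_norm w + sq_norm F / t + sq_norm w / R)" (is "_ \<le> ?C")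
proof -
  note w = flowD[OF fl]
  have [measurable]: "w \<in> borel_measurable borel" "U \<in> borel_measurable borel" "chi \<in> borel_measurable borel"
    using w(6,9) test_fun_measurable[OF test_chi] by (auto dest: loc_int_measurable)
  obtain r where r: "\<And>n::nat. mollifier 1 (r n)" "AE x in lborel. (\<lambda>n. conv (r n) w x) \<longlonglongrightarrow> w x"
    using mollifier_AE[OF w(6)] by blast
  define q where "q i j y x = U x $ i $ j * (trunc_product chi R i j y * chi ((1/R) *\<^sub>R x))" for i j y x
  define B where "B i j x = M * R\<^sup>2 * \<bar>U x $ i $ j * chi ((1/R) *\<^sub>R x)\<bar>" for i j x
  have cut: "test_fun UNIV (\<lambda>x. chi ((1/R) *\<^sub>R x))"
    using test_fun_affine_comp[OF test_chi, of "1/R" 0] R by simp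
  have [measurable]: "trunc_product chi R i j \<in> borel_measurable borel" for i j
    unfolding trunc_product_def[abs_def] by measurable
  have Pc: "continuous_on UNIV (trunc_product chi R i j)" for i j
    by (rule smooth_continuous_on[OF smooth_trunc_product[OF R]])
  have [measurable]: "conv (r n) w \<in> borel_measurable borel" for n
    using r(1)[of n] by (intro conv_measurable[OF w(6)]) (simp add: mollifier_def)
  have qm: "(\<lambda>x. q i j (w x) x) \<in> borel_measurable lborel" "(\<lambda>x. q i j (conv (r n) w x) x) \<in> borel_measurable lborel" for i j n
    unfolding q_def by measurable
  have Bi: "integrable lborel (B i j)" for i j
    unfolding B_def using loc_int_test_fun[OF loc_int_nth_nth[OF w(9)] cut, of i j]
    by (intro integrable_mult_right integrable_abs) (simp add: mult.commute)
  have bd: "\<bar>q i j y x\<bar> \<le> B i j x" for i j x y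
  proof -
    have "\<bar>trunc_product chi R i j y\<bar> * \<bar>U x $ i $ j * chi ((1/R) *\<^sub>R x)\<bar> \<le> B i j x"
      unfolding B_def by (rule mult_right_mono[OF trunc_product_bounded[OF R]]) simp
    then show ?thesis by (simp add: q_def abs_mult mult_ac)
  qed
  have lim: "(\<lambda>n. LBINT x. q i j (conv (r n) w x) x) \<longlonglongrightarrow> (LBINT x. q i j (w x) x)" for i j
  proof (rule integral_dominated_convergence[OF _ _ Bi[of i j]])
    show "AE x in lborel. (\<lambda>n. q i j (conv (r n) w x) x) \<longlonglongrightarrow> q i j (w x) x"
      using r(2)
    proof eventually_elim
      case (elim x)
      have "(\<lambda>n. trunc_product chi R i j (conv (r n) w x)) \<longlonglongrightarrow> trunc_product chi R i j (w x)"
        using Pc elim by (rule continuous_on_tendsto_compose) auto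
      then show ?case unfolding q_def by (intro tendsto_intros)
    qed
  qed (use bd in \<open>auto simp del: measurable_lborel2 intro: qm\<close>)
  have "(\<lambda>n. \<bar>\<Sum>i\<in>UNIV. \<Sum>j\<in>UNIV. LBINT x. q i j (conv (r n) w x) x\<bar>) \<longlonglongrightarrow> \<bar>\<Sum>i\<in>UNIV. \<Sum>j\<in>UNIV. LBINT x. q i j (w x) x\<bar>"
    by (intro tendsto_rabs tendsto_sum lim)
  moreover have "\<bar>\<Sum>i\<in>UNIV. \<Sum>j\<in>UNIV. LBINT x. q i j (conv (r n) w x) x\<bar> \<le> ?C" for n
    unfolding q_def by (rule transport_bound_mollified[OF fl um m r(1) R t])
  ultimately have le: "\<bar>\<Sum>i\<in>UNIV. \<Sum>j\<in>UNIV. LBINT x. q i j (w x) x\<bar> \<le> ?C"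
    by (intro LIMSEQ_le_const2) auto
  have I: "integrable lborel (\<lambda>x. q i j (w x) x)" for i j
    by (rule integrable_pointwise_bound[OF Bi[of i j] qm(1)]) (simp add: bd)
  have "(\<Sum>i\<in>UNIV. \<Sum>j\<in>UNIV. LBINT x. q i j (w x) x) = (LBINT x. (\<Sum>i\<in>UNIV. \<Sum>j\<in>UNIV. q i j (w x) x))"
    using I by (simp add: Bochner_Integration.integral_sum)
  also have "\<dots> = (LBINT x. ((U x *v w x) \<bullet> w x) * (chi ((1/R) *\<^sub>R w x) * chi ((1/R) *\<^sub>R x)))"
    unfolding quadratic_form_sum[symmetric]
    by (simp add: q_def trunc_product_def sum_distrib_right sum_distrib_left mult_ac)
  finally show ?thesis using le by simp
qed

text \<open>Removal of the truncation. Here the whole quadratic form is dominated, by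
  \<open>M * M\<close> times its absolute value, and the error \<open>sq_norm w / R\<close> from the
  position cutoff tends to 0.\<close>

lemma (in bounded_cutoff) transport_bound:
  fixes w :: "real^'n \<Rightarrow> real^'n"
  assumes fl: "flow w F u U" and um: "AE x in lborel. norm (u x) \<le> m" and m: "m \<ge> 0" and t: "t > 0"
  shows "\<bar>LBINT x. (U x *v w x) \<bullet> w x\<bar> \<le> m * transport_const * (t * sq_norm w + sq_norm F / t)"
proof -
  note w = flowD[OF fl]
  have chic: "continuous_on UNIV chi" by (rule smooth_continuous_on[OF test_fun_smooth[OF test_chi]])
  have [measurable]: "w \<in> borel_measurable borel" "chi \<in> borel_measurable borel"
    using w(6) test_fun_measurable[OF test_chi] by (auto dest: loc_int_measurable)
  define q where "q x = (U x *v w x) \<bullet> w x" for x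
  have qi: "integrable lborel q" using w(5) by (simp add: q_def[abs_def])
  then have [measurable]: "q \<in> borel_measurable borel" by simp
  define s where "s n = 1 / real (Suc n)" for n
  have s: "s \<longlonglongrightarrow> 0" unfolding s_def by (rule LIMSEQ_Suc[OF lim_1_over_n])
  have chil: "(\<lambda>n. chi (s n *\<^sub>R y)) \<longlonglongrightarrow> 1" for y
  proof -
    have "(\<lambda>n. s n *\<^sub>R y) \<longlonglongrightarrow> 0" using tendsto_scaleR[OF s tendsto_const[of y]] by simp
    from continuous_on_tendsto_compose[OF chic this] show ?thesis by (simp add: chi_zero)
  qed
  have "(\<lambda>n. LBINT x. q x * (chi (s n *\<^sub>R w x) * chi (s n *\<^sub>R x))) \<longlonglongrightarrow> (LBINT x. q x)"
  proof (rule integral_dominated_convergence[where w="\<lambda>x. (M * M) * \<bar>q x\<bar>"])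
    show "integrable lborel (\<lambda>x. (M * M) * \<bar>q x\<bar>)" using qi by (intro integrable_mult_right integrable_abs)
    have "(\<lambda>n. q x * (chi (s n *\<^sub>R w x) * chi (s n *\<^sub>R x))) \<longlonglongrightarrow> q x * (1 * 1)" for x
      by (intro tendsto_mult tendsto_const chil)
    then show "AE x in lborel. (\<lambda>n. q x * (chi (s n *\<^sub>R w x) * chi (s n *\<^sub>R x))) \<longlonglongrightarrow> q x" by simp
    have "norm (q x * (chi y * chi z)) \<le> (M * M) * \<bar>q x\<bar>" for x y z
    proof -
      have "\<bar>chi y\<bar> * \<bar>chi z\<bar> * \<bar>q x\<bar> \<le> (M * M) * \<bar>q x\<bar>"
        using M_pos by (intro mult_right_mono mult_mono chi_le) auto
      then show ?thesis by (simp add: abs_mult mult_ac)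
    qed
    then show "AE x in lborel. norm (q x * (chi (s n *\<^sub>R w x) * chi (s n *\<^sub>R x))) \<le> (M * M) * \<bar>q x\<bar>" for n
      by simp
  qed measurable
  then have "(\<lambda>n. \<bar>LBINT x. q x * (chi (s n *\<^sub>R w x) * chi (s n *\<^sub>R x))\<bar>) \<longlonglongrightarrow> \<bar>LBINT x. q x\<bar>"
    by (rule tendsto_rabs)
  moreover have "(\<lambda>n. m * transport_const * (t * sq_norm w + sq_norm F / t + sq_norm w * s n))
      \<longlonglongrightarrow> m * transport_const * (t * sq_norm w + sq_norm F / t + sq_norm w * 0)"
    by (intro tendsto_intros s)
  moreover have "\<bar>LBINT x. q x * (chi (s n *\<^sub>R w x) * chi (s n *\<^sub>R x))\<bar>
      \<le> m * transport_const * (t * sq_norm w + sq_norm F / t + sq_norm w * s n)" for n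
    using transport_bound_truncated[OF fl um m _ t, of "real (Suc n)"] by (simp add: q_def s_def)
  ultimately have "\<bar>LBINT x. q x\<bar> \<le> m * transport_const * (t * sq_norm w + sq_norm F / t + sq_norm w * 0)"
    by (intro LIMSEQ_le) auto
  then show ?thesis by (simp add: q_def)
qed

subsection \<open>The energy argument\<close>

lemma L2_norm_borel:
  fixes f :: "real^'n \<Rightarrow> 'b::euclidean_space"
  assumes f: "f \<in> borel_measurable lebesgue" and g: "g \<in> borel_measurable borel" and e: "AE x in lborel. f x = g x"
  shows "(L2_norm f)\<^sup>2 = sq_norm g"
    "integrable lebesgue (\<lambda>x. (norm (f x))\<^sup>2) \<longleftrightarrow> sq_integrable g"
proof -
  have m: "(\<lambda>x. (norm (f x))\<^sup>2) \<in> borel_measurable lebesgue"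
    by (rule borel_measurable_power, rule measurable_compose[OF f]) measurable
  have mg: "(\<lambda>x. (norm (g x))\<^sup>2) \<in> borel_measurable borel"
    using g by measurable
  have e2: "AE x in lborel. (norm (f x))\<^sup>2 = (norm (g x))\<^sup>2" using e by eventually_elim simp
  show "(L2_norm f)\<^sup>2 = sq_norm g"
    unfolding L2_norm_def using lebesgue_integral_AE_lborel(1)[OF m mg e2] by simp
  show "integrable lebesgue (\<lambda>x. (norm (f x))\<^sup>2) \<longleftrightarrow> sq_integrable g"
    by (rule lebesgue_integral_AE_lborel(2)[OF m mg e2])
qed

lemma AE_lborel_not_False: "\<not> (AE x in (lborel :: 'a::euclidean_space measure). False)"
proof
  assume "AE x in (lborel :: 'a measure). False"
  then have "(\<integral>\<^sup>+x. 1 \<partial>(lborel :: 'a measure)) = (\<integral>\<^sup>+x. 0 \<partial>(lborel :: 'a measure))"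
    by (intro nn_integral_cong_AE) auto
  then show False by simp
qed

lemma Linf_norm_AE:
  fixes f :: "real^'n \<Rightarrow> 'b::euclidean_space"
  assumes "Linf_norm f = ereal l"
  shows "AE x in lborel. norm (f x) \<le> l"
proof -
  have "AE x in lebesgue. ereal (norm (f x)) \<le> ereal l"
    using esssup_AE[of "\<lambda>x. ereal (norm (f x))" lebesgue] assms by (simp add: Linf_norm_def)
  then show ?thesis by (simp add: AE_completion_iff)
qed

lemma min_norm_cases:
  fixes u :: "real^'n \<Rightarrow> real^'n"
  assumes m: "min_norm u = ereal m" "m \<noteq> 0" and F: "\<exists>F. has_weak_grad u F"
  shows "(AE x in lborel. norm (u x) \<le> m) \<or> (AE x in lborel. norm (weak_grad u x) \<le> m\<^sup>2)"
proof -
  consider "Linf_norm u = ereal m" | "sqrt_ereal (Linf_norm_grad u) = ereal m"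
    using m(1) by (auto simp: min_norm_def min_def split: if_splits)
  then show ?thesis
  proof cases
    case 1
    then show ?thesis using Linf_norm_AE by blast
  next
    case 2
    then have m': "m = sqrt (real_of_ereal (Linf_norm_grad u))" "Linf_norm_grad u \<noteq> \<infinity>"
      by (auto simp: sqrt_ereal_def split: if_splits)
    \<comment> \<open>The value -\<infinity> would be read as 0 by \<open>real_of_ereal\<close>,
      which \<open>m \<noteq> 0\<close> excludes.\<close>
    with m(2) obtain l where l: "Linf_norm_grad u = ereal l" by (cases "Linf_norm_grad u") auto
    have "Linf_norm (weak_grad u) = ereal l" using l F by (simp add: Linf_norm_grad_def)
    then have "AE x in lborel. norm (weak_grad u x) \<le> l" by (rule Linf_norm_AE)
    \<comment> \<open>The real square root is odd, so squaring gives |l|; the inequality holds for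
      either sign of \<open>l\<close>.\<close>
    moreover have "l \<le> m\<^sup>2" using m'(1) l by (simp add: real_sqrt_abs2 flip: real_sqrt_power) 
    ultimately have "AE x in lborel. norm (weak_grad u x) \<le> m\<^sup>2" by (auto elim!: eventually_mono)
    then show ?thesis ..
  qed
qed

text \<open>The 2 comes from the case of bounded gradient, where twice the transport term is at most
  2 m^2 W. The other summand comes from the case of bounded velocity; adding them covers
  both.\<close>

definition (in bounded_cutoff) energy_const :: real where
  "energy_const = 2 + 4 * transport_const\<^sup>2"

lemma (in bounded_cutoff) energy_bound:
  fixes w :: "real^'n \<Rightarrow> real^'n"
  assumes fl: "flow w F u U"
    and um: "(AE x in lborel. norm (u x) \<le> m) \<or> (AE x in lborel. norm (U x) \<le> m\<^sup>2)" and m0: "m \<noteq> 0"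
    and D: "D + 2 * sq_norm F \<le> - 2 * (LBINT x. (U x *v w x) \<bullet> w x)"
  shows "D + sq_norm F \<le> energy_const * m\<^sup>2 * sq_norm w"
proof -
  note wi = flowD(3)[OF fl] and Ui = flowD(5)[OF fl]
  define a where "a = transport_const"
  have a: "a > 0" using transport_const_pos by (simp add: a_def)
  define W where "W = sq_norm w"
  define E where "E = sq_norm F"
  define I where "I = (LBINT x. (U x *v w x) \<bullet> w x)"
  have W: "W \<ge> 0" and E: "E \<ge> 0" by (simp_all add: W_def E_def)
  from um have "2 * \<bar>I\<bar> \<le> (2 + 4 * a\<^sup>2) * m\<^sup>2 * W + E"
  proof
    assume um: "AE x in lborel. norm (u x) \<le> m"
    \<comment> \<open>Lebesgue measure is not the zero measure, so a norm cannot be bounded by a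
      negative number almost everywhere.\<close>
    have "m \<ge> 0"
    proof (rule ccontr)
      assume "\<not> m \<ge> 0"
      then have "AE x in (lborel :: (real^'n) measure). False"
        using um by (auto elim!: eventually_mono) (smt (verit) norm_ge_zero)
      then show False using AE_lborel_not_False by blast
    qed
    with m0 have m: "m > 0" by simp
    \<comment> \<open>The parameter t = 2 m a makes the coefficient of \<open>E\<close> exactly 1/2.
      Twice the transport term then uses up one of the two copies of the dissipation and leaves the
      other.\<close>
    have "\<bar>I\<bar> \<le> m * a * (2 * m * a * W + E / (2 * m * a))"
      unfolding I_def W_def E_def a_def[symmetric]
        using m a transport_bound[OF fl um, of "2 * m * a"] by (simp add: a_def)
    also have "\<dots> = 2 * a\<^sup>2 * m\<^sup>2 * W + E / 2"
      using m a by (simp add: field_simps power2_eq_square)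
    finally have "2 * \<bar>I\<bar> \<le> 4 * a\<^sup>2 * m\<^sup>2 * W + E" by simp
    also have "\<dots> \<le> (2 + 4 * a\<^sup>2) * m\<^sup>2 * W + E" using W by (simp add: mult_right_mono)
    finally show ?thesis .
  next
    assume Um: "AE x in lborel. norm (U x) \<le> m\<^sup>2"
    have "\<bar>I\<bar> \<le> (LBINT x. \<bar>(U x *v w x) \<bullet> w x\<bar>)" unfolding I_def by (rule integral_abs_bound)
    also have "\<dots> \<le> (LBINT x. m\<^sup>2 * (norm (w x))\<^sup>2)"
    proof (rule integral_mono_AE[OF integrable_abs[OF Ui]])
      show "integrable lborel (\<lambda>x. m\<^sup>2 * (norm (w x))\<^sup>2)" using wi by (intro integrable_mult_right)
      show "AE x in lborel. \<bar>(U x *v w x) \<bullet> w x\<bar> \<le> m\<^sup>2 * (norm (w x))\<^sup>2"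
        using Um
      proof eventually_elim
        case (elim x)
        have "\<bar>(U x *v w x) \<bullet> w x\<bar> \<le> norm (U x *v w x) * norm (w x)" by (rule Cauchy_Schwarz_ineq2)
        also have "\<dots> \<le> (m\<^sup>2 * norm (w x)) * norm (w x)"
          using order_trans[OF norm_matrix_vector_le mult_right_mono[OF elim norm_ge_zero]]
          by (intro mult_right_mono) auto
        finally show ?case by (simp add: power2_eq_square)
      qed
    qed
    also have "\<dots> = m\<^sup>2 * W" by (simp add: W_def)
    finally have "2 * \<bar>I\<bar> \<le> 2 * m\<^sup>2 * W" by simp
    also have "\<dots> \<le> (2 + 4 * a\<^sup>2) * m\<^sup>2 * W + E"
      using W E by (intro add_increasing2 mult_right_mono) auto
    finally show ?thesis .
  qed
  moreover have "D + 2 * E \<le> 2 * \<bar>I\<bar>" using D unfolding E_def I_def by linarith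
  ultimately show ?thesis
    unfolding W_def[symmetric] E_def[symmetric] energy_const_def a_def[symmetric] by linarith
qed

text \<open>The low part and the remainder need not be orthogonal, so the factor 2 of the elementary
  inequality for |a + b|^2 takes the place of Pythagoras. Finiteness of \<open>sq_norm H\<close> is
  a consequence of the increment bound.\<close>

lemma splitting_bound:
  fixes w H :: "real^'n \<Rightarrow> real^'n"
  assumes wm [measurable]: "w \<in> borel_measurable borel" and Hm [measurable]: "H \<in> borel_measurable borel"
    and wi: "sq_integrable w" and Fi: "sq_integrable F"
    and B: "B \<ge> 0" and H: "sq_nnorm H \<le> ennreal B * sq_nnorm F"
  shows "sq_norm H \<le> B * sq_norm F"
    "sq_norm w \<le> 2 * ((LBINT x. (norm (w x - H x))\<^sup>2) + sq_norm H)"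
proof -
  define E where "E = sq_norm F"
  have E0: "E \<ge> 0" by (simp add: E_def)
  have "sq_nnorm F = ennreal E"
    unfolding E_def using Fi by (intro nn_integral_eq_integral) auto
  then have le: "sq_nnorm H \<le> ennreal (B * E)"
    using H ennreal_mult'[OF B, of E] by simp
  then have "sq_nnorm H < \<infinity>" by (rule le_less_trans) simp
  then have Hi: "sq_integrable H" by (intro integrableI_nonneg) auto
  have "ennreal (sq_norm H) \<le> ennreal (B * E)"
    using le nn_integral_eq_integral[OF Hi] by simp
  then show "sq_norm H \<le> B * sq_norm F"
    using B E0 by (subst (asm) ennreal_le_iff) (auto simp: E_def)
  have sq: "(norm (a + b))\<^sup>2 \<le> 2 * ((norm a)\<^sup>2 + (norm b)\<^sup>2)" for a b :: "real^'n"
  proof -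
    have "(norm (a + b))\<^sup>2 \<le> (norm a + norm b)\<^sup>2" by (intro power_mono norm_triangle_ineq) simp
    then show ?thesis using sum_squares_bound[of "norm a" "norm b"] by (simp add: power2_sum)
  qed
  have sq1: "(norm (w x - H x))\<^sup>2 \<le> 2 * ((norm (w x))\<^sup>2 + (norm (H x))\<^sup>2)" for x
    using sq[of "w x" "- H x"] by simp
  have Li: "integrable lborel (\<lambda>x. (norm (w x - H x))\<^sup>2)"
  proof (rule integrable_pointwise_bound)
    show "integrable lborel (\<lambda>x. 2 * ((norm (w x))\<^sup>2 + (norm (H x))\<^sup>2))" using wi Hi by simp
    show "norm ((norm (w x - H x))\<^sup>2) \<le> 2 * ((norm (w x))\<^sup>2 + (norm (H x))\<^sup>2)" for x
      using sq1[of x] by simp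
  qed measurable
  have sq2: "(norm (w x))\<^sup>2 \<le> 2 * ((norm (w x - H x))\<^sup>2 + (norm (H x))\<^sup>2)" for x
    using sq[of "w x - H x" "H x"] by simp
  have "sq_norm w \<le> (LBINT x. 2 * ((norm (w x - H x))\<^sup>2 + (norm (H x))\<^sup>2))"
    by (rule integral_mono[OF wi _ sq2]) (use Li Hi in auto)
  also have "\<dots> = 2 * ((LBINT x. (norm (w x - H x))\<^sup>2) + sq_norm H)"
    using Li Hi by simp
  finally show "sq_norm w \<le> 2 * ((LBINT x. (norm (w x - H x))\<^sup>2) + sq_norm H)" .
qed

text \<open>The summand -1 in the condition is what turns a bound on S/H into one on (S + H)/H,
  hence on all of \<open>W\<close> relative to \<open>H\<close>. The scale \<open>s\<close> then
  cancels against the \<open>1 / s\<close> in the bound on \<open>H\<close>.\<close>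

lemma ratio_bound:
  fixes S H :: real
  assumes W: "W \<le> 2 * (S + H)" and H: "H \<le> B / s * E" and Hpos: "H > 0" and s: "s > 0" and m: "m \<noteq> 0"
    and c: "c > 0" and r: "S / H \<le> c * s / m\<^sup>2 - 1"
  shows "m\<^sup>2 * W \<le> 2 * B * c * E"
proof -
  have m2: "m\<^sup>2 > 0" using m by simp
  have "S \<le> (c * s / m\<^sup>2 - 1) * H" using r Hpos by (simp add: divide_le_eq)
  then have "S + H \<le> c * s / m\<^sup>2 * H" by (simp add: algebra_simps)
  then have "m\<^sup>2 * (S + H) \<le> c * s * H" using m2 by (simp add: field_simps)
  also have "\<dots> \<le> c * s * (B / s * E)" using H c s by (intro mult_left_mono) auto
  also have "\<dots> = c * B * E" using s by simp
  finally have "m\<^sup>2 * (S + H) \<le> c * B * E" .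
  moreover have "m\<^sup>2 * W \<le> m\<^sup>2 * (2 * (S + H))" using W m2 by (intro mult_left_mono) auto
  ultimately show ?thesis by (simp add: algebra_simps)
qed

text \<open>Zero is also a weak gradient of such a \<open>w\<close>, and weak gradients are unique.
  This serves to exclude \<open>w = 0\<close> below.\<close>

lemma (in cutoff) weak_gradient_zero:
  fixes w :: "real^'n \<Rightarrow> real^'n"
  assumes w: "weak_gradient w F"
    and wi: "sq_integrable w" and z: "sq_norm w = 0"
  shows "sq_norm F = 0"
proof -
  have l: "loc_int w" using w by (simp add: weak_gradient_def)
  have [measurable]: "w \<in> borel_measurable borel" using l by (rule loc_int_measurable)
  have w0: "AE x in lborel. w x = 0"
    using integral_nonneg_eq_0_iff_AE[OF wi] z by simp
  have "weak_gradient w (\<lambda>x. 0)"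
    unfolding weak_gradient_def
  proof (intro conjI allI impI l)
    show "loc_int (\<lambda>x::real^'n. 0::real^'n^'n)" by (rule integrable_loc_int) simp
    fix g :: "real^'n \<Rightarrow> real" and i j assume g: "test_fun UNIV g"
    have "(LBINT x. w x $ i * pderiv_dir (axis j 1) g x) = 0"
      by (rule integral_eq_zero_AE) (use w0 in \<open>auto elim!: eventually_mono\<close>)
    then show "(LBINT x. w x $ i * pderiv_dir (axis j 1) g x) = - (LBINT x. (0::real^'n^'n) $ i $ j * g x)"
      by simp
  qed
  from weak_gradient_unique[OF w this] have "AE x in lborel. F x = 0" .
  then show ?thesis by (intro integral_eq_zero_AE) (auto elim!: eventually_mono)
qed

text \<open>The two alternatives differ only in the projection and in the inverse squared length,
  2^(2J) or h^(-2). The denominators are required to be nonzero because a quotient by 0 would count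
  as 0.\<close>

definition resolved :: "(real^'n \<Rightarrow> real) \<Rightarrow> real \<Rightarrow> real \<Rightarrow> (real^'n \<Rightarrow> real^'n) \<Rightarrow> bool" where
  "resolved chi c m f \<longleftrightarrow>
     (\<exists>J::int. L2_norm (lp_high chi J f) \<noteq> 0 \<and>
         (L2_norm (lp_low chi J f))\<^sup>2 / (L2_norm (lp_high chi J f))\<^sup>2 \<le> c * 2 powi (2 * J) / m\<^sup>2 - 1) \<or>
     (\<exists>h>0. L2_norm (\<lambda>x. f x - cube_interp h f x) \<noteq> 0 \<and>
         (L2_norm (cube_interp h f))\<^sup>2 / (L2_norm (\<lambda>x. f x - cube_interp h f x))\<^sup>2 \<le> c * h powi (-2) / m\<^sup>2 - 1)"

text \<open>The constants of \<open>lp_low_estimate\<close> and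
  \<open>cube_average_estimate\<close>, added to serve both alternatives; the leading 2 comes from
  \<open>splitting_bound\<close>.\<close>

definition (in cutoff) resolution_const :: real where
  "resolution_const = 2 * ((LBINT x. \<bar>lp_profile chi x\<bar>) * (LBINT x. (norm x)\<^sup>2 * \<bar>lp_profile chi x\<bar>)
     + real CARD('n) * 2 ^ CARD('n))"

lemma (in cutoff) resolution_const_pos: "resolution_const > 0"
  by (simp add: resolution_const_def add_nonneg_pos)

lemma (in cutoff) resolved_estimate:
  fixes f w :: "real^'n \<Rightarrow> real^'n"
  assumes f: "f \<in> borel_measurable lebesgue" and w: "weak_gradient w F" and e: "AE x in lborel. f x = w x"
    and wi: "sq_integrable w" and Fi: "sq_integrable F" and c: "c > 0" and m: "m \<noteq> 0"
    and cond: "resolved chi c m f"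
  shows "m\<^sup>2 * sq_norm w \<le> resolution_const * c * sq_norm F \<and> sq_norm w > 0"
proof -
  note chi = test_chi
  define B1 where "B1 = (LBINT x. \<bar>lp_profile chi x\<bar>) * (LBINT x. (norm x)\<^sup>2 * \<bar>lp_profile chi x\<bar>)"
  define B2 where "B2 = real CARD('n) * 2 ^ CARD('n)"
  have B1: "B1 \<ge> 0" and B2: "B2 > 0" by (simp_all add: B1_def B2_def)
  define B where "B = B1 + B2"
  have B: "B > 0" "B1 \<le> B" "B2 \<le> B" using B1 B2 by (auto simp: B_def)
  have wm [measurable]: "w \<in> borel_measurable borel" using w by (auto simp: weak_gradient_def loc_int_def)
  define W where "W = sq_norm w"
  define E where "E = sq_norm F"
  have E0: "E \<ge> 0" by (simp add: E_def)
  \<comment> \<open>Common to both alternatives: \<open>L\<close> is the projection of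
    \<open>w\<close>, and \<open>s\<close> is 2^(2J) or h^(-2).\<close>
  have key: "m\<^sup>2 * W \<le> 2 * B * c * E \<and> W > 0"
    if L: "L \<in> borel_measurable borel" and s: "s > 0" and Bs: "B' \<le> B" "B' \<ge> 0"
      and est: "(\<integral>\<^sup>+x. ennreal ((norm (w x - L x))\<^sup>2) \<partial>lborel) \<le> ennreal (B' / s) * sq_nnorm F"
      and nz: "L2_norm (\<lambda>x. f x - L x) \<noteq> 0"
      and r: "(L2_norm L)\<^sup>2 / (L2_norm (\<lambda>x. f x - L x))\<^sup>2 \<le> c * s / m\<^sup>2 - 1" for L :: "real^'n \<Rightarrow> real^'n" and s B'
  proof -
    have Lm: "L \<in> borel_measurable lebesgue" using L by (simp add: measurable_completion)
    have eH: "AE x in lborel. f x - L x = w x - L x" using e by eventually_elim simp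
    have Hm: "(\<lambda>x. w x - L x) \<in> borel_measurable borel" using L wm by measurable
    have fH: "(\<lambda>x. f x - L x) \<in> borel_measurable lebesgue" by (intro borel_measurable_diff f Lm)
    define H where "H = (L2_norm (\<lambda>x. f x - L x))\<^sup>2"
    define S where "S = (L2_norm L)\<^sup>2"
    have Hpos: "H > 0" using nz by (simp add: H_def)
    have He: "H = (LBINT x. (norm (w x - L x))\<^sup>2)" unfolding H_def by (rule L2_norm_borel(1)[OF fH Hm eH])
    have Se: "S = sq_norm L" unfolding S_def by (rule L2_norm_borel(1)[OF Lm L]) simp
    have Bs0: "B' / s \<ge> 0" using Bs s by simp
    note sp = splitting_bound[OF wm Hm wi Fi Bs0 est]
    have W: "W \<le> 2 * (S + H)" using sp(2) by (simp add: W_def He Se)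
    have "H \<le> B' / s * E" using sp(1) by (simp add: He E_def)
    also have "\<dots> \<le> B / s * E" using Bs s E0 by (intro mult_right_mono divide_right_mono) auto
    finally have HB: "H \<le> B / s * E" .
    have "m\<^sup>2 * W \<le> 2 * B * c * E"
      by (rule ratio_bound[OF W HB Hpos s m c]) (use r in \<open>simp add: S_def H_def\<close>)
    \<comment> \<open>If \<open>w\<close> vanished, so would its gradient and then \<open>H\<close>,
      against the nonzero denominator. Positivity of \<open>W\<close> is what makes the final
      inequality strict.\<close>
    moreover have "W \<noteq> 0"
    proof
      assume "W = 0"
      then have "E = 0" unfolding E_def using weak_gradient_zero[OF w wi] by (simp add: W_def)
      then show False using HB Hpos by simp
    qed
    then have "W > 0" by (simp add: W_def less_le)
    ultimately show ?thesis by simp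
  qed
  from cond have "m\<^sup>2 * W \<le> 2 * B * c * E \<and> W > 0"
    unfolding resolved_def
  proof (elim disjE exE conjE)
    fix J :: int
    assume nz: "L2_norm (lp_high chi J f) \<noteq> 0"
      and r: "(L2_norm (lp_low chi J f))\<^sup>2 / (L2_norm (lp_high chi J f))\<^sup>2 \<le> c * 2 powi (2 * J) / m\<^sup>2 - 1"
    let ?L = "conv (lp_kernel chi (2 powi (J + 1))) w"
    have low: "lp_low chi J f = ?L" using lp_low_eq[OF chi f wm e wi] by auto
    have high: "lp_high chi J f = (\<lambda>x. f x - ?L x)" by (auto simp: lp_high_def low)
    have s: "(2::real) powi (2 * J) = (2 powi J)\<^sup>2" by (simp add: power_int_mult mult.commute[of 2 J])
    \<comment> \<open>The sum of the blocks up to \<open>J\<close> has its kernel at frequency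
      2^(J+1), a gain of 4 over 2^(2J); hence \<open>B1 / 4\<close> below.\<close>
    have pw: "((2::real) powi (J + 1))\<^sup>2 = 4 * 2 powi (2 * J)"
      by (simp add: s power_int_add power_mult_distrib)
    show ?thesis
    proof (rule key[of ?L "2 powi (2 * J)" "B1 / 4"])
      show "?L \<in> borel_measurable borel" by (intro conv_kernel_measurable lp_kernel_measurable chi wm)
      have c4: "B1 / 4 / 2 powi (2 * J) = B1 / ((2::real) powi (J + 1))\<^sup>2" by (simp add: pw)
      show "(\<integral>\<^sup>+x. ennreal ((norm (w x - ?L x))\<^sup>2) \<partial>lborel) \<le> ennreal (B1 / 4 / 2 powi (2 * J)) * sq_nnorm F"
        unfolding c4 by (rule lp_low_estimate[OF w _ wi, folded B1_def]; simp)
    qed (use B B1 nz r in \<open>simp_all add: high low\<close>)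
  next
    fix h :: real
    assume h: "h > 0" and nz: "L2_norm (\<lambda>x. f x - cube_interp h f x) \<noteq> 0"
      and r: "(L2_norm (cube_interp h f))\<^sup>2 / (L2_norm (\<lambda>x. f x - cube_interp h f x))\<^sup>2 \<le> c * h powi (-2) / m\<^sup>2 - 1"
    let ?L = "\<lambda>x. LBINT y. ((if same_cell h x y then 1 else 0) / h ^ CARD('n)) *\<^sub>R w y"
    have L: "cube_interp h f = ?L" using cube_interp_eq[OF h f wm e] by auto
    have hp: "h powi (-2) = 1 / h\<^sup>2" using h by (simp add: power_int_minus divide_inverse)
    show ?thesis
    proof (rule key[of ?L "h powi (-2)" B2])
      show "?L \<in> borel_measurable borel" by (rule cube_average_measurable[OF wm])
      show "(\<integral>\<^sup>+x. ennreal ((norm (w x - ?L x))\<^sup>2) \<partial>lborel) \<le> ennreal (B2 / h powi (-2)) * sq_nnorm F"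
        using cube_average_estimate[OF w h] by (simp add: hp B2_def)
      show "L2_norm (\<lambda>x. f x - ?L x) \<noteq> 0" using nz unfolding L .
      show "(L2_norm ?L)\<^sup>2 / (L2_norm (\<lambda>x. f x - ?L x))\<^sup>2 \<le> c * h powi (-2) / m\<^sup>2 - 1" using r unfolding L .
    qed (use B B2 h in auto)
  qed
  then show ?thesis
    by (simp add: W_def E_def resolution_const_def B_def B1_def B2_def)
qed

lemma has_weak_grad_weak_grad: "\<exists>F. has_weak_grad f F \<Longrightarrow> has_weak_grad f (weak_grad f)"
  unfolding weak_grad_def using someI_ex[of "has_weak_grad f"] by simp

text \<open>The transfer point: \<open>w\<close>, \<open>u\<close> and their gradients at time
  \<open>t\<close> are replaced by Borel representatives, after which the energy bound gives an
  upper bound for the dissipation and the resolution estimate a lower one. The dissipation is then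
  eliminated.\<close>

lemma (in bounded_cutoff) fixed_time_bound:
  fixes u w :: "real \<Rightarrow> real^'n \<Rightarrow> real^'n"
  assumes en: "energy_ineq_at G u w t D" and mn: "min_norm (u t) = ereal m" and m: "m \<noteq> 0" and c: "c > 0"
    and cond: "resolved chi c m (w t)"
  shows "m\<^sup>2 * (L2_norm (w t))\<^sup>2 \<le> resolution_const * c * (energy_const * m\<^sup>2 * (L2_norm (w t))\<^sup>2 - D)"
    "(L2_norm (w t))\<^sup>2 > 0"
proof -
  have H1: "in_H1 (w t)" and uF: "\<exists>F. has_weak_grad (u t) F"
    and ui: "integrable lebesgue (\<lambda>x. (weak_grad (u t) x *v w t x) \<bullet> w t x)"
    and D: "D + 2 * (L2_norm (weak_grad (w t)))\<^sup>2 \<le> - 2 * (LINT x|lebesgue. (weak_grad (u t) x *v w t x) \<bullet> w t x)"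
    using en by (auto simp: energy_ineq_at_def)
  obtain F0 where F0: "has_weak_grad (w t) F0" "in_L2 F0" using H1 by (auto simp: in_H1_def)
  have wg: "has_weak_grad (w t) (weak_grad (w t))" using F0(1) has_weak_grad_weak_grad by blast
  have ug: "has_weak_grad (u t) (weak_grad (u t))" using uF has_weak_grad_weak_grad by blast
  have meas: "f \<in> borel_measurable lebesgue" "F \<in> borel_measurable lebesgue" if "has_weak_grad f F" for f :: "real^'n \<Rightarrow> real^'n" and F
    using that loc_integrable_measurable by (auto simp: has_weak_grad_def)
  obtain w' where w': "w' \<in> borel_measurable borel" "AE x in lborel. w t x = w' x"
    using borel_version[OF meas(1)[OF wg]] by blast
  obtain F' where F': "F' \<in> borel_measurable borel" "AE x in lborel. weak_grad (w t) x = F' x"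
    using borel_version[OF meas(2)[OF wg]] by blast
  obtain F0' where F0': "F0' \<in> borel_measurable borel" "AE x in lborel. F0 x = F0' x"
    using borel_version[OF meas(2)[OF F0(1)]] by blast
  obtain u' where u': "u' \<in> borel_measurable borel" "AE x in lborel. u t x = u' x"
    using borel_version[OF meas(1)[OF ug]] by blast
  obtain U' where U': "U' \<in> borel_measurable borel" "AE x in lborel. weak_grad (u t) x = U' x"
    using borel_version[OF meas(2)[OF ug]] by blast
  have wF: "weak_gradient w' F'" by (rule has_weak_grad_borel[OF wg w' F'])
  have wF0: "weak_gradient w' F0'" by (rule has_weak_grad_borel[OF F0(1) w' F0'])
  have uU: "weak_gradient u' U'" by (rule has_weak_grad_borel[OF ug u' U'])
  have wi: "sq_integrable w'" and We: "(L2_norm (w t))\<^sup>2 = sq_norm w'"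
    using L2_norm_borel[OF meas(1)[OF wg] w'] H1 by (simp_all add: in_H1_def in_L2_def)
  have F0i: "sq_integrable F0'"
    using L2_norm_borel(2)[OF meas(2)[OF F0(1)] F0'] F0(2) by (simp add: in_L2_def)
  \<comment> \<open>Square integrability is known for the gradient from \<open>in_H1\<close>;
    uniqueness hands it to the chosen one.\<close>
  have "AE x in lborel. (norm (F0' x))\<^sup>2 = (norm (F' x))\<^sup>2"
    using weak_gradient_unique[OF wF wF0] by (auto elim!: eventually_mono)
  moreover have "(\<lambda>x. (norm (F' x))\<^sup>2) \<in> borel_measurable lborel" using F'(1) by measurable
  ultimately have Fi: "sq_integrable F'"
    using F0i by (subst integrable_cong_AE[symmetric]) auto
  have Ee: "(L2_norm (weak_grad (w t)))\<^sup>2 = sq_norm F'"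
    by (rule L2_norm_borel(1)[OF meas(2)[OF wg] F'])
  have qe: "AE x in lborel. (weak_grad (u t) x *v w t x) \<bullet> w t x = (U' x *v w' x) \<bullet> w' x"
    using U'(2) w'(2) by eventually_elim simp
  have qm: "(\<lambda>x. (U' x *v w' x) \<bullet> w' x) \<in> borel_measurable borel"
    unfolding quadratic_form_sum[symmetric] using U'(1) w'(1) by measurable
  note q = lebesgue_integral_AE_lborel[OF borel_measurable_integrable[OF ui] qm qe]
  have mm: "(AE x in lborel. norm (u' x) \<le> m) \<or> (AE x in lborel. norm (U' x) \<le> m\<^sup>2)"
    using min_norm_cases[OF mn m uF]
  proof
    assume "AE x in lborel. norm (u t x) \<le> m"
    with u'(2) have "AE x in lborel. norm (u' x) \<le> m" by eventually_elim simp
    then show ?thesis ..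
  next
    assume "AE x in lborel. norm (weak_grad (u t) x) \<le> m\<^sup>2"
    with U'(2) have "AE x in lborel. norm (U' x) \<le> m\<^sup>2" by eventually_elim simp
    then show ?thesis ..
  qed
  have fl: "flow w' F' u' U'" using wF uU wi Fi ui q by (simp add: flow_def)
  have DE: "D + sq_norm F' \<le> energy_const * m\<^sup>2 * sq_norm w'"
    using D q by (intro energy_bound[OF fl mm m]) (simp add: Ee)
  have BE: "m\<^sup>2 * sq_norm w' \<le> resolution_const * c * sq_norm F'" "sq_norm w' > 0"
    using resolved_estimate[OF meas(1)[OF wg] wF w'(2) wi Fi c m cond] by auto
  have "resolution_const * c * sq_norm F' \<le> resolution_const * c * (energy_const * m\<^sup>2 * sq_norm w' - D)"
    using DE resolution_const_pos c by (intro mult_left_mono) auto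
  then show "m\<^sup>2 * (L2_norm (w t))\<^sup>2 \<le> resolution_const * c * (energy_const * m\<^sup>2 * (L2_norm (w t))\<^sup>2 - D)"
    "(L2_norm (w t))\<^sup>2 > 0"
    using BE by (simp_all add: We)
qed

text \<open>With x = m^2 W and this \<open>c\<close>, the bound reads 4 K' x \<le> K x - D at worst,
  so D \<le> -3 K' x. The added term equals 2 K' x, which leaves the margin K' x > 0.\<close>

lemma decay_of_bound:
  fixes W m D :: real
  assumes b: "m\<^sup>2 * W \<le> A * c * (K * m\<^sup>2 * W - D)" and W: "W > 0" and m: "m \<noteq> 0"
    and A: "0 < A" "A \<le> A'" and K: "0 < K" "K \<le> K'" and c: "c = 1 / (4 * A' * K')"
  shows "D + (1 / A') * m\<^sup>2 / (2 * c) * W < 0"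
proof -
  define x where "x = m\<^sup>2 * W"
  have x: "x > 0" using W m by (simp add: x_def)
  have A': "A' > 0" and K': "K' > 0" using A K by auto
  have c0: "c > 0" using A' K' by (simp add: c)
  have "x \<le> A * c * (K * x - D)" using b by (simp add: x_def mult.assoc)
  then have "x / (A * c) \<le> K * x - D" using A c0 by (simp add: divide_le_eq mult.commute)
  moreover have "x / (A' * c) \<le> x / (A * c)"
    using A A' c0 x by (intro divide_left_mono mult_right_mono) auto
  moreover have "x / (A' * c) = 4 * K' * x" using A' K' by (simp add: c)
  moreover have "K * x \<le> K' * x" using K x by simp
  moreover have "(1 / A') * m\<^sup>2 / (2 * c) * W = 2 * K' * x" using A' K' by (simp add: c x_def)
  moreover have "K' * x > 0" using K' x by simp
  ultimately show ?thesis by linarith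
qed

text \<open>\<open>A\<close> and \<open>K\<close> need only dominate the constants of this dimension
  and cutoff, so that the same c5 and C can be used for both dimensions.\<close>

lemma (in bounded_cutoff) decay:
  assumes A: "resolution_const \<le> A" and K: "energy_const \<le> K" and c: "c = 1 / (4 * A * K)"
  shows "\<forall>T (u :: real \<Rightarrow> real^'n \<Rightarrow> real^'n) v w G D.
        T > 0 \<and> ns_solution T u \<and> ns_solution T v \<and> w = (\<lambda>t x. u t x - v t x) \<and>
        in_LinfL2_L2H1 T w \<and> energy_inequality T G u w D \<longrightarrow>
        (\<forall>t\<in>G. \<forall>m. min_norm (u t) = ereal m \<and> m \<noteq> 0 \<and>
           ((\<exists>J::int. L2_norm (lp_high chi J (w t)) \<noteq> 0 \<and>
               (L2_norm (lp_low chi J (w t)))\<^sup>2 / (L2_norm (lp_high chi J (w t)))\<^sup>2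
                 \<le> c * 2 powi (2 * J) / m\<^sup>2 - 1 \<and>
               2 powi (2 * J) \<ge> m\<^sup>2 / c) \<or>
            (\<exists>h>0. L2_norm (\<lambda>x. w t x - cube_interp h (w t) x) \<noteq> 0 \<and>
               (L2_norm (cube_interp h (w t)))\<^sup>2 / (L2_norm (\<lambda>x. w t x - cube_interp h (w t) x))\<^sup>2
                 \<le> c * h powi (-2) / m\<^sup>2 - 1 \<and>
               h powi (-2) \<ge> m\<^sup>2 / c)) \<longrightarrow>
           D t + (1 / A) * m\<^sup>2 / (2 * c) * (L2_norm (w t))\<^sup>2 < 0)"
proof (intro allI impI ballI, goal_cases)
  case (1 T u v w G D t m)
  then have "energy_inequality T G u w D" "t \<in> G" and mn: "min_norm (u t) = ereal m" and m: "m \<noteq> 0" by blast+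
  then have en: "energy_ineq_at G u w t (D t)" by (simp add: energy_inequality_def)
  have K0: "energy_const > 0" by (simp add: energy_const_def add_pos_nonneg)
  have "resolved chi c m (w t)" unfolding resolved_def using 1 by blast
  moreover have "c > 0" using A K resolution_const_pos K0 by (simp add: c)
  ultimately show ?case
    using fixed_time_bound[OF en mn m] decay_of_bound[OF _ _ m resolution_const_pos A K0 K c] by blast
qed

theorem theorem1p5:
  fixes chi2 :: "real^2 \<Rightarrow> real" and chi3 :: "real^3 \<Rightarrow> real"
  assumes "lp_cutoff chi2" and "lp_cutoff chi3"
  shows "\<exists>c5>0. \<exists>C>0.
     (\<forall>T (u :: real \<Rightarrow> real^2 \<Rightarrow> real^2) v w G D.
        T > 0 \<and> ns_solution T u \<and> ns_solution T v \<and> w = (\<lambda>t x. u t x - v t x) \<and>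
        in_LinfL2_L2H1 T w \<and> energy_inequality T G u w D \<longrightarrow>
        (\<forall>t\<in>G. \<forall>m. min_norm (u t) = ereal m \<and> m \<noteq> 0 \<and>
           ((\<exists>J::int. L2_norm (lp_high chi2 J (w t)) \<noteq> 0 \<and>
               (L2_norm (lp_low chi2 J (w t)))\<^sup>2 / (L2_norm (lp_high chi2 J (w t)))\<^sup>2
                 \<le> c5 * 2 powi (2 * J) / m\<^sup>2 - 1 \<and>
               2 powi (2 * J) \<ge> m\<^sup>2 / c5) \<or>
            (\<exists>h>0. L2_norm (\<lambda>x. w t x - cube_interp h (w t) x) \<noteq> 0 \<and>
               (L2_norm (cube_interp h (w t)))\<^sup>2 / (L2_norm (\<lambda>x. w t x - cube_interp h (w t) x))\<^sup>2
                 \<le> c5 * h powi (-2) / m\<^sup>2 - 1 \<and>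
               h powi (-2) \<ge> m\<^sup>2 / c5)) \<longrightarrow>
           D t + C * m\<^sup>2 / (2 * c5) * (L2_norm (w t))\<^sup>2 < 0))
     \<and>
     (\<forall>T (u :: real \<Rightarrow> real^3 \<Rightarrow> real^3) v w G D.
        T > 0 \<and> ns_solution T u \<and> ns_solution T v \<and> w = (\<lambda>t x. u t x - v t x) \<and>
        in_LinfL2_L2H1 T w \<and> energy_inequality T G u w D \<longrightarrow>
        (\<forall>t\<in>G. \<forall>m. min_norm (u t) = ereal m \<and> m \<noteq> 0 \<and>
           ((\<exists>J::int. L2_norm (lp_high chi3 J (w t)) \<noteq> 0 \<and>
               (L2_norm (lp_low chi3 J (w t)))\<^sup>2 / (L2_norm (lp_high chi3 J (w t)))\<^sup>2
                 \<le> c5 * 2 powi (2 * J) / m\<^sup>2 - 1 \<and>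
               2 powi (2 * J) \<ge> m\<^sup>2 / c5) \<or>
            (\<exists>h>0. L2_norm (\<lambda>x. w t x - cube_interp h (w t) x) \<noteq> 0 \<and>
               (L2_norm (cube_interp h (w t)))\<^sup>2 / (L2_norm (\<lambda>x. w t x - cube_interp h (w t) x))\<^sup>2
                 \<le> c5 * h powi (-2) / m\<^sup>2 - 1 \<and>
               h powi (-2) \<ge> m\<^sup>2 / c5)) \<longrightarrow>
           D t + C * m\<^sup>2 / (2 * c5) * (L2_norm (w t))\<^sup>2 < 0))"
proof -
  obtain M2 where "bounded_cutoff chi2 M2"
    using cutoff.bounded_cutoff_exists[OF cutoff.intro[OF assms(1)]] by blast
  moreover obtain M3 where "bounded_cutoff chi3 M3"
    using cutoff.bounded_cutoff_exists[OF cutoff.intro[OF assms(2)]] by blast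
  ultimately interpret two: bounded_cutoff chi2 M2 + three: bounded_cutoff chi3 M3 .
  \<comment> \<open>Maxima over the two dimensions make c5 and C common to d = 2 and d = 3.\<close>
  define A where "A = max two.resolution_const three.resolution_const"
  define K where "K = max two.energy_const three.energy_const"
  define c where "c = 1 / (4 * A * K)"
  have le: "two.resolution_const \<le> A" "three.resolution_const \<le> A" "two.energy_const \<le> K" "three.energy_const \<le> K"
    by (auto simp: A_def K_def)
  have "two.energy_const > 0" by (simp add: two.energy_const_def add_pos_nonneg)
  then have pos: "1 / A > 0" "c > 0" using le two.resolution_const_pos by (auto simp: c_def)
  show ?thesis
    by (rule exI[of _ c], rule conjI[OF pos(2)], rule exI[of _ "1 / A"], rule conjI[OF pos(1)], rule conjI)
      (rule two.decay[OF le(1,3) c_def] three.decay[OF le(2,4) c_def])+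
qed

end
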